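(* Let $n\geq 4$ be an even integer, let $u\in C^\infty(\mathbb{R}^n)$, and suppose that $g=e^{2u}|dx|^2$ is a complete conformal metric on $\mathbb{R}^n$. Suppose that the $n$th-order $Q$-curvature $Q^{(n)}_g$ and the scalar curvature $R_g$ are both non-negative on $\mathbb{R}^n$. Then the Ricci curvature $Ric_g$ is non-negative.
   Context: $|dx|^2$ is the Euclidean metric on $\mathbb{R}^n$ and $\Delta$ the Euclidean Laplacian. The $n$th-order $Q$-curvature $Q^{(n)}_g$ of $g=e^{2u}|dx|^2$ is defined by $(-\Delta)^{n/2}u=Q^{(n)}_g e^{nu}$. *)

theory Defs
  imports "HOL-Analysis.Analysis"
begin

definition pd :: "'n::finite \<Rightarrow> (real ^ 'n \<Rightarrow> real) \<Rightarrow> real ^ 'n \<Rightarrow> real" where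
  "pd i f x = frechet_derivative f (at x) (axis i 1)"

primrec C_k :: "nat \<Rightarrow> (real ^ 'n::finite \<Rightarrow> real) \<Rightarrow> bool" where
  "C_k 0 f \<longleftrightarrow> continuous_on UNIV f"
| "C_k (Suc k) f \<longleftrightarrow> f differentiable_on UNIV \<and> (\<forall>i. C_k k (pd i f))"

definition C_inf :: "(real ^ 'n::finite \<Rightarrow> real) \<Rightarrow> bool" where
  "C_inf f \<longleftrightarrow> (\<forall>k. C_k k f)"

definition neg_laplacian :: "(real ^ 'n::finite \<Rightarrow> real) \<Rightarrow> real ^ 'n \<Rightarrow> real" where
  "neg_laplacian f x = - (\<Sum>i\<in>UNIV. pd i (pd i f) x)"


text \<open>A Riemannian metric on the coordinate space is its matrix of components
  \<open>g x $ i $ j = g(\<partial>\<^sub>i, \<partial>\<^sub>j)\<close> at the point \<open>x\<close>.\<close>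

type_synonym 'n metric_tensor = "real ^ 'n \<Rightarrow> real ^ 'n ^ 'n"

definition conformal_metric :: "(real ^ 'n::finite \<Rightarrow> real) \<Rightarrow> 'n metric_tensor" where
  "conformal_metric u x = mat (exp (2 * u x))"

text \<open>\<open>christoffel g k i j\<close> is the symbol with upper index \<open>k\<close> and lower indices \<open>i\<close>, \<open>j\<close>.\<close>

definition christoffel :: "'n::finite metric_tensor \<Rightarrow> 'n \<Rightarrow> 'n \<Rightarrow> 'n \<Rightarrow> real ^ 'n \<Rightarrow> real" where
  "christoffel g k i j x = 1 / 2 * (\<Sum>l\<in>UNIV. matrix_inv (g x) $ k $ l *
     (pd i (\<lambda>y. g y $ j $ l) x + pd j (\<lambda>y. g y $ i $ l) x - pd l (\<lambda>y. g y $ i $ j) x))"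

text \<open>\<open>riemann g l i j k\<close> is the \<open>\<partial>\<^sub>l\<close>-component of \<open>R(\<partial>\<^sub>i, \<partial>\<^sub>j)\<partial>\<^sub>k\<close>, where
  \<open>R(X, Y)Z = \<nabla>\<^sub>X \<nabla>\<^sub>Y Z - \<nabla>\<^sub>Y \<nabla>\<^sub>X Z - \<nabla>\<^bsub>[X,Y]\<^esub> Z\<close>.\<close>

definition riemann :: "'n::finite metric_tensor \<Rightarrow> 'n \<Rightarrow> 'n \<Rightarrow> 'n \<Rightarrow> 'n \<Rightarrow> real ^ 'n \<Rightarrow> real" where
  "riemann g l i j k x =
     pd i (christoffel g l j k) x - pd j (christoffel g l i k) x
     + (\<Sum>m\<in>UNIV. christoffel g l i m x * christoffel g m j k x
                  - christoffel g l j m x * christoffel g m i k x)"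

text \<open>\<open>Ric(Y, Z)\<close> is the trace of \<open>X \<mapsto> R(X, Y)Z\<close>, so round spheres have positive curvature.\<close>

definition ricci :: "'n::finite metric_tensor \<Rightarrow> real ^ 'n \<Rightarrow> real ^ 'n ^ 'n" where
  "ricci g x = (\<chi> j k. \<Sum>i\<in>UNIV. riemann g i i j k x)"

definition scalar_curvature :: "'n::finite metric_tensor \<Rightarrow> real ^ 'n \<Rightarrow> real" where
  "scalar_curvature g x = (\<Sum>i\<in>UNIV. \<Sum>j\<in>UNIV. matrix_inv (g x) $ i $ j * ricci g x $ i $ j)"

definition ricci_nonneg :: "'n::finite metric_tensor \<Rightarrow> bool" where
  "ricci_nonneg g \<longleftrightarrow> (\<forall>x v. v \<bullet> (ricci g x *v v) \<ge> 0)"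

text \<open>The function \<open>Q\<close> determined by \<open>(-\<Delta>)\<^bsup>n/2\<^esup> u = Q e\<^bsup>nu\<^esup>\<close>, where \<open>n = CARD('n)\<close> is even.\<close>

definition Q_curvature :: "(real ^ 'n::finite \<Rightarrow> real) \<Rightarrow> real ^ 'n \<Rightarrow> real" where
  "Q_curvature u x =
     (neg_laplacian ^^ (CARD('n) div 2)) u x / exp (real CARD('n) * u x)"

lemma Q_curvature_eq:
  fixes u :: "real ^ 'n::finite \<Rightarrow> real"
  shows "(neg_laplacian ^^ (CARD('n) div 2)) u x = Q_curvature u x * exp (real CARD('n) * u x)"
  by (simp add: Q_curvature_def)

text \<open>A \<open>valid_path\<close> is continuous on \<open>[0,1]\<close>, and \<open>C\<^sup>1\<close> off a finite set near which its
  derivative may be unbounded. The length is therefore a nonnegative Lebesgue integral, which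
  is \<open>\<infinity>\<close> for a non-rectifiable path; a real-valued integral would be \<open>0\<close> there.\<close>

definition riem_length :: "'n::finite metric_tensor \<Rightarrow> (real \<Rightarrow> real ^ 'n) \<Rightarrow> ennreal" where
  "riem_length g \<gamma> = (\<integral>\<^sup>+ t\<in>{0..1}.
     ennreal (sqrt (vector_derivative \<gamma> (at t) \<bullet> (g (\<gamma> t) *v vector_derivative \<gamma> (at t)))) \<partial>lborel)"

definition riem_dist :: "'n::finite metric_tensor \<Rightarrow> real ^ 'n \<Rightarrow> real ^ 'n \<Rightarrow> real" where
  "riem_dist g x y =
     enn2real (INF \<gamma>\<in>{\<gamma>. valid_path \<gamma> \<and> pathstart \<gamma> = x \<and> pathfinish \<gamma> = y}. riem_length g \<gamma>)"

definition riem_complete :: "'n::finite metric_tensor \<Rightarrow> bool" where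
  "riem_complete g \<longleftrightarrow> Metric_space.mcomplete UNIV (riem_dist g)"

end

theory Submission
  imports Defs
begin

text \<open>
  Write \<open>n = 2m\<close>, \<open>f = (-\<Delta>)\<^sup>m u \<ge> 0\<close>. The mechanism is potential-theoretic. Suppose
  \<open>u\<close> is, up to a constant, \<open>- \<integral> log |x - y| d\<mu>(y)\<close> with a positive measure \<open>\<mu>\<close> that is
  a constant multiple of \<open>f dy\<close>. Fix \<open>x\<close> and a unit vector \<open>v\<close>, and let \<open>w(y)\<close> be the
  component orthogonal to \<open>v\<close> of \<open>(y - x) / |y - x|\<^sup>2\<close>. Differentiating under the integral
  in the formula for the Ricci tensor of a conformally flat metric gives
  \<open>Ric(v, v) / (n - 2) = 2 \<integral> |w|\<^sup>2 d\<mu> - |\<integral> w d\<mu>|\<^sup>2\<close>,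
  which is nonnegative by Cauchy-Schwarz as soon as the total mass of \<open>\<mu>\<close> is at most \<open>2\<close>.

  Both the representation and the bound on the mass come from the scalar curvature. Its sign
  says \<open>\<Delta>u + (m - 1) |\<nabla>u|\<^sup>2 \<le> 0\<close>, so that \<open>exp ((m - 1) u)\<close> is positive and superharmonic and
  therefore dominates a multiple of \<open>|x|\<close> to the power \<open>2 - n\<close> at infinity: this is \<open>log_lower_bound\<close>,
  \<open>u \<ge> - 2 log |x| - C\<close>. On the other hand \<open>u\<close> itself is superharmonic, so its means are
  bounded above. Hence means of \<open>u\<close> grow at most logarithmically, which leaves no room for a
  polyharmonic polynomial besides the potential, and the constant \<open>2\<close> in the lower bound is
  exactly the admissible mass.

  To carry this out without singular integrals, all means are taken with the kernels \<open>ker\<close>,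
  proportional to the powers \<open>(\<tau> - |z|\<^sup>2)\<^sub>+\<^sup>N\<close>. They have bounded support and satisfy
  \<open>\<partial>\<^sub>\<tau> ker (N + 1) = \<Delta> ker (N + 2)\<close> (\<open>DERIV_ker\<close>), so the means of \<open>(-\<Delta>)\<^sup>j u\<close>, taken with
  \<open>N + j\<close>, are up to sign the successive derivatives of one function of the single variable
  \<open>\<tau>\<close>. The quantity \<open>taylor_at_0\<close>, the Taylor polynomial at \<open>\<tau>\<close> of that function evaluated at
  \<open>0\<close>, turns questions about \<open>u\<close> into calculus on the half-line:
  logarithmic growth forces \<open>(-\<Delta>)\<^sup>j u \<ge> 0\<close> for \<open>j \<ge> 1\<close> (\<open>nlap_nonneg\<close>), the bound on the mass
  (\<open>mass_bound\<close>), and decay of the boundary terms for the first and second derivatives of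
  \<open>u\<close>. The fundamental theorem of calculus between \<open>\<epsilon>\<close> and \<open>T\<close> then expresses these derivatives
  as integrals of \<open>f\<close> against truncated versions of the kernels \<open>z / |z|\<^sup>2\<close> and
  \<open>2 z z\<^sup>T / |z|\<^sup>4 - 1 / |z|\<^sup>2\<close>. The Cauchy-Schwarz argument survives the truncation with an
  error of order \<open>1 / T\<close> (\<open>truncated_ricci_bound\<close>), and \<open>\<epsilon> \<rightarrow> 0\<close>, \<open>T \<rightarrow> \<infinity>\<close> finishes the proof.
\<close>

section \<open>Partial derivatives\<close>

lemma pd_eq: "(f has_derivative f') (at x) \<Longrightarrow> pd i f x = f' (axis i 1)"
  unfolding pd_def using frechet_derivative_at by metis

lemma DERIV_pd_line:
  fixes f :: "real ^ 'n::finite \<Rightarrow> real"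
  assumes "f differentiable (at (x + t *\<^sub>R axis i 1))"
  shows "((\<lambda>t. f (x + t *\<^sub>R axis i 1)) has_real_derivative pd i f (x + t *\<^sub>R axis i 1)) (at t within S)"
proof -
  have D: "(f has_derivative frechet_derivative f (at (x + t *\<^sub>R axis i 1))) (at (x + t *\<^sub>R axis i 1))"
    using assms by (simp add: frechet_derivative_works)
  have "((\<lambda>t. x + t *\<^sub>R axis i 1) has_derivative (\<lambda>h. h *\<^sub>R axis i 1)) (at t within S)"
    by (auto intro!: derivative_eq_intros)
  from has_derivative_compose[OF this D]
  show ?thesis
    unfolding has_field_derivative_def pd_def
    using linear_scale[OF has_derivative_linear[OF D]]
    by (simp add: mult.commute[of _ "frechet_derivative _ _ _"] mult_commute_abs)
qed

lemma pd_const [simp]: "pd i (\<lambda>x. c) = (\<lambda>x. 0)"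
  by (rule ext, rule pd_eq[where f' = "\<lambda>_. 0", simplified]) simp

lemma pd_add:
  assumes "f differentiable (at x)" "g differentiable (at x)"
  shows "pd i (\<lambda>x. f x + g x) x = pd i f x + pd i g x"
  using assms by (subst pd_eq[OF has_derivative_add])
    (auto simp: frechet_derivative_works pd_def)

lemma pd_uminus:
  assumes "f differentiable (at x)"
  shows "pd i (\<lambda>x. - f x) x = - pd i f x"
  using assms by (subst pd_eq[OF has_derivative_minus])
    (auto simp: frechet_derivative_works pd_def)

lemma pd_diff:
  assumes "f differentiable (at x)" "g differentiable (at x)"
  shows "pd i (\<lambda>x. f x - g x) x = pd i f x - pd i g x"
  using assms by (subst pd_eq[OF has_derivative_diff])
    (auto simp: frechet_derivative_works pd_def)

lemma pd_mult:
  assumes "f differentiable (at x)" "g differentiable (at x)"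
  shows "pd i (\<lambda>x. f x * g x) x = f x * pd i g x + pd i f x * g x"
  using assms by (subst pd_eq[OF has_derivative_mult])
    (auto simp: frechet_derivative_works pd_def)

lemma pd_cmult:
  assumes "f differentiable (at x)"
  shows "pd i (\<lambda>x. c * f x) x = c * pd i f x"
  using assms by (subst pd_mult) (auto simp: )

lemma pd_sum:
  assumes "\<And>j. j \<in> A \<Longrightarrow> f j differentiable (at x)"
  shows "pd i (\<lambda>x. \<Sum>j\<in>A. f j x) x = (\<Sum>j\<in>A. pd i (f j) x)"
  using assms by (subst pd_eq[OF has_derivative_sum])
    (auto simp: frechet_derivative_works pd_def)

lemma pd_compose:
  fixes f :: "real ^ 'n::finite \<Rightarrow> real"
  assumes "f differentiable (at x)" "(g has_real_derivative g') (at (f x))"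
  shows "pd i (\<lambda>x. g (f x)) x = g' * pd i f x"
    and "(\<lambda>x. g (f x)) differentiable (at x)"
proof -
  have "(f has_derivative frechet_derivative f (at x)) (at x)"
    using assms by (simp add: frechet_derivative_works)
  from has_derivative_compose[OF this assms(2)[unfolded has_field_derivative_def]]
  have *: "((\<lambda>x. g (f x)) has_derivative (\<lambda>h. g' * frechet_derivative f (at x) h)) (at x)" .
  show "pd i (\<lambda>x. g (f x)) x = g' * pd i f x"
    using pd_eq[OF *] by (simp add: pd_def)
  show "(\<lambda>x. g (f x)) differentiable (at x)" using * by (auto simp: differentiable_def)
qed

lemma pd_translate:
  fixes f :: "real ^ 'n::finite \<Rightarrow> real"
  assumes "f differentiable (at (a + x))"
  shows "pd i (\<lambda>x. f (a + x)) x = pd i f (a + x)"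
    and "(\<lambda>x. f (a + x)) differentiable (at x)"
proof -
  have D: "(f has_derivative frechet_derivative f (at (a + x))) (at (a + x))"
    using assms by (simp add: frechet_derivative_works)
  have "((\<lambda>x. a + x) has_derivative (\<lambda>h. h)) (at x)" by (auto intro!: derivative_eq_intros)
  from has_derivative_compose[OF this D]
  have *: "((\<lambda>x. f (a + x)) has_derivative frechet_derivative f (at (a + x))) (at x)" .
  show "pd i (\<lambda>x. f (a + x)) x = pd i f (a + x)"
    using pd_eq[OF *] by (simp add: pd_def)
  show "(\<lambda>x. f (a + x)) differentiable (at x)" using * by (auto simp: differentiable_def)
qed

lemma pd_component: "pd i (\<lambda>z. z $ j) z = (if i = j then 1 else 0)"
  and differentiable_component: "(\<lambda>z. z $ j :: real) differentiable (at z)"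
proof -
  have D: "((\<lambda>z. z $ j :: real) has_derivative (\<lambda>h. h $ j)) (at z)"
    by (rule bounded_linear.has_derivative[OF bounded_linear_vec_nth]) simp
  show "pd i (\<lambda>z. z $ j) z = (if i = j then 1 else 0)"
    using pd_eq[OF D] by (simp add: axis_def)
  show "(\<lambda>z. z $ j :: real) differentiable (at z)" using D by (auto simp: differentiable_def)
qed

lemma pd_inner_self: "pd i (\<lambda>z. z \<bullet> z) z = 2 * z $ i"
  and differentiable_inner_self: "(\<lambda>z. z \<bullet> z) differentiable (at (z :: real ^ 'n::finite))"
proof -
  have D: "((\<lambda>z. z \<bullet> z) has_derivative (\<lambda>h. 2 * (z \<bullet> h))) (at z)"
    by (auto intro!: derivative_eq_intros simp: inner_commute)
  show "pd i (\<lambda>z. z \<bullet> z) z = 2 * z $ i"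
    using pd_eq[OF D] by (simp add: inner_axis)
  show "(\<lambda>z. z \<bullet> z) differentiable (at z)" using D by (auto simp: differentiable_def)
qed

section \<open>Smooth functions\<close>

lemma C_inf_differentiable: "C_inf f \<Longrightarrow> f differentiable (at x)"
  unfolding C_inf_def by (drule spec[of _ "Suc 0"]) (simp add: differentiable_on_def)

lemma C_inf_pd: "C_inf f \<Longrightarrow> C_inf (pd i f)"
  unfolding C_inf_def by (metis C_k.simps(2))

lemma C_inf_continuous: "C_inf f \<Longrightarrow> continuous_on A f"
  unfolding C_inf_def by (metis C_k.simps(1) continuous_on_subset subset_UNIV)

lemma C_inf_const: "C_inf (\<lambda>x :: real ^ 'n::finite. c)"
proof -
  have "C_k k (\<lambda>x :: real ^ 'n. c)" for k c by (induction k arbitrary: c) auto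
  then show ?thesis by (simp add: C_inf_def)
qed

lemma C_inf_add:
  fixes f g :: "real ^ 'n::finite \<Rightarrow> real"
  assumes "C_inf f" "C_inf g" shows "C_inf (\<lambda>x. f x + g x)"
proof -
  have "C_k k (\<lambda>x. f x + g x)" if "C_inf f" "C_inf g" for k and f g :: "real ^ 'n \<Rightarrow> real"
    using that
  proof (induction k arbitrary: f g)
    case 0 then show ?case by (simp add: continuous_on_add C_inf_continuous)
  next
    case (Suc k)
    have "pd i (\<lambda>x. f x + g x) = (\<lambda>x. pd i f x + pd i g x)" for i
      using pd_add C_inf_differentiable Suc.prems by blast
    then show ?case
      using Suc by (auto simp: differentiable_on_def C_inf_differentiable C_inf_pd)
  qed
  with assms show ?thesis by (intro C_inf_def[THEN iffD2] allI) blast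
qed

lemma C_inf_uminus:
  fixes f :: "real ^ 'n::finite \<Rightarrow> real"
  assumes "C_inf f" shows "C_inf (\<lambda>x. - f x)"
proof -
  have "C_k k (\<lambda>x. - f x)" if "C_inf f" for k and f :: "real ^ 'n \<Rightarrow> real"
    using that
  proof (induction k arbitrary: f)
    case 0 then show ?case by (simp add: continuous_on_minus C_inf_continuous)
  next
    case (Suc k)
    have "pd i (\<lambda>x. - f x) = (\<lambda>x. - pd i f x)" for i
      using pd_uminus C_inf_differentiable Suc.prems by blast
    then show ?case
      using Suc by (auto simp: differentiable_on_def C_inf_differentiable C_inf_pd)
  qed
  with assms show ?thesis by (intro C_inf_def[THEN iffD2] allI) blast
qed

lemma C_inf_sum:
  assumes "\<And>j. j \<in> A \<Longrightarrow> C_inf (f j)"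
  shows "C_inf (\<lambda>x. \<Sum>j\<in>A. f j x)"
  using assms by (induction A rule: infinite_finite_induct) (auto intro: C_inf_add C_inf_const)

lemma pd_translate_C_inf:
  "C_inf f \<Longrightarrow> pd i (\<lambda>x. f (a + x)) = (\<lambda>x. pd i f (a + x))"
  by (rule ext) (rule pd_translate, rule C_inf_differentiable)

lemma C_inf_translate:
  fixes f :: "real ^ 'n::finite \<Rightarrow> real"
  assumes "C_inf f" shows "C_inf (\<lambda>x. f (a + x))"
proof -
  have "C_k k (\<lambda>x. f (a + x))" if "C_inf f" for k and f :: "real ^ 'n \<Rightarrow> real"
    using that
  proof (induction k arbitrary: f)
    case 0 then show ?case
      by (auto intro!: continuous_on_compose2[OF C_inf_continuous[of f UNIV]] continuous_intros)
  next
    case (Suc k)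
    then show ?case
      by (auto simp: differentiable_on_def C_inf_differentiable C_inf_pd pd_translate_C_inf
          intro!: pd_translate(2))
  qed
  with assms show ?thesis by (intro C_inf_def[THEN iffD2] allI) blast
qed

lemma C_inf_neg_laplacian: "C_inf f \<Longrightarrow> C_inf (neg_laplacian f)"
  unfolding neg_laplacian_def by (intro C_inf_uminus C_inf_sum C_inf_pd)

lemma C_inf_neg_laplacian_power: "C_inf f \<Longrightarrow> C_inf ((neg_laplacian ^^ k) f)"
  by (induction k) (auto intro: C_inf_neg_laplacian)

lemma neg_laplacian_translate:
  "C_inf f \<Longrightarrow> neg_laplacian (\<lambda>x. f (a + x)) = (\<lambda>x. neg_laplacian f (a + x))"
  unfolding neg_laplacian_def by (simp add: pd_translate_C_inf C_inf_pd)

lemma neg_laplacian_power_translate: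
  "C_inf f \<Longrightarrow> (neg_laplacian ^^ k) (\<lambda>x. f (a + x)) = (\<lambda>x. (neg_laplacian ^^ k) f (a + x))"
  by (induction k) (auto simp: neg_laplacian_translate C_inf_neg_laplacian_power)

section \<open>Integrals of continuous functions with bounded support\<close>

definition compactly_supported :: "(real ^ 'n::finite \<Rightarrow> real) \<Rightarrow> bool" where
  "compactly_supported f \<longleftrightarrow> continuous_on UNIV f \<and> (\<exists>R. \<forall>z. R \<le> norm z \<longrightarrow> f z = 0)"

abbreviation cube :: "real \<Rightarrow> (real ^ 'n::finite) set" where
  "cube r \<equiv> cbox (\<chi> i. - r) (\<chi> i. r)"

lemma cube_iff: "z \<in> cube r \<longleftrightarrow> (\<forall>i. \<bar>z $ i\<bar> \<le> r)"
  by (auto simp: mem_box_cart abs_le_iff) (metis minus_le_iff)+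

lemma norm_le_cube: "norm z \<le> r \<Longrightarrow> z \<in> cube r"
  using component_le_norm_cart order_trans by (fastforce simp: cube_iff)

lemma integral_UNIV_superset:
  fixes f :: "real ^ 'n::finite \<Rightarrow> real"
  assumes "\<And>z. z \<notin> S \<Longrightarrow> f z = 0"
  shows "integral UNIV f = integral S f"
proof -
  have "(\<lambda>x. if x \<in> S then f x else 0) = f" using assms by auto
  then show ?thesis by (metis integral_restrict_UNIV)
qed

lemma compactly_supported_integrable:
  assumes "compactly_supported f" shows "f integrable_on UNIV"
proof -
  obtain R where R: "\<And>z. R \<le> norm z \<Longrightarrow> f z = 0" and c: "continuous_on UNIV f"
    using assms by (auto simp: compactly_supported_def)
  have "f integrable_on cube R"
    by (rule integrable_continuous) (rule continuous_on_subset[OF c], simp)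
  moreover have "f z = 0" if "z \<notin> cube R" for z
    using R[of z] norm_le_cube[of z R] that by linarith
  ultimately show ?thesis
    using integrable_on_superset by (metis subset_UNIV)
qed

lemma compactly_supported_mult: assumes "compactly_supported f" "continuous_on UNIV g" shows "compactly_supported (\<lambda>z. f z * g z)" "compactly_supported (\<lambda>z. g z * f z)"
  using assms unfolding compactly_supported_def by (auto intro!: continuous_intros)

lemma compactly_supported_add: assumes "compactly_supported f" "compactly_supported g" shows "compactly_supported (\<lambda>z. f z + g z)"
proof -
  obtain R S where "\<And>z. R \<le> norm z \<Longrightarrow> f z = 0" "\<And>z. S \<le> norm z \<Longrightarrow> g z = 0"
    using assms unfolding compactly_supported_def by blast
  then have "\<forall>z. max R S \<le> norm z \<longrightarrow> f z + g z = 0" by simp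
  with assms show ?thesis unfolding compactly_supported_def by (blast intro: continuous_on_add)
qed

text \<open>The integral of \<open>F\<close> does not change when \<open>F\<close> is translated along the \<open>i\<close>-th axis;
  differentiating this in the translation parameter gives the claim.\<close>

lemma integral_pd_eq_0:
  fixes F :: "real ^ 'n::finite \<Rightarrow> real"
  assumes F: "\<And>z. F differentiable (at z)" "continuous_on UNIV (pd i F)"
    and R: "\<And>z. R \<le> norm z \<Longrightarrow> F z = 0"
  shows "integral UNIV (pd i F) = 0"
proof -
  define Q :: "(real ^ 'n) set" where "Q = cube (\<bar>R\<bar> + 2)"
  define a :: "real ^ 'n" where "a = axis i 1"
  have contF: "continuous_on A F" for A
    by (intro differentiable_imp_continuous_on) (use F in \<open>auto simp: differentiable_on_def intro: differentiable_at_withinI\<close>)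
  have na: "norm a = 1" by (simp add: a_def)
  have const: "integral Q (\<lambda>z. F (z + t *\<^sub>R a)) = integral UNIV F" if "t \<in> {-1..1}" for t
  proof -
    have "integral Q (\<lambda>z. F (z + t *\<^sub>R a)) = integral UNIV (\<lambda>z. F (z + t *\<^sub>R a))"
    proof (rule integral_UNIV_superset[symmetric])
      fix z assume "z \<notin> Q"
      then have "norm z > \<bar>R\<bar> + 2" using norm_le_cube[of z "\<bar>R\<bar> + 2"] by (force simp: Q_def)
      moreover have "norm z \<le> norm (z + t *\<^sub>R a) + norm (t *\<^sub>R a)"
        by (metis add_diff_cancel norm_triangle_ineq4)
      ultimately show "F (z + t *\<^sub>R a) = 0" using that na by (intro R) auto
    qed
    also have "\<dots> = integral UNIV F"
    proof -
      let ?A = "cbox (\<chi> i. - (\<bar>R\<bar> + 2)) (\<chi> i. \<bar>R\<bar> + 2) :: (real ^ 'n) set"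
      let ?c = "- (t *\<^sub>R a)"
      have 1: "integral UNIV F = integral ?A F"
        by (rule integral_UNIV_superset) (use R norm_le_cube[of _ "\<bar>R\<bar> + 2"] in \<open>force\<close>)
      have *: "integral (cbox ((\<chi> i. - (\<bar>R\<bar> + 2)) - t *\<^sub>R a) ((\<chi> i. \<bar>R\<bar> + 2) - t *\<^sub>R a)) (\<lambda>z. F (z + t *\<^sub>R a))
          = integral ?A F"
        using integral_shift_cbox[of "(\<chi> i. - (\<bar>R\<bar> + 2))" "t *\<^sub>R a" "\<chi> i. \<bar>R\<bar> + 2" F]
        by simp
      have "integral UNIV (\<lambda>z. F (z + t *\<^sub>R a)) =
         integral (cbox ((\<chi> i. - (\<bar>R\<bar> + 2)) - t *\<^sub>R a) ((\<chi> i. \<bar>R\<bar> + 2) - t *\<^sub>R a)) (\<lambda>z. F (z + t *\<^sub>R a))"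
      proof (rule integral_UNIV_superset)
        fix z assume z: "z \<notin> cbox ((\<chi> i. - (\<bar>R\<bar> + 2)) - t *\<^sub>R a) ((\<chi> i. \<bar>R\<bar> + 2) - t *\<^sub>R a)"
        have "z + t *\<^sub>R a \<notin> ?A"
          using z by (simp add: mem_box_cart algebra_simps) 
        then show "F (z + t *\<^sub>R a) = 0" using R norm_le_cube[of "z + t *\<^sub>R a" "\<bar>R\<bar> + 2"] by force
      qed
      with * 1 show ?thesis by simp
    qed
    finally show ?thesis .
  qed
  have "((\<lambda>t. integral Q (\<lambda>z. F (z + t *\<^sub>R a))) has_real_derivative integral Q (\<lambda>z. pd i F (z + 0 *\<^sub>R a)))
      (at 0 within {-1..1})"
    unfolding Q_def
  proof (rule leibniz_rule_field_derivative)
    show "((\<lambda>t. F (z + t *\<^sub>R a)) has_real_derivative pd i F (z + t *\<^sub>R a)) (at t within {-1..1})" for t z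
      unfolding a_def by (rule DERIV_pd_line) (rule F)
    show "(\<lambda>z. F (z + t *\<^sub>R a)) integrable_on cube (\<bar>R\<bar> + 2)" for t
      by (intro integrable_continuous continuous_on_compose2[OF contF[of UNIV]] continuous_intros) auto
    show "continuous_on ({-1..1} \<times> cube (\<bar>R\<bar> + 2)) (\<lambda>(t, z). pd i F (z + t *\<^sub>R a))"
      unfolding split_beta
      by (intro continuous_on_compose2[OF F(2)] continuous_intros) auto
  qed auto
  from has_field_derivative_transform_within[OF this, of 1 "\<lambda>t. integral UNIV F"]
  have "((\<lambda>t. integral UNIV F) has_real_derivative integral Q (pd i F)) (at 0 within {-1..1})"
    by (simp add: const)
  moreover have "at (0::real) within {-1..1} = at 0" by (rule at_within_Icc_at) auto
  ultimately have "integral Q (pd i F) = 0"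
    using DERIV_unique DERIV_const by metis
  moreover have "integral UNIV (pd i F) = integral Q (pd i F)"
  proof (rule integral_UNIV_superset)
    fix z assume "z \<notin> Q"
    then have z: "norm z > \<bar>R\<bar> + 2" using norm_le_cube[of z "\<bar>R\<bar> + 2"] by (force simp: Q_def)
    have "(F has_derivative (\<lambda>_. 0)) (at z)"
    proof (rule has_derivative_transform_within[where d = 1])
      show "((\<lambda>_. 0) has_derivative (\<lambda>_. 0)) (at z)" by simp
      fix y assume "dist y z < 1"
      then have "norm z < norm y + 1" using norm_triangle_ineq2[of z y] by (simp add: dist_norm norm_minus_commute)
      then show "0 = F y" using z by (subst R) auto
    qed auto
    then show "pd i F z = 0" by (rule pd_eq)
  qed
  ultimately show ?thesis by simp
qed

lemma integral_by_parts_pd: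
  fixes \<phi> v :: "real ^ 'n::finite \<Rightarrow> real"
  assumes \<phi>: "\<And>z. \<phi> differentiable (at z)" "compactly_supported \<phi>" "compactly_supported (pd i \<phi>)"
    and v: "\<And>z. v differentiable (at z)" "continuous_on UNIV (pd i v)"
  shows "integral UNIV (\<lambda>z. \<phi> z * pd i v z) = - integral UNIV (\<lambda>z. pd i \<phi> z * v z)"
proof -
  have contv: "continuous_on UNIV v"
    by (intro differentiable_imp_continuous_on) (use v in \<open>auto simp: differentiable_on_def\<close>)
  have eq: "pd i (\<lambda>z. \<phi> z * v z) = (\<lambda>z. \<phi> z * pd i v z + pd i \<phi> z * v z)"
    by (rule ext) (intro pd_mult \<phi> v)
  have compactly_supported: "compactly_supported (\<lambda>z. \<phi> z * pd i v z)" "compactly_supported (\<lambda>z. pd i \<phi> z * v z)"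
    using \<phi> v contv by (auto intro: compactly_supported_mult)
  obtain R where R: "\<And>z. R \<le> norm z \<Longrightarrow> \<phi> z = 0" using \<phi>(2) by (auto simp: compactly_supported_def)
  have "integral UNIV (pd i (\<lambda>z. \<phi> z * v z)) = 0"
  proof (rule integral_pd_eq_0)
    show "(\<lambda>z. \<phi> z * v z) differentiable at z" for z using \<phi> v by simp
    show "continuous_on UNIV (pd i (\<lambda>z. \<phi> z * v z))"
      unfolding eq using compactly_supported by (auto simp: compactly_supported_def intro: continuous_on_add)
    show "\<phi> z * v z = 0" if "R \<le> norm z" for z using R that by simp
  qed
  then show ?thesis
    unfolding eq using integral_add[OF compactly_supported[THEN compactly_supported_integrable]] by simp
qed

section \<open>Averaging kernels of bounded support\<close>

text \<open>A substitute of bounded support for the heat kernel at time \<open>\<tau>\<close>. The power of \<open>\<tau>\<close> is the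
  scaling that keeps the mass constant in \<open>\<tau>\<close>; the factor \<open>4\<^sup>N N!\<close> keeps factors
  depending on \<open>N\<close> out of \<open>pd_ker\<close> and of the evolution equation \<open>DERIV_ker\<close>. Each Laplacian costs two derivatives at
  the boundary of the ball, and pays for them by a step in \<open>N\<close> when it is traded for
  \<open>\<partial>\<^sub>\<tau>\<close>.\<close>

definition ker :: "nat \<Rightarrow> real \<Rightarrow> real ^ 'n::finite \<Rightarrow> real" where
  "ker N \<tau> z = max 0 (\<tau> - z \<bullet> z) ^ N / (4 ^ N * fact N * \<tau> ^ (N + CARD('n) div 2))"

text \<open>These weighted means are centred at the origin and not normalised: the constant \<open>1\<close> has mean
  \<open>ker_mass\<close>, which depends on \<open>N\<close> but not on \<open>\<tau>\<close>.\<close>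

definition ker_avg :: "nat \<Rightarrow> real \<Rightarrow> (real ^ 'n::finite \<Rightarrow> real) \<Rightarrow> real" where
  "ker_avg N \<tau> v = integral UNIV (\<lambda>z. ker N \<tau> z * v z)"

text \<open>Only \<open>N = 1\<close> needs care at the origin; \<open>max 0 x ^ (N + 1) = x * max 0 x ^ N\<close> and the product
  rule do the rest.\<close>

lemma DERIV_max_0_power:
  assumes "N \<ge> 1"
  shows "((\<lambda>x. max 0 x ^ Suc N) has_real_derivative real (Suc N) * max 0 x ^ N) (at x)"
  using assms
proof (induction N rule: nat_induct_at_least)
  case base
  consider "x > 0" | "x < 0" | "x = 0" by linarith
  then show ?case
  proof cases
    case 1
    have "((\<lambda>x. x ^ 2) has_real_derivative 2 * x) (at x)"
      by (auto intro!: derivative_eq_intros)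
    then have "((\<lambda>x. max 0 x ^ 2) has_real_derivative 2 * x) (at x)"
      by (rule has_field_derivative_transform_within[where d = x]) (use 1 in \<open>auto simp: dist_real_def\<close>)
    then show ?thesis using 1 by (simp add: numeral_2_eq_2)
  next
    case 2
    have "((\<lambda>x. 0) has_real_derivative 0) (at x)" by simp
    then have "((\<lambda>x. max 0 x ^ 2) has_real_derivative 0) (at x)"
      by (rule has_field_derivative_transform_within[where d = "- x"]) (use 2 in \<open>auto simp: dist_real_def\<close>)
    then show ?thesis using 2 by (simp add: numeral_2_eq_2)
  next
    case 3
    have "((\<lambda>h. (max 0 (0 + h) ^ 2 - max 0 0 ^ 2) / h) \<longlongrightarrow> 0) (at (0 :: real))"
    proof (rule Lim_null_comparison)
      show "\<forall>\<^sub>F h in at 0. norm ((max 0 (0 + h) ^ 2 - max 0 0 ^ 2) / h) \<le> \<bar>h\<bar>"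
        by (rule eventuallyI) (auto simp: max_def power2_eq_square)
      show "((\<lambda>h::real. \<bar>h\<bar>) \<longlongrightarrow> 0) (at 0)" by (rule tendsto_rabs_zero) (rule tendsto_ident_at)
    qed
    then show ?thesis using 3 by (simp add: DERIV_def numeral_2_eq_2)
  qed
next
  case (Suc N)
  have "((\<lambda>x. x * max 0 x ^ Suc N) has_real_derivative
      1 * max 0 x ^ Suc N + (real (Suc N) * max 0 x ^ N) * x) (at x)"
    by (rule DERIV_mult[OF DERIV_ident Suc.IH])
  moreover have "(\<lambda>x::real. x * max 0 x ^ Suc N) = (\<lambda>x. max 0 x ^ Suc (Suc N))"
    by (rule ext) (auto simp: max_def)
  moreover have "max 0 x ^ N * x = max 0 x ^ Suc N"
    using Suc.hyps by (auto simp: max_def)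
  ultimately have "((\<lambda>x. max 0 x ^ Suc (Suc N)) has_real_derivative
      max 0 x ^ Suc N + real (Suc N) * max 0 x ^ Suc N) (at x)"
    by (simp only: mult.assoc mult_1)
  then show ?case by (simp only: of_nat_Suc[of "Suc N"] distrib_right mult_1 add.commute)
qed

lemma ker_nonneg: "\<tau> > 0 \<Longrightarrow> ker N \<tau> z \<ge> 0"
  by (simp add: ker_def)

lemma ker_eq_0: "\<tau> \<le> z \<bullet> z \<Longrightarrow> N \<ge> 1 \<Longrightarrow> ker N \<tau> z = 0"
  by (simp add: ker_def max_def)

lemma continuous_ker [continuous_intros]:
  assumes "continuous_on A f" "continuous_on A g" "\<And>x. x \<in> A \<Longrightarrow> f x > 0"
  shows "continuous_on A (\<lambda>x. ker N (f x) (g x))"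
  unfolding ker_def by (intro continuous_intros assms) (use assms(3) in force)

lemma compactly_supported_ker: assumes "\<tau> > 0" "N \<ge> 1" shows "compactly_supported (ker N \<tau>)"
  unfolding compactly_supported_def
proof
  show "continuous_on UNIV (ker N \<tau>)" using assms by (auto intro!: continuous_intros)
  show "\<exists>R. \<forall>z. R \<le> norm z \<longrightarrow> ker N \<tau> z = 0"
  proof (intro exI[of _ "sqrt \<tau>"] allI impI ker_eq_0 assms)
    fix z :: "real ^ 'n" assume "sqrt \<tau> \<le> norm z"
    then have "(sqrt \<tau>)\<^sup>2 \<le> (norm z)\<^sup>2" using assms by (intro power_mono) auto
    then show "\<tau> \<le> z \<bullet> z" using assms by (simp add: dot_square_norm)
  qed
qed

lemma pd_ker:
  fixes z :: "real ^ 'n::finite"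
  assumes "\<tau> > 0" "N \<ge> 1"
  shows "pd i (ker (Suc N) \<tau>) z = - (z $ i / (2 * \<tau>)) * ker N \<tau> z" (is ?A)
    and "ker (Suc N) \<tau> differentiable (at z)" (is ?B)
proof -
  let ?D = "4 ^ Suc N * fact (Suc N) * \<tau> ^ (Suc N + CARD('n) div 2)"
  have g: "((\<lambda>s. max 0 (\<tau> - s) ^ Suc N / ?D) has_real_derivative
      - (real (Suc N) * max 0 (\<tau> - z \<bullet> z) ^ N) / ?D) (at (z \<bullet> z))"
    by (intro DERIV_cdivide DERIV_chain2[OF DERIV_max_0_power[OF assms(2)], THEN DERIV_cong])
      (auto intro!: derivative_eq_intros)
  have k: "(ker (Suc N) \<tau> :: real ^ 'n \<Rightarrow> real) = (\<lambda>z. max 0 (\<tau> - z \<bullet> z) ^ Suc N / ?D)"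
    by (simp add: ker_def fun_eq_iff)
  show ?B unfolding k by (rule pd_compose(2)[OF differentiable_inner_self g])
  have "pd i (ker (Suc N) \<tau>) z = - (real (Suc N) * max 0 (\<tau> - z \<bullet> z) ^ N) / ?D * (2 * z $ i)"
    unfolding k by (simp only: pd_compose(1)[OF differentiable_inner_self g] pd_inner_self)
  then show ?A using assms by (simp add: ker_def divide_simps mult_ac)
qed

lemma pd_pd_ker:
  fixes z :: "real ^ 'n::finite"
  assumes "\<tau> > 0" "N \<ge> 1"
  shows "pd j (pd i (ker (N + 2) \<tau>)) z =
      z $ i * z $ j / (4 * \<tau>\<^sup>2) * ker N \<tau> z - (if i = j then 1 / (2 * \<tau>) else 0) * ker (Suc N) \<tau> z" (is ?A)
    and "pd i (ker (N + 2) \<tau>) differentiable (at z)" (is ?B)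
proof -
  have 1: "pd i (ker (N + 2) \<tau> :: real ^ 'n \<Rightarrow> real) = (\<lambda>z. (- 1 / (2 * \<tau>)) * (z $ i * ker (Suc N) \<tau> z))"
    using assms by (simp add: fun_eq_iff pd_ker(1)[of \<tau> "Suc N"])
  note d = differentiable_component pd_ker(2)[OF assms]
  show ?B unfolding 1 by (intro differentiable_mult differentiable_const d)
  show ?A unfolding 1
    by (subst pd_cmult, intro differentiable_mult d, subst pd_mult[OF d])
      (use assms in \<open>auto simp: pd_component pd_ker field_simps power2_eq_square\<close>)
qed

lemma compactly_supported_pd_ker: assumes "\<tau> > 0" "N \<ge> 1" shows "compactly_supported (pd i (ker (Suc N) \<tau> :: real ^ 'n::finite \<Rightarrow> real))"
proof -
  have "pd i (ker (Suc N) \<tau> :: real ^ 'n \<Rightarrow> real) = (\<lambda>z. (- (z $ i / (2 * \<tau>))) * ker N \<tau> z)"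
    by (simp add: fun_eq_iff pd_ker(1)[OF assms])
  then show ?thesis
    by (simp only:) (intro compactly_supported_mult compactly_supported_ker continuous_intros assms, use assms in auto)
qed

lemma compactly_supported_pd_pd_ker: assumes "\<tau> > 0" "N \<ge> 1" shows "compactly_supported (pd j (pd i (ker (N + 2) \<tau> :: real ^ 'n::finite \<Rightarrow> real)))"
proof -
  have "pd j (pd i (ker (N + 2) \<tau> :: real ^ 'n \<Rightarrow> real)) = (\<lambda>z. z $ i * z $ j / (4 * \<tau>\<^sup>2) * ker N \<tau> z +
      (- (if i = j then 1 / (2 * \<tau>) else 0)) * ker (Suc N) \<tau> z)"
    by (simp add: fun_eq_iff pd_pd_ker(1)[OF assms, simplified])
  then show ?thesis
    by (simp only:) (intro compactly_supported_add compactly_supported_mult compactly_supported_ker continuous_intros assms, use assms in auto)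
qed

text \<open>The evolution equation \<open>\<partial>\<^sub>\<tau> ker (N + 1) = \<Delta> ker (N + 2)\<close>. Both sides equal
  \<open>|z|\<^sup>2 / (4\<tau>\<^sup>2) ker N - (m / \<tau>) ker (N + 1)\<close>, where \<open>n = 2m\<close>.\<close>

lemma DERIV_ker:
  assumes "\<tau> > 0" "N \<ge> 1" "even CARD('n::finite)"
  shows "((\<lambda>\<tau>. ker (Suc N) \<tau> (z :: real ^ 'n)) has_real_derivative
      (\<Sum>i\<in>UNIV. pd i (pd i (ker (N + 2) \<tau>)) z)) (at \<tau> within S)"
proof -
  define m where "m = CARD('n) div 2"
  have n: "real CARD('n) = 2 * real m" using assms(3) by (simp add: m_def real_of_nat_div)
  define s where "s = z \<bullet> z"
  define C where "C = (4 ^ Suc N * fact (Suc N) :: real)"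
  define P where "P = max 0 (\<tau> - s)"
  have sumsq: "(\<Sum>i\<in>UNIV. z $ i * z $ i) = s"
    by (simp add: s_def inner_vec_def)
  have "((\<lambda>\<tau>. max 0 (\<tau> - s) ^ Suc N / \<tau> ^ (Suc N + m) / C) has_real_derivative
     ((real (Suc N) * P ^ N * \<tau> ^ (Suc N + m) - P ^ Suc N * (real (Suc N + m) * \<tau> ^ (N + m)))
       / (\<tau> ^ (Suc N + m) * \<tau> ^ (Suc N + m))) / C) (at \<tau> within S)"
    unfolding P_def
    apply (intro DERIV_cdivide DERIV_divide)
    subgoal
      by (rule has_field_derivative_at_within, intro DERIV_chain2[OF DERIV_max_0_power[OF assms(2)], THEN DERIV_cong])
        (auto intro!: derivative_eq_intros)
    subgoal by (rule derivative_eq_intros refl | simp)+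
    subgoal using assms by simp
    done
  also have "(\<lambda>\<tau>. max 0 (\<tau> - s) ^ Suc N / \<tau> ^ (Suc N + m) / C) = (\<lambda>\<tau>. ker (Suc N) \<tau> z)"
    by (simp add: ker_def fun_eq_iff s_def m_def C_def mult_ac)
  also have "((real (Suc N) * P ^ N * \<tau> ^ (Suc N + m) - P ^ Suc N * (real (Suc N + m) * \<tau> ^ (N + m)))
       / (\<tau> ^ (Suc N + m) * \<tau> ^ (Suc N + m))) / C
     = s / (4 * \<tau>\<^sup>2) * ker N \<tau> z - real m / \<tau> * ker (Suc N) \<tau> z"
  proof -
    have kS: "ker (Suc N) \<tau> z = P * P ^ N / (C * (\<tau> * \<tau> ^ (N + m)))"
      by (simp add: ker_def C_def P_def s_def m_def)
    have "fact N \<noteq> (0::real)" "\<tau> ^ (N + m) \<noteq> 0" using assms by auto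
    then have kN: "ker N \<tau> z = 4 * real (Suc N) * P ^ N / (C * \<tau> ^ (N + m))"
      unfolding ker_def C_def P_def s_def m_def fact_Suc power_Suc[of 4]
      by (simp only: of_nat_Suc divide_simps mult_eq_0_iff) (simp add: algebra_simps)
    have sP: "s * P ^ N = \<tau> * P ^ N - P * P ^ N"
    proof (cases "\<tau> \<le> s")
      case True then show ?thesis using assms(2) by (simp add: P_def)
    next
      case False then show ?thesis by (simp add: P_def algebra_simps)
    qed
    have "s / (4 * \<tau>\<^sup>2) * ker N \<tau> z = real (Suc N) * (s * P ^ N) / (C * \<tau>\<^sup>2 * \<tau> ^ (N + m))"
    proof -
      have "s * (4 * r * p) / (4 * t * w) = r * (s * p) / w / t" for r p t w :: real by (simp add: mult_ac)
      from this[of "real (Suc N)" "P ^ N" "\<tau>\<^sup>2" "C * \<tau> ^ (N + m)"] show ?thesis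
        unfolding kN by (simp only: times_divide_times_eq divide_divide_eq_left mult_ac)
    qed
    also have "\<dots> = real (Suc N) * (\<tau> * P ^ N - P * P ^ N) / (C * \<tau>\<^sup>2 * \<tau> ^ (N + m))"
      unfolding sP ..
    finally have sk: "s / (4 * \<tau>\<^sup>2) * ker N \<tau> z =
      real (Suc N) * (\<tau> * P ^ N - P * P ^ N) / (C * \<tau>\<^sup>2 * \<tau> ^ (N + m))" .
    have alg: "(r * p * (t * w) - (P * p) * ((r + k) * w)) / ((t * w) * (t * w)) / C
        = r * (t * p - P * p) / (C * t\<^sup>2 * w) - k / t * (P * p / (C * (t * w)))"
      if "t > 0" "w > 0" "C > 0" for r p t w k C :: real
      using that by (simp add: field_simps power2_eq_square)
    have "\<tau> ^ (N + m) > 0" "C > 0" using assms by (auto simp: C_def)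
    from alg[OF assms(1) this, of "real (Suc N)" "P ^ N" "real m"] show ?thesis
      unfolding sk kS by (simp only: power_Suc add_Suc of_nat_add[symmetric] add_Suc)
  qed
  also have "\<dots> = (\<Sum>i\<in>UNIV. pd i (pd i (ker (N + 2) \<tau>)) z)"
    unfolding pd_pd_ker(1)[OF assms(1,2)]
    by (simp add: sum_subtractf n sum_distrib_right[symmetric] sum_divide_distrib[symmetric] sumsq)
  finally show ?thesis .
qed

lemma ker_avg_integrable:
  "\<tau> > 0 \<Longrightarrow> N \<ge> 1 \<Longrightarrow> continuous_on UNIV v \<Longrightarrow> (\<lambda>z. ker N \<tau> z * v z) integrable_on UNIV"
  by (intro compactly_supported_integrable compactly_supported_mult compactly_supported_ker)

lemma ker_avg_mono:
  fixes v w :: "real ^ 'n::finite \<Rightarrow> real"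
  assumes "\<tau> > 0" "N \<ge> 1" "continuous_on UNIV v" "continuous_on UNIV w"
    "\<And>z. z \<bullet> z \<le> \<tau> \<Longrightarrow> v z \<le> w z"
  shows "ker_avg N \<tau> v \<le> ker_avg N \<tau> w"
  unfolding ker_avg_def
proof (rule integral_le)
  fix z :: "real ^ 'n"
  show "ker N \<tau> z * v z \<le> ker N \<tau> z * w z"
    using assms ker_nonneg[of \<tau> N z] ker_eq_0[of \<tau> z N]
    by (cases "z \<bullet> z \<le> \<tau>") (auto intro: mult_left_mono)
qed (use assms ker_avg_integrable in auto)

lemma ker_avg_add:
  assumes "\<tau> > 0" "N \<ge> 1" "continuous_on UNIV v" "continuous_on UNIV w"
  shows "ker_avg N \<tau> (\<lambda>z. v z + w z) = ker_avg N \<tau> v + ker_avg N \<tau> w"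
  unfolding ker_avg_def distrib_left using assms by (intro integral_add ker_avg_integrable)

lemma ker_avg_cmult: "ker_avg N \<tau> (\<lambda>z. c * v z) = c * ker_avg N \<tau> v"
  unfolding ker_avg_def by (simp add: mult.left_commute)

lemma ker_avg_nonneg:
  assumes "\<tau> > 0" "N \<ge> 1" "continuous_on UNIV v" "\<And>z. v z \<ge> 0"
  shows "ker_avg N \<tau> v \<ge> 0"
  using ker_avg_mono[of \<tau> N "\<lambda>_. 0" v] assms by (simp add: ker_avg_def)

lemma ker_avg_pd:
  assumes "\<tau> > 0" "N \<ge> 1" "C_inf v"
  shows "ker_avg (Suc N) \<tau> (pd i v) = integral UNIV (\<lambda>z. z $ i / (2 * \<tau>) * ker N \<tau> z * v z)"
proof -
  have "ker_avg (Suc N) \<tau> (pd i v) = - integral UNIV (\<lambda>z. pd i (ker (Suc N) \<tau>) z * v z)"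
    unfolding ker_avg_def using assms
    by (intro integral_by_parts_pd pd_ker compactly_supported_ker compactly_supported_pd_ker C_inf_differentiable C_inf_continuous C_inf_pd) auto
  also have "\<dots> = integral UNIV (\<lambda>z. z $ i / (2 * \<tau>) * ker N \<tau> z * v z)"
    unfolding integral_neg[symmetric] by (rule integral_cong) (simp add: pd_ker(1)[OF assms(1,2)])
  finally show ?thesis .
qed

lemma ker_avg_pd_pd:
  fixes v :: "real ^ 'n::finite \<Rightarrow> real"
  assumes "\<tau> > 0" "N \<ge> 1" "C_inf v"
  shows "ker_avg (N + 2) \<tau> (pd i (pd j v)) = integral UNIV (\<lambda>z. (z $ i * z $ j / (4 * \<tau>\<^sup>2) * ker N \<tau> z
      - (if i = j then 1 / (2 * \<tau>) else 0) * ker (Suc N) \<tau> z) * v z)"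
proof -
  have 1: "pd i (ker (N + 2) \<tau>) z = - (z $ i / (2 * \<tau>)) * ker (N + 1) \<tau> z" for z :: "real ^ 'n"
    using assms by (simp add: pd_ker(1)[of \<tau> "Suc N"])
  have d: "(ker (N + 2) \<tau> :: real ^ 'n \<Rightarrow> real) differentiable (at z)" for z
    using assms pd_ker(2)[of \<tau> "Suc N" z] by simp
  have c: "compactly_supported (pd i (ker (N + 2) \<tau> :: real ^ 'n \<Rightarrow> real))"
    using assms compactly_supported_pd_ker[of \<tau> "Suc N" i] by simp
  have "ker_avg (N + 2) \<tau> (pd i (pd j v)) = - integral UNIV (\<lambda>z. pd i (ker (N + 2) \<tau>) z * pd j v z)"
    unfolding ker_avg_def
    by (rule integral_by_parts_pd[OF d compactly_supported_ker c C_inf_differentiable C_inf_continuous])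
      (use assms in \<open>auto intro: C_inf_pd\<close>)
  also have "integral UNIV (\<lambda>z. pd i (ker (N + 2) \<tau>) z * pd j v z) =
      - integral UNIV (\<lambda>z. pd j (pd i (ker (N + 2) \<tau>)) z * v z)"
    by (rule integral_by_parts_pd[OF pd_pd_ker(2)[OF assms(1,2)] c compactly_supported_pd_pd_ker[OF assms(1,2)]
          C_inf_differentiable[OF assms(3)] C_inf_continuous[OF C_inf_pd[OF assms(3)]]])
  finally show ?thesis by (simp add: pd_pd_ker(1)[OF assms(1,2), simplified])
qed

lemma ker_avg_neg_laplacian:
  assumes "\<tau> > 0" "N \<ge> 1" "C_inf v"
  shows "- ker_avg (N + 2) \<tau> (neg_laplacian v) = integral UNIV (\<lambda>z. (\<Sum>i\<in>UNIV. pd i (pd i (ker (N + 2) \<tau>)) z) * v z)"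
proof -
  have "integral UNIV (\<lambda>z. (\<Sum>i\<in>UNIV. pd i (pd i (ker (N + 2) \<tau>)) z) * v z)
      = (\<Sum>i\<in>UNIV. integral UNIV (\<lambda>z. pd i (pd i (ker (N + 2) \<tau>)) z * v z))"
    unfolding sum_distrib_right
    by (intro integral_sum compactly_supported_integrable compactly_supported_mult(1) compactly_supported_pd_pd_ker assms C_inf_continuous[OF assms(3)]) auto
  also have "\<dots> = (\<Sum>i\<in>UNIV. ker_avg (N + 2) \<tau> (pd i (pd i v)))"
    unfolding ker_avg_pd_pd[OF assms] pd_pd_ker[OF assms(1,2)] ..
  also have "\<dots> = integral UNIV (\<lambda>z. \<Sum>i\<in>UNIV. ker (N + 2) \<tau> z * pd i (pd i v) z)"
    unfolding ker_avg_def
    by (intro integral_sum[symmetric] ker_avg_integrable C_inf_continuous C_inf_pd assms) (use assms in auto)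
  also have "\<dots> = - ker_avg (N + 2) \<tau> (neg_laplacian v)"
    by (simp add: ker_avg_def neg_laplacian_def sum_distrib_left)
  finally show ?thesis ..
qed

text \<open>The derivative falls on the kernel, becomes its Laplacian, and two integrations by parts move
  this Laplacian to \<open>v\<close>. The integral is taken over a fixed cube containing all supports for
  nearby \<open>\<tau>\<close>.\<close>

lemma DERIV_ker_avg:
  fixes v :: "real ^ 'n::finite \<Rightarrow> real"
  assumes "\<tau> > 0" "N \<ge> 2" "C_inf v" "even CARD('n)"
  shows "((\<lambda>\<tau>. ker_avg N \<tau> v) has_real_derivative - ker_avg (Suc N) \<tau> (neg_laplacian v)) (at \<tau>)"
proof -
  obtain M where N: "N = Suc M" and M: "M \<ge> 1" using assms(2) by (cases N) auto
  define Q :: "(real ^ 'n) set" where "Q = cube (sqrt (2 * \<tau>))"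
  define U where "U = {\<tau> / 2..2 * \<tau>}"
  have out: "ker (Suc K) t z = 0" if "t \<in> U" "z \<notin> Q" for t z K
  proof (rule ker_eq_0)
    have "sqrt (2 * \<tau>) < norm z" using that norm_le_cube[of z "sqrt (2 * \<tau>)"] by (force simp: Q_def)
    then have "(sqrt (2 * \<tau>))\<^sup>2 \<le> (norm z)\<^sup>2" using assms by (intro power_mono) auto
    then show "t \<le> z \<bullet> z" using that assms by (simp add: dot_square_norm U_def)
  qed simp
  have pos: "t > 0" if "t \<in> U" for t using that assms by (auto simp: U_def)
  have cv: "continuous_on A v" for A by (rule C_inf_continuous) fact
  have "((\<lambda>t. integral Q (\<lambda>z. ker (Suc M) t z * v z)) has_real_derivative
      integral Q (\<lambda>z. (\<Sum>i\<in>UNIV. pd i (pd i (ker (M + 2) \<tau>)) z) * v z)) (at \<tau> within U)"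
    unfolding Q_def
  proof (rule leibniz_rule_field_derivative)
    show "((\<lambda>t. ker (Suc M) t z * v z) has_real_derivative
      (\<Sum>i\<in>UNIV. pd i (pd i (ker (M + 2) t)) z) * v z) (at t within U)" if "t \<in> U" for t z
      by (rule DERIV_cmult_right, rule DERIV_ker) (use that pos M assms in auto)
    show "(\<lambda>z. ker (Suc M) t z * v z) integrable_on cube (sqrt (2 * \<tau>))" if "t \<in> U" for t
      by (intro integrable_continuous continuous_intros cv) (use pos that in auto)
    show "continuous_on (U \<times> cube (sqrt (2 * \<tau>)))
        (\<lambda>(t, z). (\<Sum>i\<in>UNIV. pd i (pd i (ker (M + 2) t)) z) * v z)"
    proof -
      have "continuous_on (U \<times> cube (sqrt (2 * \<tau>)))
        (\<lambda>p. (\<Sum>i\<in>UNIV. snd p $ i * snd p $ i / (4 * (fst p)\<^sup>2) * ker M (fst p) (snd p)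
          - (1 / (2 * fst p)) * ker (Suc M) (fst p) (snd p)) * v (snd p))"
        by (intro continuous_intros continuous_on_compose2[OF cv[of UNIV]]) (use pos in \<open>force+\<close>)
      then show ?thesis
      proof (rule continuous_on_eq)
        fix p :: "real \<times> (real ^ 'n)" assume p: "p \<in> U \<times> cube (sqrt (2 * \<tau>))"
        then have "fst p > 0" using pos by force
        note * = pd_pd_ker(1)[OF this M]
        show "(\<Sum>i\<in>UNIV. snd p $ i * snd p $ i / (4 * (fst p)\<^sup>2) * ker M (fst p) (snd p)
            - (1 / (2 * fst p)) * ker (Suc M) (fst p) (snd p)) * v (snd p)
          = (case p of (t, z) \<Rightarrow> (\<Sum>i\<in>UNIV. pd i (pd i (ker (M + 2) t)) z) * v z)"
          unfolding case_prod_beta * by simp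
      qed
    qed
    show "convex U" "\<tau> \<in> U" using assms by (auto simp: U_def)
  qed
  moreover have "integral Q (\<lambda>z. ker (Suc M) t z * v z) = ker_avg (Suc M) t v" if "t \<in> U" for t
    unfolding ker_avg_def by (rule integral_UNIV_superset[symmetric]) (use out that in auto)
  moreover have "\<tau> \<in> U" using assms by (auto simp: U_def)
  moreover have "integral Q (\<lambda>z. (\<Sum>i\<in>UNIV. pd i (pd i (ker (M + 2) \<tau>)) z) * v z) = - ker_avg (M + 2) \<tau> (neg_laplacian v)"
    unfolding ker_avg_neg_laplacian[OF assms(1) M assms(3)]
  proof (rule integral_UNIV_superset[symmetric])
    fix z assume "z \<notin> Q"
    then have z: "ker M \<tau> z = 0" "ker (Suc M) \<tau> z = 0"
      using out[of \<tau> z "M - 1"] out[of \<tau> z M] M \<open>\<tau> \<in> U\<close> by auto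
    show "(\<Sum>i\<in>UNIV. pd i (pd i (ker (M + 2) \<tau>)) z) * v z = 0"
      unfolding pd_pd_ker(1)[OF assms(1) M] z by simp
  qed
  ultimately have "((\<lambda>t. ker_avg (Suc M) t v) has_real_derivative - ker_avg (M + 2) \<tau> (neg_laplacian v)) (at \<tau> within U)"
    by (metis (no_types, lifting) has_field_derivative_transform_within zero_less_one)
  moreover have "at \<tau> within U = at \<tau>" unfolding U_def using assms by (intro at_within_Icc_at) auto
  ultimately show ?thesis using N by simp
qed

definition ker_mass :: "'n::finite itself \<Rightarrow> nat \<Rightarrow> real" where
  "ker_mass _ N = ker_avg N 1 (\<lambda>z :: real ^ 'n. 1)"

text \<open>The mass of the kernel is constant in \<open>\<tau>\<close> since its derivative is an average of \<open>\<Delta> 1 = 0\<close>.\<close>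

lemma ker_avg_const:
  assumes "\<tau> > 0" "N \<ge> 2" "even CARD('n::finite)"
  shows "ker_avg N \<tau> (\<lambda>z :: real ^ 'n. c) = c * ker_mass TYPE('n) N"
proof -
  have "\<exists>k. \<forall>t\<in>{0<..}. ker_avg N t (\<lambda>z :: real ^ 'n. 1) = k"
  proof (rule has_field_derivative_zero_constant)
    fix t :: real assume "t \<in> {0<..}"
    then have "((\<lambda>t. ker_avg N t (\<lambda>z :: real ^ 'n. 1)) has_real_derivative - ker_avg (Suc N) t (neg_laplacian (\<lambda>z :: real ^ 'n. 1))) (at t)"
      by (intro DERIV_ker_avg C_inf_const assms) auto
    moreover have "ker_avg (Suc N) t (neg_laplacian (\<lambda>z :: real ^ 'n. 1)) = 0"
      by (simp add: ker_avg_def neg_laplacian_def)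
    ultimately show "((\<lambda>t. ker_avg N t (\<lambda>z :: real ^ 'n. 1)) has_real_derivative 0) (at t within {0<..})"
      by (auto intro: has_field_derivative_at_within)
  qed simp
  then have "ker_avg N \<tau> (\<lambda>z :: real ^ 'n. 1) = ker_mass TYPE('n) N"
    using assms(1) by (auto simp: ker_mass_def)
  then show ?thesis using ker_avg_cmult[of N \<tau> c "\<lambda>z :: real ^ 'n. 1"] by simp
qed

lemma ker_mass_pos: assumes "N \<ge> 1" shows "ker_mass TYPE('n::finite) N > 0"
proof -
  define a :: "real ^ 'n" where "a = (\<chi> i. - 1)"
  define b :: "real ^ 'n" where "b = (\<chi> i. 1)"
  have eq: "ker_mass TYPE('n) N = integral (cbox a b) (\<lambda>z. ker N 1 z)"
    unfolding ker_mass_def ker_avg_def mult_1_right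
  proof (rule integral_UNIV_superset, rule ker_eq_0)
    fix z assume "z \<notin> cbox a b"
    then have "1 < norm z" using norm_le_cube[of z 1] by (force simp: a_def b_def)
    then have "1\<^sup>2 \<le> (norm z)\<^sup>2" by (intro power_mono) auto
    then show "1 \<le> z \<bullet> z" by (simp add: dot_square_norm)
  qed (use assms in auto)
  have cont: "continuous_on (cbox a b) (ker N 1 :: real ^ 'n \<Rightarrow> real)"
    by (intro continuous_intros) auto
  have "integral (cbox a b) (ker N 1) \<ge> 0"
    by (rule integral_nonneg[OF integrable_continuous[OF cont]]) (simp add: ker_nonneg)
  moreover have "integral (cbox a b) (ker N 1) \<noteq> 0"
  proof
    assume "integral (cbox a b) (ker N 1) = 0"
    moreover have "box a b \<noteq> {}"
    proof -
      have "0 \<in> box a b" by (simp add: mem_box_cart a_def b_def)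
      then show ?thesis by blast
    qed
    ultimately have "\<forall>z\<in>cbox a b. ker N 1 z = 0"
      using integral_cbox_eq_0_iff[OF cont] by (simp add: ker_nonneg)
    moreover have "0 \<in> cbox a b" by (simp add: mem_box_cart a_def b_def)
    ultimately show False by (auto simp: ker_def)
  qed
  ultimately show ?thesis unfolding eq by simp
qed

lemma ker_avg_tendsto:
  fixes v :: "real ^ 'n::finite \<Rightarrow> real"
  assumes "continuous_on UNIV v" "N \<ge> 2" "even CARD('n)"
  shows "((\<lambda>\<tau>. ker_avg N \<tau> v) \<longlongrightarrow> ker_mass TYPE('n) N * v 0) (at_right 0)"
proof (rule tendstoI)
  fix e :: real assume e: "e > 0"
  define k where "k = ker_mass TYPE('n) N"
  have k: "k > 0" unfolding k_def by (rule ker_mass_pos) (use assms in auto)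
  define e' where "e' = e / (2 * k)"
  have e': "e' > 0" using e k by (simp add: e'_def)
  have "isCont v 0" using assms(1) by (simp add: continuous_on_eq_continuous_at)
  then obtain d where d: "d > 0" "\<And>z. norm z < d \<Longrightarrow> \<bar>v z - v 0\<bar> < e'"
    using e' unfolding continuous_at_eps_delta by (auto simp: dist_real_def)
  have "dist (ker_avg N \<tau> v) (k * v 0) < e" if t: "0 < \<tau>" "\<tau> < d\<^sup>2" for \<tau>
  proof -
    have b: "v 0 - e' \<le> v z" "v z \<le> v 0 + e'" if "z \<bullet> z \<le> \<tau>" for z
    proof -
      have "(norm z)\<^sup>2 < d\<^sup>2" using that t by (simp add: dot_square_norm)
      then have "norm z < d" using d(1) by (simp add: power2_less_imp_less)
      from d(2)[OF this] show "v 0 - e' \<le> v z" "v z \<le> v 0 + e'" by auto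
    qed
    have N: "1 \<le> N" using assms(2) by simp
    have "ker_avg N \<tau> v \<le> ker_avg N \<tau> (\<lambda>z :: real ^ 'n. v 0 + e')"
      by (rule ker_avg_mono[OF t(1) N assms(1) continuous_on_const b(2)])
    moreover have "ker_avg N \<tau> (\<lambda>z :: real ^ 'n. v 0 - e') \<le> ker_avg N \<tau> v"
      by (rule ker_avg_mono[OF t(1) N continuous_on_const assms(1) b(1)])
    ultimately have "ker_avg N \<tau> v \<le> k * v 0 + k * e'" "k * v 0 - k * e' \<le> ker_avg N \<tau> v"
      using ker_avg_const[OF t(1) assms(2,3)] by (auto simp: k_def algebra_simps)
    moreover have "k * e' < e" using e k by (simp add: e'_def)
    ultimately show ?thesis by (auto simp: dist_real_def)
  qed
  then show "\<forall>\<^sub>F \<tau> in at_right 0. dist (ker_avg N \<tau> v) (ker_mass TYPE('n) N * v 0) < e"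
    unfolding eventually_at_right_field k_def
    using d(1) by (intro exI[of _ "d\<^sup>2"]) auto
qed

text \<open>Symmetry of second derivatives is inherited from the explicit kernels.\<close>

lemma pd_commute:
  fixes v :: "real ^ 'n::finite \<Rightarrow> real"
  assumes "C_inf v" "even CARD('n)"
  shows "pd i (pd j v) = pd j (pd i v)"
proof
  fix x
  define w where "w = (\<lambda>z. v (x + z))"
  have w: "C_inf w" unfolding w_def by (rule C_inf_translate) fact
  have lim: "((\<lambda>\<tau>. ker_avg 3 \<tau> (pd i (pd j w))) \<longlongrightarrow> ker_mass TYPE('n) 3 * pd i (pd j w) 0) (at_right 0)" for i j
    by (rule ker_avg_tendsto) (auto intro: C_inf_continuous C_inf_pd w assms)
  have "\<forall>\<^sub>F \<tau> in at_right 0. ker_avg 3 \<tau> (pd i (pd j w)) = ker_avg 3 \<tau> (pd j (pd i w))"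
  proof -
    have "ker_avg 3 \<tau> (pd i (pd j w)) = ker_avg 3 \<tau> (pd j (pd i w))" if "\<tau> > 0" for \<tau>
    proof -
      have "ker_avg (1 + 2) \<tau> (pd i (pd j w)) = ker_avg (1 + 2) \<tau> (pd j (pd i w))"
        unfolding ker_avg_pd_pd[OF that order.refl w]
        by (rule integral_cong) (cases "i = j"; simp add: mult_ac)
      moreover have "1 + 2 = (3 :: nat)" by simp
      ultimately show ?thesis by (simp only:)
    qed
    then show ?thesis by (auto simp: eventually_at_right_field intro!: exI[of _ 1])
  qed
  then have "((\<lambda>\<tau>. ker_avg 3 \<tau> (pd i (pd j w))) \<longlongrightarrow> ker_mass TYPE('n) 3 * pd j (pd i w) 0) (at_right 0)"
    using lim[of j i] by (simp add: tendsto_cong)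
  with lim[of i j] have "ker_mass TYPE('n) 3 * pd i (pd j w) 0 = ker_mass TYPE('n) 3 * pd j (pd i w) 0"
    by (rule tendsto_unique[OF trivial_limit_at_right_real])
  then have "pd i (pd j w) 0 = pd j (pd i w) 0"
    using ker_mass_pos[of 3, where 'n = 'n] by simp
  then show "pd i (pd j v) x = pd j (pd i v) x"
    by (simp add: w_def pd_translate_C_inf assms C_inf_pd)
qed

section \<open>Chains of successive derivatives on the half-line\<close>

text \<open>For a chain with \<open>G j' = - G (j + 1)\<close> one has \<open>G j = (- d/d\<tau>)\<^sup>j (G 0)\<close>, and this is the Taylor
  polynomial of \<open>G 0\<close> about the point \<open>\<tau>\<close>, evaluated at \<open>0\<close>. Its derivative in \<open>\<tau>\<close>
  telescopes to a single term, which gives Taylor's formula with integral remainder.\<close>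

definition taylor_at_0 :: "nat \<Rightarrow> (nat \<Rightarrow> real \<Rightarrow> real) \<Rightarrow> real \<Rightarrow> real" where
  "taylor_at_0 k G \<tau> = (\<Sum>j<k. \<tau> ^ j / fact j * G j \<tau>)"

lemma DERIV_taylor_at_0:
  assumes "\<And>j. j \<le> k \<Longrightarrow> (G j has_real_derivative - G (Suc j) \<tau>) (at \<tau>)"
  shows "(taylor_at_0 (Suc k) G has_real_derivative - (\<tau> ^ k / fact k * G (Suc k) \<tau>)) (at \<tau>)"
  using assms
proof (induction k)
  case 0
  then show ?case by (simp add: taylor_at_0_def[abs_def])
next
  case (Suc k)
  have eq: "taylor_at_0 (Suc (Suc k)) G = (\<lambda>\<tau>. taylor_at_0 (Suc k) G \<tau> + \<tau> ^ Suc k / fact (Suc k) * G (Suc k) \<tau>)"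
    by (simp add: taylor_at_0_def fun_eq_iff)
  have p: "((\<lambda>\<tau>. \<tau> ^ Suc k / fact (Suc k)) has_real_derivative \<tau> ^ k / fact k) (at \<tau>)"
    by (rule DERIV_cong[OF DERIV_cdivide[OF DERIV_pow]]) (simp add: divide_simps)
  have "((\<lambda>\<tau>. taylor_at_0 (Suc k) G \<tau> + \<tau> ^ Suc k / fact (Suc k) * G (Suc k) \<tau>) has_real_derivative
      - (\<tau> ^ k / fact k * G (Suc k) \<tau>) + (\<tau> ^ k / fact k * G (Suc k) \<tau>
        + - G (Suc (Suc k)) \<tau> * (\<tau> ^ Suc k / fact (Suc k)))) (at \<tau>)"
    by (intro DERIV_add DERIV_mult p Suc.IH Suc.prems) auto
  then show ?case unfolding eq by (rule DERIV_cong) (simp add: mult_ac)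
qed

text \<open>Combined with nonnegativity of the terms of positive order, this bounds each of them by the
  value of the polynomial at one fixed point minus \<open>G 0\<close>: growth of \<open>G 0\<close> alone controls the
  whole chain.\<close>

lemma taylor_at_0_antimono:
  assumes "\<And>j \<tau>. j \<le> k \<Longrightarrow> \<tau> > 0 \<Longrightarrow> (G j has_real_derivative - G (Suc j) \<tau>) (at \<tau>)"
    and "\<And>\<tau>. \<tau> > 0 \<Longrightarrow> G (Suc k) \<tau> \<ge> 0" "0 < a" "a \<le> b"
  shows "taylor_at_0 (Suc k) G b \<le> taylor_at_0 (Suc k) G a"
proof (rule DERIV_nonpos_imp_nonincreasing[OF assms(4)])
  fix x assume "a \<le> x" "x \<le> b"
  then have x: "x > 0" using assms(3) by simp
  show "\<exists>y. (taylor_at_0 (Suc k) G has_real_derivative y) (at x) \<and> y \<le> 0"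
    using DERIV_taylor_at_0[of k G x] assms(1)[OF _ x] assms(2)[OF x] x
    by (intro exI[of _ "- (x ^ k / fact k * G (Suc k) x)"]) auto
qed

lemma taylor_at_0_ge_term:
  assumes "\<And>i. 1 \<le> i \<Longrightarrow> i < k \<Longrightarrow> G i \<tau> \<ge> 0" "\<tau> > 0" "1 \<le> j" "j < k"
  shows "G 0 \<tau> + \<tau> ^ j / fact j * G j \<tau> \<le> taylor_at_0 k G \<tau>"
proof -
  have "(\<Sum>i\<in>{0, j}. \<tau> ^ i / fact i * G i \<tau>) \<le> taylor_at_0 k G \<tau>"
    unfolding taylor_at_0_def
    by (rule sum_mono2) (use assms in \<open>auto simp: Suc_le_eq\<close>)
  then show ?thesis using assms(3) by simp
qed

lemma taylor_at_0_ge_0th: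
  assumes "\<And>i. 1 \<le> i \<Longrightarrow> i < k \<Longrightarrow> G i \<tau> \<ge> 0" "\<tau> > 0" "k \<ge> 1"
  shows "G 0 \<tau> \<le> taylor_at_0 k G \<tau>"
proof -
  have "(\<Sum>i\<in>{0}. \<tau> ^ i / fact i * G i \<tau>) \<le> taylor_at_0 k G \<tau>"
    unfolding taylor_at_0_def
    by (rule sum_mono2) (use assms in \<open>auto simp: Suc_le_eq\<close>)
  then show ?thesis by simp
qed

lemma derivative_bounded_below_imp_linear_growth:
  fixes g :: "real \<Rightarrow> real"
  assumes "\<And>\<tau>. \<tau> \<ge> t0 \<Longrightarrow> (g has_real_derivative g' \<tau>) (at \<tau>)" "\<And>\<tau>. \<tau> \<ge> t0 \<Longrightarrow> g' \<tau> \<ge> a" "a > 0"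
  shows "\<exists>t1\<ge>1. \<forall>\<tau>\<ge>t1. g \<tau> \<ge> a / 2 * \<tau>"
proof -
  define t1 where "t1 = max 1 (max t0 (2 / a * (a * t0 - g t0)))"
  have "g \<tau> \<ge> a / 2 * \<tau>" if t: "\<tau> \<ge> t1" for \<tau>
  proof -
    have "g t0 - a * t0 \<le> g \<tau> - a * \<tau>"
    proof (rule DERIV_nonneg_imp_nondecreasing[where f = "\<lambda>x. g x - a * x"])
      show "t0 \<le> \<tau>" using t by (simp add: t1_def)
      fix x assume "t0 \<le> x"
      then show "\<exists>y. ((\<lambda>x. g x - a * x) has_real_derivative y) (at x) \<and> 0 \<le> y"
        using assms(1,2)[of x] by (intro exI[of _ "g' x - a"]) (auto intro!: derivative_eq_intros)
    qed
    moreover have "2 / a * (a * t0 - g t0) \<le> \<tau>" using t by (simp add: t1_def)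
    then have "a * t0 - g t0 \<le> a / 2 * \<tau>" using assms(3) by (simp add: field_simps)
    ultimately show ?thesis by (simp add: algebra_simps)
  qed
  then show ?thesis by (intro exI[of _ t1]) (auto simp: t1_def)
qed

text \<open>If some derivative stayed away from zero with a fixed sign, every earlier one would grow
  at least linearly.\<close>

lemma chain_not_bounded_away_from_0:
  assumes D: "\<And>j \<tau>. j < k \<Longrightarrow> \<tau> > 0 \<Longrightarrow> (G j has_real_derivative - G (Suc j) \<tau>) (at \<tau>)"
    and growth: "\<And>\<tau>. \<tau> \<ge> 1 \<Longrightarrow> \<bar>G 0 \<tau>\<bar> \<le> A + B * ln \<tau>"
    and "k \<ge> 1" "a > 0" and neg: "\<And>\<tau>. \<tau> > 0 \<Longrightarrow> G k \<tau> \<le> - a"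
  shows False
proof -
  have step: "\<exists>b>0. \<exists>t\<ge>1. (\<forall>\<tau>\<ge>t. G j \<tau> \<ge> b * \<tau>) \<or> (\<forall>\<tau>\<ge>t. - G j \<tau> \<ge> b * \<tau>)"
    if "j < k" "\<exists>b>0. \<exists>t\<ge>1. (\<forall>\<tau>\<ge>t. G (Suc j) \<tau> \<ge> b) \<or> (\<forall>\<tau>\<ge>t. - G (Suc j) \<tau> \<ge> b)" for j
  proof -
    from that(2) obtain b t where bt: "b > 0" "t \<ge> 1"
      "(\<forall>\<tau>\<ge>t. G (Suc j) \<tau> \<ge> b) \<or> (\<forall>\<tau>\<ge>t. - G (Suc j) \<tau> \<ge> b)" by blast
    from bt(3) show ?thesis
    proof
      assume *: "\<forall>\<tau>\<ge>t. G (Suc j) \<tau> \<ge> b"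
      have D': "((\<lambda>\<tau>. - G j \<tau>) has_real_derivative G (Suc j) \<tau>) (at \<tau>)" if "\<tau> > 0" for \<tau>
        using DERIV_minus[OF D[OF \<open>j < k\<close> that]] by simp
      have "\<exists>t1\<ge>1. \<forall>\<tau>\<ge>t1. - G j \<tau> \<ge> b / 2 * \<tau>"
        by (rule derivative_bounded_below_imp_linear_growth[of t _ "\<lambda>\<tau>. G (Suc j) \<tau>"])
          (use * D' bt in auto)
      then show ?thesis using bt(1) by (intro exI[of _ "b / 2"]) auto
    next
      assume *: "\<forall>\<tau>\<ge>t. - G (Suc j) \<tau> \<ge> b"
      have "\<exists>t1\<ge>1. \<forall>\<tau>\<ge>t1. G j \<tau> \<ge> b / 2 * \<tau>"
        by (rule derivative_bounded_below_imp_linear_growth[of t _ "\<lambda>\<tau>. - G (Suc j) \<tau>"])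
          (use * D[OF that(1)] bt in auto)
      then show ?thesis using bt(1) by (intro exI[of _ "b / 2"]) auto
    qed
  qed
  have weaken: "\<exists>b>0. \<exists>t\<ge>1. (\<forall>\<tau>\<ge>t. G j \<tau> \<ge> b) \<or> (\<forall>\<tau>\<ge>t. - G j \<tau> \<ge> b)"
    if "\<exists>b>0. \<exists>t\<ge>1. (\<forall>\<tau>\<ge>t. G j \<tau> \<ge> b * \<tau>) \<or> (\<forall>\<tau>\<ge>t. - G j \<tau> \<ge> b * \<tau>)" for j
  proof -
    from that obtain b t where bt: "b > 0" "t \<ge> 1"
      "(\<forall>\<tau>\<ge>t. G j \<tau> \<ge> b * \<tau>) \<or> (\<forall>\<tau>\<ge>t. - G j \<tau> \<ge> b * \<tau>)" by blast
    have "b \<le> b * \<tau>" if "\<tau> \<ge> t" for \<tau> using bt that by simp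
    then show ?thesis using bt by (meson order_trans)
  qed
  have "\<exists>b>0. \<exists>t\<ge>1. (\<forall>\<tau>\<ge>t. G 0 \<tau> \<ge> b * \<tau>) \<or> (\<forall>\<tau>\<ge>t. - G 0 \<tau> \<ge> b * \<tau>)"
  proof -
    have "\<exists>b>0. \<exists>t\<ge>1. (\<forall>\<tau>\<ge>t. G (k - i) \<tau> \<ge> b * \<tau>) \<or> (\<forall>\<tau>\<ge>t. - G (k - i) \<tau> \<ge> b * \<tau>)"
      if "1 \<le> i" "i \<le> k" for i
      using that
    proof (induction i rule: nat_induct_at_least)
      case base
      have "\<exists>b>0. \<exists>t\<ge>1. (\<forall>\<tau>\<ge>t. G k \<tau> \<ge> b) \<or> (\<forall>\<tau>\<ge>t. - G k \<tau> \<ge> b)"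
      proof -
        have "a \<le> - G k \<tau>" if "\<tau> \<ge> 1" for \<tau> using neg[of \<tau>] that by simp
        then show ?thesis using \<open>a > 0\<close> by (meson order_refl)
      qed
      then show ?case using step[of "k - 1"] \<open>k \<ge> 1\<close> by simp
    next
      case (Suc i)
      then have "Suc (k - Suc i) = k - i" by simp
      then show ?case using step[of "k - Suc i"] weaken[of "k - i"] Suc by simp
    qed
    from this[of k] show ?thesis using \<open>k \<ge> 1\<close> by simp
  qed
  then obtain b t where bt: "b > 0" "t \<ge> 1"
      "(\<forall>\<tau>\<ge>t. G 0 \<tau> \<ge> b * \<tau>) \<or> (\<forall>\<tau>\<ge>t. - G 0 \<tau> \<ge> b * \<tau>)" by blast
  have le: "b * \<tau> \<le> A + B * ln \<tau>" if "\<tau> \<ge> t" for \<tau>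
    using bt growth[of \<tau>] that by fastforce
  have "((\<lambda>\<tau>. A / \<tau> + B * (ln \<tau> / \<tau>)) \<longlongrightarrow> 0 + B * 0) at_top"
    by (intro tendsto_add tendsto_mult tendsto_const ln_x_over_x_tendsto_0
        tendsto_divide_0[OF tendsto_const] filterlim_at_top_imp_at_infinity filterlim_ident)
  then have "\<forall>\<^sub>F \<tau> in at_top. A / \<tau> + B * (ln \<tau> / \<tau>) < b"
    using bt(1) by (intro order_tendstoD) auto
  then have "\<forall>\<^sub>F \<tau> in at_top. A / \<tau> + B * (ln \<tau> / \<tau>) < b \<and> \<tau> \<ge> t"
    using eventually_ge_at_top by (rule eventually_conj)
  then obtain \<tau> where \<tau>: "A / \<tau> + B * (ln \<tau> / \<tau>) < b" "\<tau> \<ge> t"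
    using eventually_happens trivial_limit_at_top_linorder by blast
  have "\<tau> > 0" using \<tau>(2) bt(2) by simp
  then have "A + B * ln \<tau> < b * \<tau>" using \<tau>(1) by (simp add: field_simps)
  with le[OF \<tau>(2)] show False by simp
qed

section \<open>A lower bound from nonnegative scalar curvature\<close>

text \<open>The function \<open>g\<close> has to agree with \<open>pd i f\<close> only near \<open>x\<close>, which admits comparison functions
  with a singularity elsewhere.\<close>

lemma second_pd_nonneg_at_local_min:
  fixes f g :: "real ^ 'n::finite \<Rightarrow> real"
  assumes d: "d > 0" and min: "\<And>y. dist y x < d \<Longrightarrow> f x \<le> f y"
    and f: "\<And>y. dist y x < d \<Longrightarrow> f differentiable (at y)" "\<And>y. dist y x < d \<Longrightarrow> pd i f y = g y"
    and g: "g differentiable (at x)"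
  shows "pd i g x \<ge> 0"
proof (rule ccontr)
  define F where "F t = f (x + t *\<^sub>R axis i 1)" for t
  define G where "G t = g (x + t *\<^sub>R axis i 1)" for t
  have near: "dist (x + t *\<^sub>R axis i 1) x < d" if "\<bar>t\<bar> < d" for t
    using that by (simp add: dist_norm)
  have F: "(F has_real_derivative G t) (at t)" if "\<bar>t\<bar> < d" for t
    unfolding F_def G_def using DERIV_pd_line[OF f(1)[OF near[OF that]]] f(2)[OF near[OF that]] by simp
  have G: "(G has_real_derivative pd i g x) (at 0)"
    using DERIV_pd_line[of g x 0 i UNIV] g by (simp add: G_def[abs_def])
  have G0: "G 0 = 0"
    by (rule DERIV_local_min[OF F[of 0] d]) (use d min near in \<open>auto simp: F_def\<close>)
  assume "\<not> pd i g x \<ge> 0"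
  then obtain e where e: "e > 0" "\<And>h. 0 < h \<Longrightarrow> h < e \<Longrightarrow> G (0 + h) < G 0"
    using DERIV_neg_dec_right[OF G] by auto
  define h where "h = min d e / 2"
  have h: "0 < h" "h < d" "h < e" using d e by (auto simp: h_def)
  obtain z where z: "0 < z" "z < h" "F h - F 0 = (h - 0) * G z"
    using MVT2[of 0 h F G] F h by force
  have "G z < 0" using e(2)[of z] z h G0 by simp
  then have "F h < F 0" using z h using mult_pos_neg[of h "G z"] by simp
  moreover have "F 0 \<le> F h" using min[OF near[of h]] h by (simp add: F_def)
  ultimately show False by simp
qed

lemma DERIV_inverse_power:
  assumes "s \<noteq> (0 :: real)"
  shows "((\<lambda>s. inverse s ^ k) has_real_derivative - (real k * inverse s ^ Suc k)) (at s)"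
proof (induction k)
  case (Suc k)
  have "((\<lambda>s. inverse s * inverse s ^ k) has_real_derivative
      - (inverse s ^ 2) * inverse s ^ k + - (real k * inverse s ^ Suc k) * inverse s) (at s)"
    by (rule DERIV_cong[OF DERIV_mult[OF DERIV_inverse[OF assms] Suc]]) (simp add: numeral_2_eq_2)
  then show ?case unfolding power_Suc[of "inverse _" k] by (rule DERIV_cong) (simp add: numeral_2_eq_2 algebra_simps)
qed simp

text \<open>The function \<open>w\<close> is superharmonic and \<open>|x|\<close> to the power \<open>2 - n\<close>, here
  \<open>inverse (x \<bullet> x) ^ (m - 1)\<close>, is harmonic. The term with \<open>\<delta>\<close> makes the Laplacian of the
  difference strictly negative, so that its minimum over the annulus \<open>1 \<le> x \<bullet> x \<le> \<rho>\<close> lies on the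
  boundary.\<close>

lemma superharmonic_on_annulus_lower_bound:
  fixes u :: "real ^ 'n::finite \<Rightarrow> real"
  assumes n: "CARD('n) = 2 * m" "m \<ge> 2" and u: "C_inf u"
    and R: "\<And>x. - neg_laplacian u x + (real m - 1) * (\<Sum>i\<in>UNIV. (pd i u x)\<^sup>2) \<le> 0"
    and w: "w = (\<lambda>x. exp ((real m - 1) * u x))"
    and c: "c > 0" "\<And>x. x \<bullet> x = 1 \<Longrightarrow> c \<le> w x"
    and x: "1 \<le> x \<bullet> x" "x \<bullet> x \<le> \<rho>" and \<delta>: "\<delta> > 0"
  shows "w x \<ge> c * inverse (x \<bullet> x) ^ (m - 1) + \<delta> * (x \<bullet> x) - \<delta> - \<delta> * \<rho> - c * inverse \<rho> ^ (m - 1)"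
proof -
  define A where "A = {y :: real ^ 'n. 1 \<le> y \<bullet> y \<and> y \<bullet> y \<le> \<rho>}"
  define q where "q y = c * inverse (y \<bullet> y) ^ (m - 1) + \<delta> * (y \<bullet> y)" for y :: "real ^ 'n"
  have \<rho>: "\<rho> \<ge> 1" using x by simp
  have dw: "w differentiable (at y)" "pd i w y = (real m - 1) * w y * pd i u y" for i y
  proof -
    have "((\<lambda>s. exp ((real m - 1) * s)) has_real_derivative (real m - 1) * exp ((real m - 1) * u y)) (at (u y))"
      by (auto intro!: derivative_eq_intros)
    from pd_compose[OF C_inf_differentiable[OF u] this]
    show "w differentiable (at y)" "pd i w y = (real m - 1) * w y * pd i u y"
      by (simp_all add: w mult_ac)
  qed
  define p where "p i y = (real m - 1) * w y * pd i u y
      - (2 * \<delta> - 2 * (real m - 1) * c * inverse (y \<bullet> y) ^ m) * y $ i" for i y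
  have dq: "q differentiable (at y)" "pd i q y = (2 * \<delta> - 2 * (real m - 1) * c * inverse (y \<bullet> y) ^ m) * y $ i"
    if "y \<bullet> y > 0" for i y
  proof -
    obtain k where k: "m = Suc (Suc k)" using n(2) by (metis Suc_le_D numeral_2_eq_2 Suc_le_mono)
    have "((\<lambda>s. c * inverse s ^ (m - 1) + \<delta> * s) has_real_derivative
       (c * - (real (m - 1) * inverse (y \<bullet> y) ^ Suc (m - 1)) + \<delta> * 1)) (at (y \<bullet> y))"
      by (intro DERIV_add DERIV_cmult DERIV_inverse_power DERIV_ident) (use that in simp)
    then have "((\<lambda>s. c * inverse s ^ (m - 1) + \<delta> * s) has_real_derivative
       (\<delta> - (real m - 1) * c * inverse (y \<bullet> y) ^ m)) (at (y \<bullet> y))"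
      by (rule DERIV_cong) (simp add: k)
    from pd_compose[OF differentiable_inner_self this]
    show "q differentiable (at y)" "pd i q y = (2 * \<delta> - 2 * (real m - 1) * c * inverse (y \<bullet> y) ^ m) * y $ i"
      by (simp_all add: q_def[abs_def] pd_inner_self algebra_simps)
  qed
  have dp: "p i differentiable (at y)"
    "pd i (p i) y = (real m - 1) * w y * ((real m - 1) * (pd i u y)\<^sup>2 + pd i (pd i u) y)
       - (2 * \<delta> - 2 * (real m - 1) * c * inverse (y \<bullet> y) ^ m)
       - 4 * real m * (real m - 1) * c * inverse (y \<bullet> y) ^ Suc m * (y $ i)\<^sup>2"
    if "y \<bullet> y > 0" for i y
  proof -
    have du: "pd i u differentiable (at y)" by (rule C_inf_differentiable[OF C_inf_pd[OF u]])
    have "((\<lambda>s. 2 * \<delta> - 2 * (real m - 1) * c * inverse s ^ m) has_real_derivative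
       0 - 2 * (real m - 1) * c * - (real m * inverse (y \<bullet> y) ^ Suc m)) (at (y \<bullet> y))"
      by (intro DERIV_diff DERIV_const DERIV_cmult DERIV_inverse_power) (use that in simp)
    note g = pd_compose[OF differentiable_inner_self this]
    have 1: "(\<lambda>y. (real m - 1) * w y * pd i u y) differentiable (at y)"
      using dw du by (intro differentiable_mult) auto
    have 2: "(\<lambda>y. (2 * \<delta> - 2 * (real m - 1) * c * inverse (y \<bullet> y) ^ m) * y $ i) differentiable (at y)"
      by (intro differentiable_mult g(2) differentiable_component)
    show "p i differentiable (at y)" unfolding p_def[abs_def] by (intro differentiable_diff 1 2)
    have "pd i (p i) y = pd i (\<lambda>y. (real m - 1) * w y * pd i u y) y
        - pd i (\<lambda>y. (2 * \<delta> - 2 * (real m - 1) * c * inverse (y \<bullet> y) ^ m) * y $ i) y"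
      unfolding p_def[abs_def] by (rule pd_diff[OF 1 2])
    also have "pd i (\<lambda>y. (real m - 1) * w y * pd i u y) y
       = (real m - 1) * w y * pd i (pd i u) y + (real m - 1) * ((real m - 1) * w y * pd i u y) * pd i u y"
      using dw du by (subst pd_mult) (auto simp: pd_cmult)
    also have "pd i (\<lambda>y. (2 * \<delta> - 2 * (real m - 1) * c * inverse (y \<bullet> y) ^ m) * y $ i) y
       = (2 * \<delta> - 2 * (real m - 1) * c * inverse (y \<bullet> y) ^ m)
        + 4 * real m * (real m - 1) * c * inverse (y \<bullet> y) ^ Suc m * (y $ i)\<^sup>2"
      unfolding pd_mult[OF g(2) differentiable_component] g(1) pd_component pd_inner_self
      by (simp add: power2_eq_square)
    finally show "pd i (p i) y = (real m - 1) * w y * ((real m - 1) * (pd i u y)\<^sup>2 + pd i (pd i u) y)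
       - (2 * \<delta> - 2 * (real m - 1) * c * inverse (y \<bullet> y) ^ m)
       - 4 * real m * (real m - 1) * c * inverse (y \<bullet> y) ^ Suc m * (y $ i)\<^sup>2"
      by (simp add: algebra_simps power2_eq_square)
  qed
  have "compact A"
  proof -
    have "A = {y. 1 \<le> y \<bullet> y} \<inter> {y. y \<bullet> y \<le> \<rho>}" by (auto simp: A_def)
    then have "closed A" by (auto intro!: closed_Int closed_Collect_le continuous_intros)
    moreover have "norm y \<le> sqrt \<rho>" if "y \<in> A" for y
      using that by (simp add: A_def norm_eq_sqrt_inner)
    then have "bounded A" by (auto simp: bounded_iff)
    ultimately show ?thesis by (simp add: compact_eq_bounded_closed)
  qed
  have cw: "continuous_on UNIV w"
    by (intro differentiable_imp_continuous_on) (auto simp: differentiable_on_def intro: dw)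
  have "continuous_on A (\<lambda>y. w y - q y)"
    unfolding q_def
    by (intro continuous_intros continuous_on_subset[OF cw]) (auto simp: A_def)
  moreover have "x \<in> A" using x by (simp add: A_def)
  ultimately obtain y where y: "y \<in> A" "\<And>z. z \<in> A \<Longrightarrow> w y - q y \<le> w z - q z"
    using continuous_attains_inf[OF \<open>compact A\<close>, of "\<lambda>y. w y - q y"] by auto
  have "\<not> (1 < y \<bullet> y \<and> y \<bullet> y < \<rho>)"
  proof
    assume int: "1 < y \<bullet> y \<and> y \<bullet> y < \<rho>"
    have "open ({z. 1 < z \<bullet> z} \<inter> {z :: real ^ 'n. z \<bullet> z < \<rho>})"
      by (intro open_Int open_Collect_less continuous_intros)
    then obtain d where d: "d > 0" "\<And>z. dist z y < d \<Longrightarrow> 1 < z \<bullet> z \<and> z \<bullet> z < \<rho>"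
      using int unfolding open_dist by blast
    have pos: "pd i (p i) y \<ge> 0" for i
    proof (rule second_pd_nonneg_at_local_min[OF d(1), of y "\<lambda>z. w z - q z"])
      fix z assume z: "dist z y < d"
      then have z': "z \<bullet> z > 0" using d(2)[OF z] by linarith
      show "w y - q y \<le> w z - q z" using d(2)[OF z] by (intro y) (auto simp: A_def)
      show "(\<lambda>z. w z - q z) differentiable at z" using dw dq[OF z'] by auto
      show "pd i (\<lambda>z. w z - q z) z = p i z"
        using dw dq[OF z'] by (simp add: pd_diff p_def)
    next
      have "y \<bullet> y > 0" by (rule less_trans[OF zero_less_one conjunct1[OF int]])
      then show "p i differentiable at y" by (rule dp)
    qed
    define s where "s = y \<bullet> y"
    have s: "s > 0" unfolding s_def by (rule less_trans[OF zero_less_one conjunct1[OF int]])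
    have "0 \<le> (\<Sum>i\<in>UNIV. pd i (p i) y)" by (rule sum_nonneg) (rule pos)
    also have "\<dots> = (real m - 1) * w y * ((real m - 1) * (\<Sum>i\<in>UNIV. (pd i u y)\<^sup>2) + (\<Sum>i\<in>UNIV. pd i (pd i u) y))
       - real (2 * m) * (2 * \<delta> - 2 * (real m - 1) * c * inverse s ^ m)
       - 4 * real m * (real m - 1) * c * inverse s ^ Suc m * (\<Sum>i\<in>UNIV. (y $ i)\<^sup>2)"
      using dp(2)[OF s[unfolded s_def]] by (simp add: s_def sum_subtractf sum.distrib sum_distrib_left n(1) distrib_left mult.assoc)
    also have "(\<Sum>i\<in>UNIV. (y $ i)\<^sup>2) = s" by (simp add: s_def inner_vec_def power2_eq_square)
    also have "(\<Sum>i\<in>UNIV. pd i (pd i u) y) = - neg_laplacian u y" by (simp add: neg_laplacian_def)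
    also have "inverse s ^ Suc m = inverse s ^ m / s" by (simp add: divide_inverse)
    also have "(real m - 1) * w y * ((real m - 1) * (\<Sum>i\<in>UNIV. (pd i u y)\<^sup>2) + - neg_laplacian u y) \<le> 0"
      using R[of y] n(2) by (intro mult_nonneg_nonpos) (auto simp: w)
    finally have "0 \<le> - (4 * real m * \<delta>)"
      using s by (simp add: algebra_simps)
    moreover have "0 < 4 * real m * \<delta>" using \<delta> n(2) by (intro mult_pos_pos) auto
    ultimately show False by linarith
  qed
  then have "y \<bullet> y = 1 \<or> y \<bullet> y = \<rho>" using y(1) by (auto simp: A_def)
  then have "w y - q y \<ge> - \<delta> - \<delta> * \<rho> - c * inverse \<rho> ^ (m - 1)"
  proof
    assume "y \<bullet> y = 1"
    moreover have "0 \<le> c * inverse \<rho> ^ (m - 1)" "0 \<le> \<delta> * \<rho>" using c \<rho> \<delta> by auto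
    ultimately show ?thesis using c(2)[of y] by (simp add: q_def)
  next
    assume "y \<bullet> y = \<rho>"
    moreover have "w y > 0" by (simp add: w)
    ultimately show ?thesis using \<delta> by (simp add: q_def)
  qed
  with y(2)[OF \<open>x \<in> A\<close>] show ?thesis by (simp add: q_def)
qed

text \<open>Letting \<open>\<delta> \<rightarrow> 0\<close> and then \<open>\<rho> \<rightarrow> \<infinity>\<close> in the comparison on annuli. The coefficient
  \<open>1\<close> of the logarithm of \<open>x \<bullet> x\<close> matters: it becomes the bound \<open>2\<close> on the mass.\<close>

lemma log_lower_bound:
  fixes u :: "real ^ 'n::finite \<Rightarrow> real"
  assumes n: "CARD('n) = 2 * m" "m \<ge> 2" and u: "C_inf u"
    and R: "\<And>x. - neg_laplacian u x + (real m - 1) * (\<Sum>i\<in>UNIV. (pd i u x)\<^sup>2) \<le> 0"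
  shows "\<exists>C. \<forall>x. u x \<ge> - ln (1 + x \<bullet> x) - C"
proof -
  define w where "w = (\<lambda>x. exp ((real m - 1) * u x))"
  have cu: "continuous_on A u" for A by (rule C_inf_continuous[OF u])
  obtain y0 where y0: "\<And>y. y \<in> cball 0 1 \<Longrightarrow> u y0 \<le> u y"
    using continuous_attains_inf[OF compact_cball _ cu, of 0 1] by (metis cball_eq_empty not_one_less_zero)
  define c where "c = exp ((real m - 1) * u y0)"
  have m1: "real m - 1 > 0" using n(2) by simp
  have c: "c > 0" "c \<le> w x" if "x \<bullet> x = 1" for x
  proof -
    have "x \<in> cball 0 1" using that by (simp add: norm_eq_sqrt_inner)
    from y0[OF this] show "c \<le> w x" using m1 by (simp add: c_def w_def)
  qed (simp add: c_def)
  have c0: "c > 0" by (simp add: c_def)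
  have w1: "w x \<ge> c * inverse (x \<bullet> x) ^ (m - 1)" if x: "x \<bullet> x \<ge> 1" for x
  proof -
    have 1: "w x \<ge> c * inverse (x \<bullet> x) ^ (m - 1) - c * inverse \<rho> ^ (m - 1)" if \<rho>: "\<rho> \<ge> x \<bullet> x" for \<rho>
    proof (rule field_le_epsilon)
      fix e :: real assume e: "e > 0"
      define \<delta> where "\<delta> = e / (1 + \<rho>)"
      have "\<rho> > 0" using x \<rho> by simp
      then have \<delta>: "\<delta> > 0" "\<delta> * (1 + \<rho>) = e" using e by (auto simp: \<delta>_def)
      have "w x \<ge> c * inverse (x \<bullet> x) ^ (m - 1) + \<delta> * (x \<bullet> x) - \<delta> - \<delta> * \<rho> - c * inverse \<rho> ^ (m - 1)"
        by (rule superharmonic_on_annulus_lower_bound[OF n u R w_def c0 c(2) x \<rho> \<delta>(1)])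
      moreover have "\<delta> * (x \<bullet> x) \<ge> 0" using \<delta> by simp
      ultimately show "c * inverse (x \<bullet> x) ^ (m - 1) - c * inverse \<rho> ^ (m - 1) \<le> w x + e"
        using \<delta>(2) by (simp add: algebra_simps)
    qed
    have "((\<lambda>\<rho>. c * inverse (x \<bullet> x) ^ (m - 1) - c * inverse \<rho> ^ (m - 1)) \<longlongrightarrow>
       c * inverse (x \<bullet> x) ^ (m - 1) - c * 0 ^ (m - 1)) at_top"
      by (intro tendsto_intros tendsto_inverse_0_at_top filterlim_ident)
    moreover have "\<forall>\<^sub>F \<rho> in at_top. c * inverse (x \<bullet> x) ^ (m - 1) - c * inverse \<rho> ^ (m - 1) \<le> w x"
      using eventually_ge_at_top[of "x \<bullet> x"] by eventually_elim (rule 1)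
    ultimately have "c * inverse (x \<bullet> x) ^ (m - 1) - c * 0 ^ (m - 1) \<le> w x"
      by (rule tendsto_upperbound) simp
    moreover have "(0::real) ^ (m - 1) = 0" using n(2) by (simp add: zero_power)
    ultimately show ?thesis by (simp only:)
  qed
  have "u x \<ge> - ln (1 + x \<bullet> x) - (- u y0)" for x
  proof (cases "x \<bullet> x \<ge> 1")
    case True
    then have "x \<noteq> 0" by auto
    have "ln (c * inverse (x \<bullet> x) ^ (m - 1)) \<le> ln (w x)"
    proof (rule ln_mono[OF w1[OF True]])
      have "x \<bullet> x > 0" using True by linarith
      then show "0 < c * inverse (x \<bullet> x) ^ (m - 1)" using c0 by simp
    qed
    moreover have "ln (w x) = (real m - 1) * u x" by (simp add: w_def)
    moreover have "ln (c * inverse (x \<bullet> x) ^ (m - 1)) = (real m - 1) * u y0 - (real m - 1) * ln (x \<bullet> x)"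
      using c0 True n(2) \<open>x \<noteq> 0\<close> by (simp add: ln_mult ln_realpow ln_inverse c_def of_nat_diff)
    ultimately have "(real m - 1) * (u y0 - ln (x \<bullet> x)) \<le> (real m - 1) * u x" by (simp add: algebra_simps)
    then have "u y0 - ln (x \<bullet> x) \<le> u x" using m1 by simp
    moreover have "ln (x \<bullet> x) \<le> ln (1 + x \<bullet> x)" using \<open>x \<noteq> 0\<close> by (intro ln_mono) auto
    ultimately show ?thesis by simp
  next
    case False
    then have "x \<in> cball 0 1" by (simp add: norm_eq_sqrt_inner)
    then have "u y0 \<le> u x" by (rule y0)
    moreover have "ln (1 + x \<bullet> x) \<ge> 0" by (rule ln_ge_zero) simp
    ultimately show ?thesis by linarith
  qed
  then show ?thesis by blast
qed

section \<open>Curvature of a conformally flat metric\<close>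

lemma matrix_inv_mat:
  assumes "c \<noteq> (0 :: real)"
  shows "matrix_inv (mat c :: real ^ 'n::finite ^ 'n) = mat (inverse c)"
proof -
  have *: "mat a ** mat b = (mat (a * b) :: real ^ 'n ^ 'n)" for a b :: real
    by (simp add: vec_eq_iff matrix_matrix_mult_def mat_def if_distrib[where f = "\<lambda>x. x * _"] cong: if_cong)
  let ?A = "mat c :: real ^ 'n ^ 'n" and ?B = "mat (inverse c) :: real ^ 'n ^ 'n"
  have AB: "?A ** ?B = mat 1" "?B ** ?A = mat 1" using assms by (simp_all add: *)
  then have inv: "?A ** matrix_inv ?A = mat 1"
    unfolding matrix_inv_def by (rule someI2[of _ ?B, OF conjI]) blast
  have "matrix_inv ?A = (?B ** ?A) ** matrix_inv ?A" unfolding AB by simp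
  also have "\<dots> = ?B" unfolding matrix_mul_assoc[symmetric] inv by simp
  finally show ?thesis .
qed

lemma christoffel_conformal:
  fixes u :: "real ^ 'n::finite \<Rightarrow> real"
  assumes "C_inf u"
  shows "christoffel (conformal_metric u) k i j x =
     (if j = k then pd i u x else 0) + (if i = k then pd j u x else 0) - (if i = j then pd k u x else 0)"
proof -
  have d: "pd a (\<lambda>y. conformal_metric u y $ b $ c) x = (if b = c then 2 * exp (2 * u x) * pd a u x else 0)" for a b c
  proof (cases "b = c")
    case True
    have "((\<lambda>s. exp (2 * s)) has_real_derivative 2 * exp (2 * u x)) (at (u x))"
      by (auto intro!: derivative_eq_intros)
    from pd_compose(1)[OF C_inf_differentiable[OF assms] this, of a] True
    show ?thesis by (simp add: conformal_metric_def mat_def)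
  qed (simp add: conformal_metric_def mat_def)
  have inv: "matrix_inv (conformal_metric u x) $ k $ l = (if k = l then exp (- (2 * u x)) else 0)" for l
    by (simp add: conformal_metric_def matrix_inv_mat exp_minus) (simp add: mat_def)
  have "christoffel (conformal_metric u) k i j x = 1 / 2 * (exp (- (2 * u x)) *
     ((if j = k then 2 * exp (2 * u x) * pd i u x else 0) + (if i = k then 2 * exp (2 * u x) * pd j u x else 0)
      - (if i = j then 2 * exp (2 * u x) * pd k u x else 0)))"
    unfolding christoffel_def d inv
    by (simp add: if_distrib[where f = "\<lambda>x. x * _"] cong: if_cong)
  moreover have "exp (- (2 * u x)) * exp (2 * u x) = 1" by (simp flip: exp_add)
  then have "1 / 2 * (exp (- (2 * u x)) * ((if P then 2 * exp (2 * u x) * a else 0)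
      + (if Q then 2 * exp (2 * u x) * b else 0) - (if R then 2 * exp (2 * u x) * c else 0)))
     = (if P then a else 0) + (if Q then b else 0) - (if R then c else 0)" for P Q R a b c
    by (auto simp: algebra_simps)
  ultimately show ?thesis by (simp only:)
qed

lemma pd_christoffel_conformal:
  fixes u :: "real ^ 'n::finite \<Rightarrow> real"
  assumes "C_inf u"
  shows "pd l (christoffel (conformal_metric u) k i j) x =
     (if j = k then pd l (pd i u) x else 0) + (if i = k then pd l (pd j u) x else 0) - (if i = j then pd l (pd k u) x else 0)"
proof -
  have d: "pd a u differentiable (at x)" for a by (rule C_inf_differentiable[OF C_inf_pd[OF assms]])
  have d': "(\<lambda>x. if P then pd a u x else 0) differentiable (at x)" for P a by (cases P) (simp_all add: d)
  have p': "pd l (\<lambda>x. if P then pd a u x else 0) x = (if P then pd l (pd a u) x else 0)" for P a by (cases P) simp_all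
  have "christoffel (conformal_metric u) k i j = (\<lambda>x. ((if j = k then pd i u x else 0) + (if i = k then pd j u x else 0)) - (if i = j then pd k u x else 0))"
    by (simp add: fun_eq_iff christoffel_conformal[OF assms])
  then show ?thesis
    by (simp only:) (subst pd_diff pd_add, intro differentiable_add d', rule d', (subst pd_add, (rule d')+)?, simp add: p')
qed

text \<open>In classical notation \<open>- (n - 2) (\<nabla>\<^sup>2u - du \<otimes> du) - (\<Delta>u + (n - 2) |\<nabla>u|\<^sup>2) I\<close>. The two orders of
  differentiation are kept apart, since \<open>pd_commute\<close> covers even dimensions only.\<close>

lemma ricci_conformal:
  fixes u :: "real ^ 'n::finite \<Rightarrow> real"
  assumes "C_inf u"
  shows "ricci (conformal_metric u) x $ j $ k =
     pd k (pd j u) x + (1 - real CARD('n)) * pd j (pd k u) x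
      + (real CARD('n) - 2) * (pd j u x * pd k u x)
      + (if j = k then neg_laplacian u x - (real CARD('n) - 2) * (\<Sum>i\<in>UNIV. (pd i u x)\<^sup>2) else 0)"
proof -
  define G where "G k i j = christoffel (conformal_metric u) k i j x" for k i j
  define U where "U i = pd i u x" for i
  define n where "n = real CARD('n)"
  define S where "S = (\<Sum>i\<in>UNIV. U i * U i)"
  have G: "G k i j = (if j = k then U i else 0) + (if i = k then U j else 0) - (if i = j then U k else 0)" for k i j
    by (simp add: G_def U_def christoffel_conformal[OF assms])
  have trG: "G i i m = U m" for i m by (simp add: G)
  have mult_if: "(if P then a else 0) * b = (if P then a * b else 0)" "b * (if P then a else 0) = (if P then b * a else 0)"
    for P and a b :: real by auto
  have S_if: "(\<Sum>m\<in>UNIV. if P then U m * U m else 0) = (if P then S else 0)" for P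
    by (simp add: S_def)
  have A: "(\<Sum>m\<in>UNIV. G i i m * G m j k) = 2 * U j * U k - (if j = k then S else 0)" for i
    unfolding trG by (simp add: G algebra_simps sum.distrib sum_subtractf mult_if S_if)
  have B1: "(\<Sum>m\<in>UNIV. G i j m * G m i k) = U j * U k + (if j = i then 2 * (U k * U i) else 0)
      - (if j = i then if i = k then S else 0 else 0) - (if k = j then U i * U i else 0)
      - (if i = j then U i * U k else 0) + (if i = k then U i * U j else 0)" for i
  proof -
    have "(\<Sum>m\<in>UNIV. G i j m * G m i k) =
       (\<Sum>m\<in>UNIV. (if m = i then U j * G i i k else 0)) + (\<Sum>m\<in>UNIV. (if j = i then U m * G m i k else 0))
       - (\<Sum>m\<in>UNIV. (if m = j then U i * G j i k else 0))"
      unfolding sum.distrib[symmetric] sum_subtractf[symmetric]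
      by (rule sum.cong[OF refl]) (auto simp: G[of i j] algebra_simps)
    also have "(\<Sum>m\<in>UNIV. (if m = i then U j * G i i k else 0)) = U j * U k" by (simp add: trG)
    also have "(\<Sum>m\<in>UNIV. (if j = i then U m * G m i k else 0)) = (if j = i then 2 * (U k * U i) - (if i = k then S else 0) else 0)"
      by (simp add: G algebra_simps sum.distrib sum_subtractf mult_if S_if)
    also have "(\<Sum>m\<in>UNIV. (if m = j then U i * G j i k else 0)) = (if k = j then U i * U i else 0)
       + (if i = j then U i * U k else 0) - (if i = k then U i * U j else 0)"
      by (auto simp: G algebra_simps)
    finally show ?thesis by simp
  qed
  have B: "(\<Sum>i\<in>UNIV. \<Sum>m\<in>UNIV. G i j m * G m i k) = (n + 2) * (U j * U k) - 2 * (if j = k then S else 0)"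
  proof -
    have 1: "(\<Sum>i\<in>UNIV. if k = j then U i * U i else 0) = (if j = k then S else 0)"
      by (auto simp: S_def)
    show ?thesis unfolding B1
      by (simp add: sum.distrib sum_subtractf 1 n_def algebra_simps)
  qed
  have "ricci (conformal_metric u) x $ j $ k =
    (\<Sum>i\<in>UNIV. pd i (christoffel (conformal_metric u) i j k) x) - (\<Sum>i\<in>UNIV. pd j (christoffel (conformal_metric u) i i k) x)
     + ((\<Sum>i\<in>UNIV. \<Sum>m\<in>UNIV. G i i m * G m j k) - (\<Sum>i\<in>UNIV. \<Sum>m\<in>UNIV. G i j m * G m i k))"
    by (simp add: ricci_def riemann_def G_def sum.distrib sum_subtractf)
  also have "(\<Sum>i\<in>UNIV. pd i (christoffel (conformal_metric u) i j k) x) = pd k (pd j u) x + pd j (pd k u) x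
      + (if j = k then neg_laplacian u x else 0)"
    by (simp add: pd_christoffel_conformal[OF assms] sum.distrib sum_subtractf neg_laplacian_def)
  also have "(\<Sum>i\<in>UNIV. pd j (christoffel (conformal_metric u) i i k) x) = n * pd j (pd k u) x"
    by (simp add: pd_christoffel_conformal[OF assms] n_def sum.distrib sum_subtractf)
  also have "(\<Sum>i\<in>UNIV. \<Sum>m\<in>UNIV. G i i m * G m j k) = n * (2 * U j * U k - (if j = k then S else 0))"
    unfolding A by (simp add: n_def)
  finally have "ricci (conformal_metric u) x $ j $ k =
      pd k (pd j u) x + (1 - n) * pd j (pd k u) x + (n - 2) * (U j * U k)
      + (if j = k then neg_laplacian u x - (n - 2) * S else 0)"
    unfolding B by (auto simp: algebra_simps)
  then show ?thesis by (simp only: n_def U_def S_def power2_eq_square)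
qed

lemma scalar_curvature_conformal:
  fixes u :: "real ^ 'n::finite \<Rightarrow> real"
  assumes "C_inf u"
  shows "scalar_curvature (conformal_metric u) x = exp (- (2 * u x)) * (real CARD('n) - 1) *
     (2 * neg_laplacian u x - (real CARD('n) - 2) * (\<Sum>i\<in>UNIV. (pd i u x)\<^sup>2))"
proof -
  have inv: "matrix_inv (conformal_metric u x) $ k $ l = (if k = l then exp (- (2 * u x)) else 0)" for k l
    by (simp add: conformal_metric_def matrix_inv_mat exp_minus) (simp add: mat_def)
  have "scalar_curvature (conformal_metric u) x = exp (- (2 * u x)) * (\<Sum>j\<in>UNIV. ricci (conformal_metric u) x $ j $ j)"
    unfolding scalar_curvature_def inv
    by (simp add: if_distrib[where f = "\<lambda>x. x * _"] sum_distrib_left cong: if_cong)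
  also have "(\<Sum>j\<in>UNIV. ricci (conformal_metric u) x $ j $ j) =
     (2 - real CARD('n)) * (\<Sum>j\<in>UNIV. pd j (pd j u) x) + (real CARD('n) - 2) * (\<Sum>i\<in>UNIV. (pd i u x)\<^sup>2)
     + real CARD('n) * (neg_laplacian u x - (real CARD('n) - 2) * (\<Sum>i\<in>UNIV. (pd i u x)\<^sup>2))"
    unfolding ricci_conformal[OF assms]
    by (simp add: sum.distrib sum_distrib_left power2_eq_square algebra_simps sum_subtractf)
  also have "(\<Sum>j\<in>UNIV. pd j (pd j u) x) = - neg_laplacian u x" by (simp add: neg_laplacian_def)
  finally show ?thesis by (simp add: algebra_simps)
qed

lemma ricci_form_conformal:
  fixes u :: "real ^ 'n::finite \<Rightarrow> real"
  assumes "C_inf u"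
  shows "v \<bullet> (ricci (conformal_metric u) x *v v) =
     (real CARD('n) - 2) * ((\<Sum>i\<in>UNIV. v $ i * pd i u x)\<^sup>2 - (\<Sum>i\<in>UNIV. \<Sum>j\<in>UNIV. v $ i * v $ j * pd i (pd j u) x))
     + (v \<bullet> v) * (neg_laplacian u x - (real CARD('n) - 2) * (\<Sum>i\<in>UNIV. (pd i u x)\<^sup>2))"
proof -
  define L where "L = neg_laplacian u x - (real CARD('n) - 2) * (\<Sum>i\<in>UNIV. (pd i u x)\<^sup>2)"
  define H where "H i j = pd i (pd j u) x" for i j
  define U where "U i = pd i u x" for i
  have R: "ricci (conformal_metric u) x $ j $ k = H k j + (1 - real CARD('n)) * H j k
      + (real CARD('n) - 2) * (U j * U k) + (if j = k then L else 0)" for j k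
    unfolding ricci_conformal[OF assms] L_def H_def U_def ..
  have "v \<bullet> (ricci (conformal_metric u) x *v v) = (\<Sum>j\<in>UNIV. \<Sum>k\<in>UNIV. v $ j * v $ k * ricci (conformal_metric u) x $ j $ k)"
    by (simp add: inner_vec_def matrix_vector_mult_def sum_distrib_left mult_ac)
  also have "\<dots> = (\<Sum>j\<in>UNIV. \<Sum>k\<in>UNIV. v $ j * v $ k * H k j)
      + (1 - real CARD('n)) * (\<Sum>j\<in>UNIV. \<Sum>k\<in>UNIV. v $ j * v $ k * H j k)
      + (real CARD('n) - 2) * (\<Sum>j\<in>UNIV. \<Sum>k\<in>UNIV. (v $ j * U j) * (v $ k * U k))
      + (\<Sum>j\<in>UNIV. \<Sum>k\<in>UNIV. if j = k then v $ j * v $ k * L else 0)"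
    unfolding R sum_distrib_left sum.distrib[symmetric]
    by (intro sum.cong refl) (simp add: algebra_simps)
  also have "(\<Sum>j\<in>UNIV. \<Sum>k\<in>UNIV. v $ j * v $ k * H k j) = (\<Sum>j\<in>UNIV. \<Sum>k\<in>UNIV. v $ j * v $ k * H j k)"
    by (subst sum.swap) (simp add: mult_ac)
  also have "(\<Sum>j\<in>UNIV. \<Sum>k\<in>UNIV. (v $ j * U j) * (v $ k * U k)) = (\<Sum>i\<in>UNIV. v $ i * U i)\<^sup>2"
    by (simp add: power2_eq_square sum_product)
  also have "(\<Sum>j\<in>UNIV. \<Sum>k\<in>UNIV. if j = k then v $ j * v $ k * L else 0) = (v \<bullet> v) * L"
    by (simp add: inner_vec_def sum_distrib_right)
  finally show ?thesis
    unfolding H_def[symmetric] U_def[symmetric] L_def[folded U_def, symmetric] by (simp add: algebra_simps)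
qed

section \<open>Growth of iterated Laplacians\<close>

abbreviation nlap :: "nat \<Rightarrow> (real ^ 'n::finite \<Rightarrow> real) \<Rightarrow> real ^ 'n \<Rightarrow> real" where
  "nlap k u \<equiv> (neg_laplacian ^^ k) u"

text \<open>The index \<open>N\<close> of the kernel rises together with the number of Laplacians, which makes
  this a chain in the sense of \<open>taylor_at_0\<close>: \<open>- \<Delta>\<close> acts as \<open>- d/d\<tau>\<close>.\<close>

definition lap_chain :: "nat \<Rightarrow> (real ^ 'n::finite \<Rightarrow> real) \<Rightarrow> nat \<Rightarrow> real \<Rightarrow> real" where
  "lap_chain N v j \<tau> = ker_avg (N + j) \<tau> (nlap j v)"

lemma DERIV_lap_chain:
  fixes v :: "real ^ 'n::finite \<Rightarrow> real"
  assumes "\<tau> > 0" "N \<ge> 2" "C_inf v" "even CARD('n)"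
  shows "(lap_chain N v j has_real_derivative - lap_chain N v (Suc j) \<tau>) (at \<tau>)"
  unfolding lap_chain_def[abs_def]
  using DERIV_ker_avg[OF assms(1) _ C_inf_neg_laplacian_power[OF assms(3)] assms(4), of "N + j" j] assms(2) by simp

text \<open>Averages of a superharmonic function decrease in \<open>\<tau>\<close>, starting from its value at the centre.\<close>

lemma ker_avg_le_value:
  fixes v :: "real ^ 'n::finite \<Rightarrow> real"
  assumes "\<tau> > 0" "N \<ge> 2" "C_inf v" "even CARD('n)" "\<And>z. neg_laplacian v z \<ge> 0"
  shows "ker_avg N \<tau> v \<le> ker_mass TYPE('n) N * v 0"
proof -
  have "ker_avg N \<tau> v \<le> ker_avg N t v" if "0 < t" "t < \<tau>" for t
  proof (rule DERIV_nonpos_imp_nonincreasing[where f = "\<lambda>\<tau>. ker_avg N \<tau> v"])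
    fix x assume "t \<le> x"
    then have "x > 0" using that by simp
    then show "\<exists>y. ((\<lambda>\<tau>. ker_avg N \<tau> v) has_real_derivative y) (at x) \<and> y \<le> 0"
      using DERIV_ker_avg[of x N v] ker_avg_nonneg[of x "Suc N" "neg_laplacian v"] assms
        C_inf_continuous[OF C_inf_neg_laplacian[OF assms(3)]]
      by (intro exI[of _ "- ker_avg (Suc N) x (neg_laplacian v)"]) auto
  qed (use that in simp)
  then have "\<forall>\<^sub>F t in at_right 0. ker_avg N \<tau> v \<le> ker_avg N t v"
    using assms(1) by (auto simp: eventually_at_right_field intro!: exI[of _ \<tau>])
  then show ?thesis
    by (rule tendsto_lowerbound[OF ker_avg_tendsto[OF C_inf_continuous[OF assms(3)] assms(2,4)]]) simp
qed

lemma neg_laplacian_pd: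
  fixes v :: "real ^ 'n::finite \<Rightarrow> real"
  assumes "C_inf v" "even CARD('n)"
  shows "neg_laplacian (pd i v) = pd i (neg_laplacian v)"
proof
  fix x
  have d: "pd j (pd j v) differentiable (at x)" for j
    using assms by (intro C_inf_differentiable C_inf_pd)
  have "pd i (neg_laplacian v) x = - (\<Sum>j\<in>UNIV. pd i (pd j (pd j v)) x)"
    unfolding neg_laplacian_def[abs_def] using d by (subst pd_uminus) (auto simp: pd_sum)
  also have "\<dots> = neg_laplacian (pd i v) x"
    unfolding neg_laplacian_def using assms by (simp add: pd_commute[of _ i] C_inf_pd)
  finally show "neg_laplacian (pd i v) x = pd i (neg_laplacian v) x" ..
qed

lemma nlap_pd:
  fixes v :: "real ^ 'n::finite \<Rightarrow> real"
  assumes "C_inf v" "even CARD('n)"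
  shows "nlap k (pd i v) = pd i (nlap k v)"
  by (induction k) (auto simp: neg_laplacian_pd assms C_inf_neg_laplacian_power)

text \<open>The two curvature conditions for \<open>exp (2 * u)\<close> times the Euclidean metric, stripped of
  positive factors.\<close>

locale nonneg_curvatures =
  fixes u :: "real ^ 'n::finite \<Rightarrow> real" and m :: nat
  assumes dim: "CARD('n) = 2 * m" and m: "m \<ge> 2" and u: "C_inf u"
    and Q: "\<And>x. nlap m u x \<ge> 0"
    and R: "\<And>x. - neg_laplacian u x + (real m - 1) * (\<Sum>i\<in>UNIV. (pd i u x)\<^sup>2) \<le> 0"
begin

lemma even_dim: "even CARD('n)" by (simp add: dim)

lemma cont_nlap: "continuous_on A (nlap j u)"
  by (intro C_inf_continuous C_inf_neg_laplacian_power u)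

lemma neg_laplacian_nonneg: "neg_laplacian u x \<ge> 0"
proof -
  have "0 \<le> (real m - 1) * (\<Sum>i\<in>UNIV. (pd i u x)\<^sup>2)"
    using m by (intro mult_nonneg_nonneg sum_nonneg) auto
  with R[of x] show ?thesis by simp
qed

lemma nonneg_curvatures_translate: "nonneg_curvatures (\<lambda>x. u (a + x)) m"
  by unfold_locales
    (use dim m u Q R in \<open>auto simp: C_inf_translate neg_laplacian_power_translate
      neg_laplacian_translate pd_translate_C_inf\<close>)

lemma log_bound: "\<exists>C. \<forall>x. u x \<ge> - ln (1 + x \<bullet> x) - C"
  by (rule log_lower_bound[OF dim m u R])

text \<open>Superharmonicity of \<open>u\<close> bounds its means above, the pointwise logarithmic bound holds them
  from below, and the two together control the means of \<open>|u|\<close>.\<close>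

lemma ker_avg_log_bound:
  assumes "N \<ge> 2"
  shows "\<exists>A. \<forall>\<tau>\<ge>1. - A - ker_mass TYPE('n) N * ln \<tau> \<le> ker_avg N \<tau> u \<and> ker_avg N \<tau> u \<le> A \<and> ker_avg N \<tau> (\<lambda>z. \<bar>u z\<bar>) \<le> A + 2 * ker_mass TYPE('n) N * ln \<tau>"
proof -
  obtain C where C: "\<And>x. u x \<ge> - ln (1 + x \<bullet> x) - C" using log_bound by blast
  define k where "k = ker_mass TYPE('n) N"
  have k: "k > 0" unfolding k_def by (rule ker_mass_pos) (use assms in simp)
  define C' where "C' = ln 2 + \<bar>C\<bar>"
  have C': "C' \<ge> 0" by (simp add: C'_def)
  define A where "A = k * \<bar>u 0\<bar> + 2 * (k * C')"
  have N1: "1 \<le> N" using assms by simp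
  have cu: "continuous_on UNIV u" by (rule C_inf_continuous[OF u])
  have "- A - k * ln \<tau> \<le> ker_avg N \<tau> u \<and> ker_avg N \<tau> u \<le> A \<and> ker_avg N \<tau> (\<lambda>z. \<bar>u z\<bar>) \<le> A + 2 * k * ln \<tau>" if t: "\<tau> \<ge> 1" for \<tau>
  proof -
    have t0: "\<tau> > 0" "ln \<tau> \<ge> 0" using t by auto
    have b: "- C' - ln \<tau> \<le> u z" if z: "z \<bullet> z \<le> \<tau>" for z
    proof -
      have "1 + z \<bullet> z \<le> 2 * \<tau>" using z t by simp
      then have "ln (1 + z \<bullet> z) \<le> ln (2 * \<tau>)"
        by (rule ln_mono) (simp add: add_pos_nonneg)
      also have "\<dots> = ln 2 + ln \<tau>" using t by (simp add: ln_mult)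
      finally show ?thesis using C[of z] by (simp add: C'_def)
    qed
    have "ker_avg N \<tau> (\<lambda>z :: real ^ 'n. - C' - ln \<tau>) \<le> ker_avg N \<tau> u"
      by (rule ker_avg_mono[OF t0(1) N1 continuous_on_const cu b])
    then have lower: "(- C' - ln \<tau>) * k \<le> ker_avg N \<tau> u" using ker_avg_const[OF t0(1) assms even_dim] by (simp add: k_def)
    have "ker_avg N \<tau> u \<le> k * u 0"
      unfolding k_def by (rule ker_avg_le_value[OF t0(1) assms u even_dim neg_laplacian_nonneg])
    also have "k * u 0 \<le> k * \<bar>u 0\<bar>" using k by simp
    finally have upper: "ker_avg N \<tau> u \<le> k * \<bar>u 0\<bar>" .
    have "ker_avg N \<tau> (\<lambda>z. \<bar>u z\<bar>) \<le> ker_avg N \<tau> (\<lambda>z. u z + 2 * (C' + ln \<tau>))"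
    proof (rule ker_avg_mono[OF t0(1) N1])
      fix z :: "real ^ 'n" assume "z \<bullet> z \<le> \<tau>"
      from b[OF this] show "\<bar>u z\<bar> \<le> u z + 2 * (C' + ln \<tau>)" using C' t0 by (simp add: abs_if)
    qed (intro continuous_intros cu)+
    also have "\<dots> = ker_avg N \<tau> u + 2 * (C' + ln \<tau>) * k"
      using ker_avg_const[OF t0(1) assms even_dim] by (simp add: ker_avg_add[OF t0(1) N1 cu continuous_on_const] k_def)
    finally have "ker_avg N \<tau> (\<lambda>z. \<bar>u z\<bar>) \<le> A + 2 * k * ln \<tau>"
      using upper by (simp add: A_def algebra_simps)
    moreover have "- A - k * ln \<tau> \<le> ker_avg N \<tau> u"
    proof -
      have "0 \<le> k * \<bar>u 0\<bar>" "0 \<le> k * C'" using k C' by auto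
      then show ?thesis using lower by (simp add: A_def algebra_simps)
    qed
    moreover have "ker_avg N \<tau> u \<le> A" using upper k C' by (simp add: A_def) (smt (verit) mult_nonneg_nonneg)
    ultimately show ?thesis by blast
  qed
  then show ?thesis unfolding k_def by blast
qed

text \<open>By downward induction on \<open>k\<close>. If \<open>nlap k u\<close> is superharmonic, a negative value at a point
  bounds all its averages about that point away from zero; then the averages of \<open>u\<close>
  would grow at least linearly in \<open>\<tau>\<close>, but they grow at most logarithmically.\<close>

lemma nlap_nonneg:
  assumes "1 \<le> k" "k \<le> m"
  shows "nlap k u x \<ge> 0"
proof -
  have "\<forall>x. nlap (m - i) u x \<ge> 0" if "i < m" for i
    using that
  proof (induction i)
    case 0 then show ?case using Q by simp
  next
    case (Suc i)
    define k where "k = m - Suc i"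
    have k: "k \<ge> 1" "Suc k = m - i" using Suc.prems by (auto simp: k_def)
    have next_nonneg: "nlap (Suc k) u x \<ge> 0" for x unfolding k(2) using Suc by simp
    show ?case
    proof (rule allI, rule ccontr)
      fix x assume "\<not> nlap (m - Suc i) u x \<ge> 0"
      then have neg: "nlap k u x < 0" by (simp add: k_def)
      define w where "w = (\<lambda>z. u (x + z))"
      interpret w: nonneg_curvatures w m unfolding w_def by (rule nonneg_curvatures_translate)
      have wk: "nlap j w = (\<lambda>z. nlap j u (x + z))" for j
        unfolding w_def by (rule neg_laplacian_power_translate[OF u])
      obtain A where A: "\<And>\<tau>. \<tau> \<ge> 1 \<Longrightarrow> - A - ker_mass TYPE('n) 2 * ln \<tau> \<le> ker_avg 2 \<tau> w" "\<And>\<tau>. \<tau> \<ge> 1 \<Longrightarrow> ker_avg 2 \<tau> w \<le> A"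
        using w.ker_avg_log_bound[of 2] by auto
      have kp: "ker_mass TYPE('n) N > 0" if "N \<ge> 1" for N using ker_mass_pos[OF that] .
      show False
      proof (rule chain_not_bounded_away_from_0)
        show "(lap_chain 2 w j has_real_derivative - lap_chain 2 w (Suc j) \<tau>) (at \<tau>)" if "\<tau> > 0" for j \<tau>
          by (rule DERIV_lap_chain[OF that _ w.u even_dim]) simp
        show "\<bar>lap_chain 2 w 0 \<tau>\<bar> \<le> \<bar>A\<bar> + ker_mass TYPE('n) 2 * ln \<tau>" if "\<tau> \<ge> 1" for \<tau>
        proof -
          have "ker_mass TYPE('n) 2 * ln \<tau> \<ge> 0" using that kp[of 2] by simp
          then show ?thesis using A[OF that] by (simp add: lap_chain_def)
        qed
        show "k \<ge> 1" by (rule k)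
        show "lap_chain 2 w k \<tau> \<le> - (ker_mass TYPE('n) (2 + k) * - nlap k u x)" if "\<tau> > 0" for \<tau>
        proof -
          have "ker_avg (2 + k) \<tau> (nlap k w) \<le> ker_mass TYPE('n) (2 + k) * nlap k w 0"
          proof (rule ker_avg_le_value[OF that _ C_inf_neg_laplacian_power[OF w.u] even_dim])
            have "neg_laplacian (nlap k w) z = nlap (Suc k) w z" for z by simp
            then show "neg_laplacian (nlap k w) z \<ge> 0" for z unfolding wk using next_nonneg by metis
          qed simp
          then show ?thesis by (simp add: lap_chain_def wk)
        qed
        show "ker_mass TYPE('n) (2 + k) * - nlap k u x > 0" using neg kp[of "2 + k"] by (simp add: mult_pos_neg)
      qed
    qed
  qed
  from this[of "m - k"] assms show ?thesis by simp
qed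

text \<open>For \<open>j \<ge> 1\<close> all terms of the Taylor polynomial are nonnegative, so each is at most
  the value of the polynomial at \<open>1\<close> minus the term of order \<open>0\<close>, the mean of \<open>u\<close>.\<close>

lemma ker_avg_nlap_bound:
  assumes "N \<ge> 2" "j < m"
  shows "\<exists>A B. \<forall>\<tau>\<ge>1. \<tau> ^ j * ker_avg (N + j) \<tau> (\<lambda>z. \<bar>nlap j u z\<bar>) \<le> A + B * ln \<tau>"
proof (cases "j = 0")
  case True
  then show ?thesis using ker_avg_log_bound[OF assms(1)] by auto
next
  case False
  obtain A where A: "\<And>\<tau>. \<tau> \<ge> 1 \<Longrightarrow> - A - ker_mass TYPE('n) N * ln \<tau> \<le> ker_avg N \<tau> u" using ker_avg_log_bound[OF assms(1)] by blast
  define G where "G = lap_chain N u"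
  have G: "G i \<tau> \<ge> 0" if "1 \<le> i" "i \<le> m" "\<tau> > 0" for i \<tau>
    unfolding G_def lap_chain_def by (rule ker_avg_nonneg) (use that assms nlap_nonneg cont_nlap in auto)
  obtain k where k: "m = Suc k" using m by (cases m) auto
  have "\<tau> ^ j * ker_avg (N + j) \<tau> (\<lambda>z. \<bar>nlap j u z\<bar>) \<le> fact j * (taylor_at_0 m G 1 + A) + (fact j * ker_mass TYPE('n) N) * ln \<tau>"
    if t: "\<tau> \<ge> 1" for \<tau>
  proof -
    have t0: "\<tau> > 0" using t by simp
    have "\<bar>nlap j u z\<bar> = nlap j u z" for z using nlap_nonneg[of j z] False assms by simp
    then have eq: "ker_avg (N + j) \<tau> (\<lambda>z. \<bar>nlap j u z\<bar>) = G j \<tau>" by (simp add: G_def lap_chain_def)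
    have "G 0 \<tau> + \<tau> ^ j / fact j * G j \<tau> \<le> taylor_at_0 m G \<tau>"
      by (rule taylor_at_0_ge_term) (use G t0 False assms in auto)
    also have "\<dots> \<le> taylor_at_0 m G 1"
      unfolding k
    proof (rule taylor_at_0_antimono)
      show "(G j has_real_derivative - G (Suc j) \<tau>) (at \<tau>)" if "\<tau> > 0" for j \<tau>
        unfolding G_def by (rule DERIV_lap_chain[OF that assms(1) u even_dim])
    qed (use G k t in auto)
    finally have "\<tau> ^ j / fact j * G j \<tau> \<le> taylor_at_0 m G 1 + A + ker_mass TYPE('n) N * ln \<tau>"
      using A[OF t] by (simp add: G_def lap_chain_def)
    then have "fact j * (\<tau> ^ j / fact j * G j \<tau>) \<le> fact j * (taylor_at_0 m G 1 + A + ker_mass TYPE('n) N * ln \<tau>)"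
      by (rule mult_left_mono) simp
    then show ?thesis unfolding eq by (simp add: algebra_simps)
  qed
  then show ?thesis by blast
qed

end

section \<open>Total mass and decay\<close>

lemma cube_inner_le:
  fixes z :: "real ^ 'n::finite"
  assumes "z \<in> cube r"
  shows "z \<bullet> z \<le> real CARD('n) * r\<^sup>2"
proof -
  have "z \<bullet> z = (\<Sum>i\<in>UNIV. (z $ i)\<^sup>2)" by (simp add: inner_vec_def power2_eq_square)
  also have "\<dots> \<le> (\<Sum>i::'n\<in>UNIV. r\<^sup>2)"
    by (rule sum_mono) (use assms in \<open>auto simp: cube_iff abs_le_square_iff[symmetric]
      intro: order_trans[OF _ abs_ge_self]\<close>)
  finally show ?thesis by simp
qed

lemma taylor_at_0_tendsto_at_0:
  assumes "\<And>j. j < k \<Longrightarrow> (G j \<longlongrightarrow> L j) (at_right 0)" "k \<ge> 1"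
  shows "(taylor_at_0 k G \<longlongrightarrow> L 0) (at_right 0)"
proof -
  have "((\<lambda>\<tau>. \<Sum>j<k. \<tau> ^ j / fact j * G j \<tau>) \<longlongrightarrow> (\<Sum>j<k. 0 ^ j / fact j * L j)) (at_right 0)"
    by (intro tendsto_sum tendsto_mult tendsto_divide tendsto_power tendsto_const tendsto_ident_at assms(1)) auto
  also have "(\<Sum>j<k. 0 ^ j / fact j * L j) = (\<Sum>j<k. if j = 0 then L 0 else 0)"
    by (rule sum.cong) auto
  also have "\<dots> = L 0" using assms(2) by (simp add: sum.delta)
  finally show ?thesis by (simp add: taylor_at_0_def[abs_def])
qed

lemma taylor_at_0_tendsto_at_top:
  assumes "\<And>j. j < k \<Longrightarrow> ((\<lambda>\<tau>. \<tau> ^ j * G j \<tau>) \<longlongrightarrow> 0) at_top"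
  shows "(taylor_at_0 k G \<longlongrightarrow> 0) at_top"
proof -
  have "((\<lambda>\<tau>. \<Sum>j<k. 1 / fact j * (\<tau> ^ j * G j \<tau>)) \<longlongrightarrow> (\<Sum>j<k. 1 / fact j * 0)) at_top"
    by (intro tendsto_sum tendsto_mult tendsto_const assms) auto
  then show ?thesis by (simp add: taylor_at_0_def[abs_def])
qed

lemma log_over_sqrt_tendsto_0: "((\<lambda>\<tau>. (A + B * ln \<tau>) / sqrt \<tau>) \<longlongrightarrow> 0) at_top"
proof -
  have "((\<lambda>x. (A + B * (2 * ln x)) / x) \<longlongrightarrow> 0) at_top"
  proof -
    have "((\<lambda>x. A / x + 2 * B * (ln x / x)) \<longlongrightarrow> 0 + 2 * B * 0) at_top"
      by (intro tendsto_add tendsto_mult tendsto_const ln_x_over_x_tendsto_0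
        tendsto_divide_0[OF tendsto_const] filterlim_at_top_imp_at_infinity filterlim_ident)
    then show ?thesis by (simp add: add_divide_distrib mult_ac)
  qed
  from filterlim_compose[OF this sqrt_at_top]
  have "((\<lambda>\<tau>. (A + B * (2 * ln (sqrt \<tau>))) / sqrt \<tau>) \<longlongrightarrow> 0) at_top" .
  then show ?thesis
    by (rule Lim_transform_eventually)
      (use eventually_gt_at_top[of 0] in eventually_elim, simp add: ln_sqrt)
qed

text \<open>Moved to the kernel, a partial derivative costs a factor \<open>|z| / \<tau>\<close>, at most the inverse
  square root of \<open>\<tau>\<close> on the support. This gain beats the logarithm in \<open>ker_avg_nlap_bound\<close>.\<close>

lemma ker_avg_pd_bound:
  fixes v :: "real ^ 'n::finite \<Rightarrow> real"
  assumes "\<tau> > 0" "N \<ge> 1" "C_inf v"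
  shows "\<bar>ker_avg (Suc N) \<tau> (pd i v)\<bar> \<le> ker_avg N \<tau> (\<lambda>z. \<bar>v z\<bar>) / sqrt \<tau>"
proof -
  have cv: "continuous_on UNIV v" by (rule C_inf_continuous[OF assms(3)])
  have "norm (integral UNIV (\<lambda>z. z $ i / (2 * \<tau>) * ker N \<tau> z * v z)) \<le> integral UNIV (\<lambda>z. 1 / sqrt \<tau> * (ker N \<tau> z * \<bar>v z\<bar>))"
  proof (rule integral_norm_bound_integral)
    show "(\<lambda>z. z $ i / (2 * \<tau>) * ker N \<tau> z * v z) integrable_on UNIV"
      by (intro compactly_supported_integrable compactly_supported_mult(1)[OF _ cv] compactly_supported_mult(2)[OF compactly_supported_ker[OF assms(1,2)]] continuous_intros) (use assms in auto)
    show "(\<lambda>z. 1 / sqrt \<tau> * (ker N \<tau> z * \<bar>v z\<bar>)) integrable_on UNIV"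
      by (intro compactly_supported_integrable compactly_supported_mult(2) compactly_supported_mult(1)[OF compactly_supported_ker[OF assms(1,2)]] continuous_intros cv)
    fix z :: "real ^ 'n"
    show "norm (z $ i / (2 * \<tau>) * ker N \<tau> z * v z) \<le> 1 / sqrt \<tau> * (ker N \<tau> z * \<bar>v z\<bar>)"
    proof (cases "\<tau> \<le> z \<bullet> z")
      case True then show ?thesis using ker_eq_0[OF True assms(2)] by simp
    next
      case False
      then have "norm z \<le> sqrt \<tau>" by (simp add: norm_eq_sqrt_inner)
      then have "\<bar>z $ i\<bar> \<le> sqrt \<tau>" using component_le_norm_cart[of z i] by linarith
      then have "\<bar>z $ i\<bar> / (2 * \<tau>) \<le> sqrt \<tau> / \<tau>"
        using assms(1) by (intro frac_le) auto
      also have "\<dots> = 1 / sqrt \<tau>" using assms(1) by (simp add: field_simps)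
      finally have "\<bar>z $ i\<bar> / (2 * \<tau>) * (ker N \<tau> z * \<bar>v z\<bar>) \<le> 1 / sqrt \<tau> * (ker N \<tau> z * \<bar>v z\<bar>)"
        by (intro mult_right_mono mult_nonneg_nonneg ker_nonneg[OF assms(1)]) auto
      then show ?thesis using assms(1) ker_nonneg[OF assms(1), of N z] by (simp add: abs_mult)
    qed
  qed
  then show ?thesis unfolding ker_avg_pd[OF assms] by (simp add: ker_avg_def)
qed

lemma ker_avg_pd_pd_bound:
  fixes v :: "real ^ 'n::finite \<Rightarrow> real"
  assumes "\<tau> > 0" "N \<ge> 1" "C_inf v"
  shows "\<bar>ker_avg (N + 2) \<tau> (pd i (pd j v))\<bar> \<le> (ker_avg N \<tau> (\<lambda>z. \<bar>v z\<bar>) + ker_avg (Suc N) \<tau> (\<lambda>z. \<bar>v z\<bar>)) / \<tau>"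
proof -
  have cv: "continuous_on UNIV v" by (rule C_inf_continuous[OF assms(3)])
  have N: "Suc N \<ge> 1" by simp
  let ?d = "if i = j then 1 / (2 * \<tau>) else 0"
  let ?g = "\<lambda>z. (z $ i * z $ j / (4 * \<tau>\<^sup>2) * ker N \<tau> z - ?d * ker (Suc N) \<tau> z) * v z"
  have i1: "(\<lambda>z. ker K \<tau> z * \<bar>v z\<bar>) integrable_on UNIV" if "K \<ge> 1" for K
    by (intro compactly_supported_integrable compactly_supported_mult(1)[OF compactly_supported_ker[OF assms(1) that]] continuous_intros cv)
  have "norm (integral UNIV ?g) \<le> integral UNIV (\<lambda>z. 1 / \<tau> * (ker N \<tau> z * \<bar>v z\<bar> + ker (Suc N) \<tau> z * \<bar>v z\<bar>))"
  proof (rule integral_norm_bound_integral)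
    have "compactly_supported (\<lambda>z. z $ i * z $ j / (4 * \<tau>\<^sup>2) * ker N \<tau> z + (- ?d) * ker (Suc N) \<tau> z)"
      by (intro compactly_supported_add compactly_supported_mult(2)[OF compactly_supported_ker[OF assms(1,2)]] compactly_supported_mult(2)[OF compactly_supported_ker[OF assms(1) N]] continuous_intros)
        (use assms in auto)
    then show "?g integrable_on UNIV"
      by (intro compactly_supported_integrable compactly_supported_mult(1)[OF _ cv]) simp
    show "(\<lambda>z. 1 / \<tau> * (ker N \<tau> z * \<bar>v z\<bar> + ker (Suc N) \<tau> z * \<bar>v z\<bar>)) integrable_on UNIV"
      by (intro integrable_on_mult_right integrable_add i1 assms N)
    fix z :: "real ^ 'n"
    have k: "ker N \<tau> z \<ge> 0" "ker (Suc N) \<tau> z \<ge> 0" using ker_nonneg[OF assms(1)] by auto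
    show "norm (?g z) \<le> 1 / \<tau> * (ker N \<tau> z * \<bar>v z\<bar> + ker (Suc N) \<tau> z * \<bar>v z\<bar>)"
    proof (cases "\<tau> \<le> z \<bullet> z")
      case True then show ?thesis using ker_eq_0[OF True assms(2)] ker_eq_0[OF True N] by simp
    next
      case False
      then have nz: "norm z \<le> sqrt \<tau>" by (simp add: norm_eq_sqrt_inner)
      have "\<bar>z $ a\<bar> \<le> sqrt \<tau>" for a using component_le_norm_cart[of z a] nz by linarith
      then have "\<bar>z $ i\<bar> * \<bar>z $ j\<bar> \<le> sqrt \<tau> * sqrt \<tau>" by (intro mult_mono) (use assms in auto)
      then have "\<bar>z $ i * z $ j\<bar> \<le> \<tau>" using assms(1) by (simp add: abs_mult)
      then have "\<bar>z $ i * z $ j\<bar> / (4 * \<tau>\<^sup>2) \<le> \<tau> / \<tau>\<^sup>2" using assms(1) by (intro frac_le) auto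
      then have a: "\<bar>z $ i * z $ j / (4 * \<tau>\<^sup>2)\<bar> \<le> 1 / \<tau>" using assms(1) by (simp add: power2_eq_square abs_mult)
      have b: "\<bar>?d\<bar> \<le> 1 / \<tau>" using assms(1) by (simp add: divide_simps)
      have "\<bar>z $ i * z $ j / (4 * \<tau>\<^sup>2) * ker N \<tau> z - ?d * ker (Suc N) \<tau> z\<bar>
          \<le> \<bar>z $ i * z $ j / (4 * \<tau>\<^sup>2)\<bar> * ker N \<tau> z + \<bar>?d\<bar> * ker (Suc N) \<tau> z"
        using k abs_triangle_ineq4[of "z $ i * z $ j / (4 * \<tau>\<^sup>2) * ker N \<tau> z" "?d * ker (Suc N) \<tau> z"]
        by (simp only: abs_mult abs_of_nonneg)
      also have "\<dots> \<le> 1 / \<tau> * ker N \<tau> z + 1 / \<tau> * ker (Suc N) \<tau> z"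
        by (intro add_mono mult_right_mono a b k)
      finally have "\<bar>z $ i * z $ j / (4 * \<tau>\<^sup>2) * ker N \<tau> z - ?d * ker (Suc N) \<tau> z\<bar> * \<bar>v z\<bar>
          \<le> (1 / \<tau> * ker N \<tau> z + 1 / \<tau> * ker (Suc N) \<tau> z) * \<bar>v z\<bar>"
        by (rule mult_right_mono) simp
      then show ?thesis by (simp only: real_norm_def abs_mult distrib_left distrib_right mult.assoc)
    qed
  qed
  then show ?thesis unfolding ker_avg_pd_pd[OF assms]
    by (simp add: ker_avg_def integral_add[OF i1[OF assms(2)] i1[OF N]])
qed

context nonneg_curvatures begin

lemma taylor_at_0_pd_tendsto_0:
  assumes "N \<ge> 2"
  shows "(taylor_at_0 m (lap_chain (Suc N) (pd i u)) \<longlongrightarrow> 0) at_top"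
proof (rule taylor_at_0_tendsto_at_top)
  fix j assume j: "j < m"
  obtain A B where AB: "\<And>\<tau>. \<tau> \<ge> 1 \<Longrightarrow> \<tau> ^ j * ker_avg (N + j) \<tau> (\<lambda>z. \<bar>nlap j u z\<bar>) \<le> A + B * ln \<tau>"
    using ker_avg_nlap_bound[OF assms j] by blast
  show "((\<lambda>\<tau>. \<tau> ^ j * lap_chain (Suc N) (pd i u) j \<tau>) \<longlongrightarrow> 0) at_top"
  proof (rule Lim_null_comparison[OF _ log_over_sqrt_tendsto_0[of A B]])
    show "\<forall>\<^sub>F \<tau> in at_top. norm (\<tau> ^ j * lap_chain (Suc N) (pd i u) j \<tau>) \<le> (A + B * ln \<tau>) / sqrt \<tau>"
      using eventually_ge_at_top[of 1]
    proof eventually_elim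
      case (elim \<tau>)
      have "\<bar>ker_avg (Suc (N + j)) \<tau> (pd i (nlap j u))\<bar> \<le> ker_avg (N + j) \<tau> (\<lambda>z. \<bar>nlap j u z\<bar>) / sqrt \<tau>"
        by (rule ker_avg_pd_bound) (use elim assms C_inf_neg_laplacian_power[OF u] in auto)
      then have "\<tau> ^ j * \<bar>ker_avg (Suc (N + j)) \<tau> (pd i (nlap j u))\<bar> \<le> \<tau> ^ j * (ker_avg (N + j) \<tau> (\<lambda>z. \<bar>nlap j u z\<bar>) / sqrt \<tau>)"
        using elim by (intro mult_left_mono) auto
      also have "\<dots> \<le> (A + B * ln \<tau>) / sqrt \<tau>"
        using divide_right_mono[OF AB[OF elim], of "sqrt \<tau>"] elim by simp
      finally show ?case using elim
        by (simp add: lap_chain_def nlap_pd[OF u even_dim] abs_mult)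
    qed
  qed
qed

lemma taylor_at_0_pd_pd_tendsto_0:
  assumes "N \<ge> 2"
  shows "(taylor_at_0 m (lap_chain (N + 2) (pd i (pd k u))) \<longlongrightarrow> 0) at_top"
proof (rule taylor_at_0_tendsto_at_top)
  fix j assume j: "j < m"
  obtain A B where AB: "\<And>\<tau>. \<tau> \<ge> 1 \<Longrightarrow> \<tau> ^ j * ker_avg (N + j) \<tau> (\<lambda>z. \<bar>nlap j u z\<bar>) \<le> A + B * ln \<tau>"
    using ker_avg_nlap_bound[OF assms j] by blast
  obtain A' B' where AB': "\<And>\<tau>. \<tau> \<ge> 1 \<Longrightarrow> \<tau> ^ j * ker_avg (Suc N + j) \<tau> (\<lambda>z. \<bar>nlap j u z\<bar>) \<le> A' + B' * ln \<tau>"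
    using ker_avg_nlap_bound[OF _ j, of "Suc N"] assms by auto
  have lim: "((\<lambda>\<tau>. ((A + A') + (B + B') * ln \<tau>) / \<tau>) \<longlongrightarrow> 0) at_top"
  proof -
    have "((\<lambda>x. (A + A') / x + (B + B') * (ln x / x)) \<longlongrightarrow> 0 + (B + B') * 0) at_top"
      by (intro tendsto_add tendsto_mult tendsto_const ln_x_over_x_tendsto_0
        tendsto_divide_0[OF tendsto_const] filterlim_at_top_imp_at_infinity filterlim_ident)
    then show ?thesis by (simp add: add_divide_distrib)
  qed
  show "((\<lambda>\<tau>. \<tau> ^ j * lap_chain (N + 2) (pd i (pd k u)) j \<tau>) \<longlongrightarrow> 0) at_top"
  proof (rule Lim_null_comparison[OF _ lim])
    show "\<forall>\<^sub>F \<tau> in at_top. norm (\<tau> ^ j * lap_chain (N + 2) (pd i (pd k u)) j \<tau>) \<le> ((A + A') + (B + B') * ln \<tau>) / \<tau>"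
      using eventually_ge_at_top[of 1]
    proof eventually_elim
      case (elim \<tau>)
      let ?a = "ker_avg (N + j) \<tau> (\<lambda>z. \<bar>nlap j u z\<bar>)" and ?b = "ker_avg (Suc (N + j)) \<tau> (\<lambda>z. \<bar>nlap j u z\<bar>)"
      have "\<bar>ker_avg (N + j + 2) \<tau> (pd i (pd k (nlap j u)))\<bar> \<le> (?a + ?b) / \<tau>"
        by (rule ker_avg_pd_pd_bound) (use elim assms C_inf_neg_laplacian_power[OF u] in auto)
      then have "\<tau> ^ j * \<bar>ker_avg (N + j + 2) \<tau> (pd i (pd k (nlap j u)))\<bar> \<le> \<tau> ^ j * ((?a + ?b) / \<tau>)"
        using elim by (intro mult_left_mono) auto
      also have "\<dots> \<le> ((A + A') + (B + B') * ln \<tau>) / \<tau>"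
        using divide_right_mono[OF add_mono[OF AB[OF elim] AB'[OF elim]], of \<tau>] elim
        by (simp add: algebra_simps)
      finally show ?case using elim
        by (simp add: lap_chain_def nlap_pd[OF _ even_dim] u C_inf_pd abs_mult)
    qed
  qed
qed

text \<open>Dividing \<open>rep_const N * f\<close> by \<open>ker_mass N\<close> gives the density of the measure whose logarithmic
  potential is \<open>u\<close>; the factor is what the kernel identities produce.\<close>

definition rep_const :: "nat \<Rightarrow> real" where
  "rep_const N = 2 / (4 ^ (N + m) * fact (N + m) * fact (m - 1))"

text \<open>By \<open>DERIV_taylor_at_0\<close> the Taylor polynomial of the means of \<open>u\<close> decreases for large \<open>\<tau>\<close> at
  least at the rate \<open>b / \<tau>\<close>, hence as fast as \<open>b * ln \<tau>\<close>, for every \<open>b\<close> below half of the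
  left-hand side. It dominates the mean of \<open>u\<close>, which is at least \<open>- ker_mass N * ln \<tau>\<close> up to an
  additive constant; so \<open>b \<le> ker_mass N\<close>.\<close>

lemma mass_bound:
  assumes "N \<ge> 2"
  shows "rep_const N * integral (cube r) (nlap m u) \<le> 2 * ker_mass TYPE('n) N"
proof -
  define J where "J = integral (cube r) (nlap m u)"
  define \<kappa> where "\<kappa> = ker_mass TYPE('n) N"
  define M where "M = N + m"
  define S where "S = real CARD('n) * r\<^sup>2"
  define G where "G = lap_chain N u"
  define b where "b \<rho> = rep_const N / 2 * (1 - S / \<rho>) ^ M * J" for \<rho>
  obtain k where k: "m = Suc k" using m by (cases m) auto
  have S: "S \<ge> 0" by (simp add: S_def)
  have fi: "nlap m u integrable_on cube r" by (rule integrable_continuous[OF cont_nlap])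
  have J: "J \<ge> 0" unfolding J_def by (rule integral_nonneg[OF fi Q])
  obtain A where A: "\<And>\<tau>. \<tau> \<ge> 1 \<Longrightarrow> - A - \<kappa> * ln \<tau> \<le> ker_avg N \<tau> u"
    using ker_avg_log_bound[OF assms] unfolding \<kappa>_def by blast
  have Gpos: "G i \<tau> \<ge> 0" if "1 \<le> i" "i \<le> m" "\<tau> > 0" for i \<tau>
    unfolding G_def lap_chain_def by (rule ker_avg_nonneg) (use that assms nlap_nonneg cont_nlap in auto)
  have bk: "b \<rho> \<le> \<kappa>" if \<rho>: "\<rho> \<ge> 1" "\<rho> > S" for \<rho>
  proof (rule ccontr)
    assume "\<not> b \<rho> \<le> \<kappa>"
    then have pos: "b \<rho> - \<kappa> > 0" by simp
    have r01: "0 \<le> 1 - S / \<rho>" using \<rho> by simp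
    have ker_ge: "(1 - S / \<rho>) ^ M / (4 ^ M * fact M * \<tau> ^ m) \<le> ker M \<tau> z"
      if "\<tau> \<ge> \<rho>" "z \<in> cube r" for \<tau> and z :: "real ^ 'n"
    proof -
      have t: "\<tau> > 0" using that \<rho> by simp
      have "z \<bullet> z \<le> S" unfolding S_def by (rule cube_inner_le[OF that(2)])
      also have "S = S / \<rho> * \<rho>" using \<rho> by simp
      also have "\<dots> \<le> S / \<rho> * \<tau>" using that \<rho> S by (intro mult_left_mono) auto
      finally have "\<tau> * (1 - S / \<rho>) \<le> max 0 (\<tau> - z \<bullet> z)" by (simp add: algebra_simps)
      then have "(\<tau> * (1 - S / \<rho>)) ^ M \<le> max 0 (\<tau> - z \<bullet> z) ^ M"
        using t r01 by (intro power_mono) auto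
      then have "(\<tau> * (1 - S / \<rho>)) ^ M / (4 ^ M * fact M * \<tau> ^ (M + m)) \<le> max 0 (\<tau> - z \<bullet> z) ^ M / (4 ^ M * fact M * \<tau> ^ (M + m))"
        using t by (intro divide_right_mono) auto
      moreover have "(\<tau> * (1 - S / \<rho>)) ^ M / (4 ^ M * fact M * \<tau> ^ (M + m)) = (1 - S / \<rho>) ^ M / (4 ^ M * fact M * \<tau> ^ m)"
        using t by (simp add: power_mult_distrib power_add)
      moreover have "ker M \<tau> z = max 0 (\<tau> - z \<bullet> z) ^ M / (4 ^ M * fact M * \<tau> ^ (M + m))"
        by (simp add: ker_def dim)
      ultimately show ?thesis by simp
    qed
    have Gm: "b \<rho> / \<tau> \<le> \<tau> ^ k / fact k * G (Suc k) \<tau>" if t: "\<tau> \<ge> \<rho>" for \<tau>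
    proof -
      have t0: "\<tau> > 0" using t \<rho> by simp
      let ?c = "(1 - S / \<rho>) ^ M / (4 ^ M * fact M * \<tau> ^ m)"
      have M1: "M \<ge> 1" using assms by (simp add: M_def)
      have ci: "(\<lambda>z. ker M \<tau> z * nlap m u z) integrable_on cube r"
        by (intro integrable_continuous continuous_intros cont_nlap) (use t0 in auto)
      have "?c * J = integral (cube r) (\<lambda>z. ?c * nlap m u z)" unfolding J_def by simp
      also have "\<dots> \<le> integral (cube r) (\<lambda>z. ker M \<tau> z * nlap m u z)"
        by (intro integral_le integrable_on_mult_right fi ci mult_right_mono ker_ge[OF t] Q)
      also have "\<dots> \<le> ker_avg M \<tau> (nlap m u)"
        unfolding ker_avg_def
        by (rule integral_subset_le[OF subset_UNIV ci ker_avg_integrable[OF t0 M1 cont_nlap]])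
          (intro ballI mult_nonneg_nonneg ker_nonneg[OF t0] Q)
      finally have "\<tau> ^ k / fact k * (?c * J) \<le> \<tau> ^ k / fact k * ker_avg M \<tau> (nlap m u)"
        using t0 by (intro mult_left_mono) auto
      moreover have "\<tau> ^ k / fact k * (?c * J) = b \<rho> / \<tau>"
      proof -
        have r: "rep_const N = 2 / (4 ^ M * fact M * fact k)"
          unfolding rep_const_def M_def by (simp add: k)
        have m': "\<tau> ^ m = \<tau> * \<tau> ^ k" by (simp add: k)
        have "w / kf * (x / (F * (t * w)) * J) = 2 / (F * kf) / 2 * x * J / t"
          if "w > 0" for w kf x F t :: real using that by simp
        from this[of "\<tau> ^ k"] show ?thesis unfolding b_def r m' using t0 by simp
      qed
      ultimately show ?thesis by (simp add: G_def lap_chain_def M_def k)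
    qed
    have key: "taylor_at_0 m G \<tau> + b \<rho> * ln \<tau> \<le> taylor_at_0 m G \<rho> + b \<rho> * ln \<rho>" if "\<tau> \<ge> \<rho>" for \<tau>
    proof (rule DERIV_nonpos_imp_nonincreasing[where f = "\<lambda>\<tau>. taylor_at_0 m G \<tau> + b \<rho> * ln \<tau>", OF that])
      fix x assume x: "\<rho> \<le> x"
      then have x0: "x > 0" using \<rho> by simp
      have "(taylor_at_0 m G has_real_derivative - (x ^ k / fact k * G (Suc k) x)) (at x)"
        unfolding k by (rule DERIV_taylor_at_0) (unfold G_def, rule DERIV_lap_chain[OF x0 assms u even_dim])
      moreover have "((\<lambda>\<tau>. b \<rho> * ln \<tau>) has_real_derivative b \<rho> / x) (at x)"
        using DERIV_cmult[OF DERIV_ln[OF x0], of "b \<rho>"] by (simp add: divide_inverse)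
      ultimately have "((\<lambda>\<tau>. taylor_at_0 m G \<tau> + b \<rho> * ln \<tau>) has_real_derivative
          - (x ^ k / fact k * G (Suc k) x) + b \<rho> / x) (at x)" by (rule DERIV_add)
      then show "\<exists>y. ((\<lambda>\<tau>. taylor_at_0 m G \<tau> + b \<rho> * ln \<tau>) has_real_derivative y) (at x) \<and> y \<le> 0"
        using Gm[OF x] by (intro exI[of _ "- (x ^ k / fact k * G (Suc k) x) + b \<rho> / x"]) auto
    qed
    define D where "D = taylor_at_0 m G \<rho> + b \<rho> * ln \<rho> + A"
    \<comment> \<open>A point where a rate larger than \<open>\<kappa>\<close> contradicts the lower bound for the mean of \<open>u\<close>.\<close>
    define \<tau> where "\<tau> = max \<rho> (exp ((D + 1) / (b \<rho> - \<kappa>)))"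
    have t: "\<tau> \<ge> \<rho>" "\<tau> \<ge> 1" "\<tau> > 0" using \<rho> by (auto simp: \<tau>_def)
    have "G 0 \<tau> \<le> taylor_at_0 m G \<tau>"
      by (rule taylor_at_0_ge_0th) (use Gpos t m in auto)
    then have "(b \<rho> - \<kappa>) * ln \<tau> \<le> D"
      using A[OF t(2)] key[OF t(1)] by (simp add: G_def lap_chain_def D_def algebra_simps)
    moreover have "(D + 1) / (b \<rho> - \<kappa>) \<le> ln \<tau>"
      using t(3) by (subst ln_ge_iff) (auto simp: \<tau>_def)
    then have "D + 1 \<le> (b \<rho> - \<kappa>) * ln \<tau>" using pos by (simp add: pos_divide_le_eq mult.commute)
    ultimately show False by simp
  qed
  have "(b \<longlongrightarrow> rep_const N / 2 * (1 - 0) ^ M * J) at_top"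
    unfolding b_def
    by (intro tendsto_intros tendsto_divide_0[OF tendsto_const] filterlim_at_top_imp_at_infinity filterlim_ident)
  moreover have "\<forall>\<^sub>F \<rho> in at_top. b \<rho> \<le> \<kappa>"
    using eventually_gt_at_top[of "max 1 S"] by eventually_elim (rule bk, auto)
  ultimately have "rep_const N / 2 * (1 - 0) ^ M * J \<le> \<kappa>"
    by (rule tendsto_upperbound) simp
  then show ?thesis by (simp add: J_def \<kappa>_def)
qed

end

section \<open>Truncated kernels\<close>

text \<open>Truncations to \<open>\<epsilon> \<le> \<tau> \<le> T\<close> of the kernels \<open>1 / s\<close> and \<open>1 / s\<^sup>2\<close>, where \<open>s\<close> is the squared
  distance: substituting \<open>s / \<tau>\<close> in the integrals over \<open>\<tau> > 0\<close> gives Beta integrals with these values.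
  The second is minus the derivative in \<open>s\<close> of the first.\<close>

definition q_ker :: "nat \<Rightarrow> real \<Rightarrow> real \<Rightarrow> real \<Rightarrow> real" where
  "q_ker M \<epsilon> T s = integral {\<epsilon>..T} (\<lambda>\<tau>. real M * max 0 (\<tau> - s) ^ (M - 1) / \<tau> ^ (M + 1))"

definition p_ker :: "nat \<Rightarrow> real \<Rightarrow> real \<Rightarrow> real \<Rightarrow> real" where
  "p_ker M \<epsilon> T s = integral {\<epsilon>..T} (\<lambda>\<tau>. real M * real (M - 1) * max 0 (\<tau> - s) ^ (M - 2) / \<tau> ^ (M + 1))"

lemma continuous_q_ker: "\<epsilon> > 0 \<Longrightarrow> continuous_on A (q_ker M \<epsilon> T)"
  unfolding q_ker_def[abs_def] cbox_interval[symmetric]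
  by (rule integral_continuous_on_param) (auto simp: split_beta intro!: continuous_intros)

lemma continuous_p_ker: "\<epsilon> > 0 \<Longrightarrow> continuous_on A (p_ker M \<epsilon> T)"
  unfolding p_ker_def[abs_def] cbox_interval[symmetric]
  by (rule integral_continuous_on_param) (auto simp: split_beta intro!: continuous_intros)

lemma q_integrable: "\<epsilon> > 0 \<Longrightarrow> (\<lambda>\<tau>. real M * max 0 (\<tau> - s) ^ (M - 1) / \<tau> ^ (M + 1)) integrable_on {\<epsilon>..T}"
  by (rule integrable_continuous_real) (auto intro!: continuous_intros)

lemma p_integrable: "\<epsilon> > 0 \<Longrightarrow> (\<lambda>\<tau>. real M * real (M - 1) * max 0 (\<tau> - s) ^ (M - 2) / \<tau> ^ (M + 1)) integrable_on {\<epsilon>..T}"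
  by (rule integrable_continuous_real) (auto intro!: continuous_intros)

lemma q_ker_nonneg: "\<epsilon> > 0 \<Longrightarrow> q_ker M \<epsilon> T s \<ge> 0"
  unfolding q_ker_def by (rule integral_nonneg[OF q_integrable]) auto

text \<open>The integrand times \<open>s\<close> is the derivative of \<open>(1 - s / \<tau>)\<^sub>+\<^sup>M\<close> in \<open>\<tau>\<close>.\<close>

lemma q_ker_le:
  assumes "0 < \<epsilon>" "\<epsilon> \<le> T" "M \<ge> 2" "s \<ge> 0"
  shows "s * q_ker M \<epsilon> T s \<le> 1"
proof -
  obtain K where K: "M = Suc K" "K \<ge> 1" using assms(3) by (cases M) auto
  have "((\<lambda>\<tau>. s * (real M * max 0 (\<tau> - s) ^ (M - 1) / \<tau> ^ (M + 1))) has_integral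
      max 0 (T - s) ^ M / T ^ M - max 0 (\<epsilon> - s) ^ M / \<epsilon> ^ M) {\<epsilon>..T}"
  proof (rule fundamental_theorem_of_calculus[OF assms(2)])
    fix \<tau> assume "\<tau> \<in> {\<epsilon>..T}"
    then have t: "\<tau> > 0" using assms(1) by simp
    define P where "P = max 0 (\<tau> - s)"
    have "((\<lambda>\<tau>. max 0 (\<tau> - s) ^ M / \<tau> ^ M) has_real_derivative
        (real M * P ^ K * \<tau> ^ M - P ^ M * (real M * \<tau> ^ K)) / (\<tau> ^ M * \<tau> ^ M)) (at \<tau> within {\<epsilon>..T})"
      unfolding P_def K(1)
      apply (intro DERIV_divide)
      subgoal
        by (rule has_field_derivative_at_within, intro DERIV_chain2[OF DERIV_max_0_power[OF K(2)], THEN DERIV_cong])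
          (auto intro!: derivative_eq_intros)
      subgoal using DERIV_pow[of "Suc K" \<tau>] by simp
      subgoal using t by simp
      done
    also have "(real M * P ^ K * \<tau> ^ M - P ^ M * (real M * \<tau> ^ K)) / (\<tau> ^ M * \<tau> ^ M)
        = s * (real M * P ^ (M - 1) / \<tau> ^ (M + 1))"
    proof -
      have sP: "s * P ^ K = \<tau> * P ^ K - P * P ^ K"
        using K(2) by (cases "\<tau> \<le> s") (auto simp: P_def algebra_simps)
      have "(r * p * (t * w) - (P' * p) * (r * w)) / (t * w * (t * w)) = r * (t * p - P' * p) / (t * (t * w))"
        if "t > 0" "w > 0" for r p t w P' :: real using that by (simp add: field_simps)
      note alg = this[OF t, of "\<tau> ^ K" "real M" "P ^ K" P]
      have pw: "\<tau> ^ M = \<tau> * \<tau> ^ K" "P ^ M = P * P ^ K" "P ^ (M - 1) = P ^ K" "\<tau> ^ (M + 1) = \<tau> * (\<tau> * \<tau> ^ K)"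
        by (simp_all add: K(1))
      have "\<tau> ^ K > 0" using t by simp
      from alg[OF this] show ?thesis unfolding pw sP[symmetric] by (simp only: times_divide_eq_right mult_ac)
    qed
    finally show "((\<lambda>\<tau>. max 0 (\<tau> - s) ^ M / \<tau> ^ M) has_vector_derivative
        s * (real M * max 0 (\<tau> - s) ^ (M - 1) / \<tau> ^ (M + 1))) (at \<tau> within {\<epsilon>..T})"
      by (simp add: has_real_derivative_iff_has_vector_derivative P_def)
  qed
  then have "s * q_ker M \<epsilon> T s = max 0 (T - s) ^ M / T ^ M - max 0 (\<epsilon> - s) ^ M / \<epsilon> ^ M"
    unfolding q_ker_def integral_mult_right[symmetric] by (rule integral_unique)
  also have "\<dots> \<le> max 0 (T - s) ^ M / T ^ M" using assms by simp
  also have "\<dots> \<le> 1" using assms by (simp add: power_mono)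
  finally show ?thesis .
qed

text \<open>The difference of the integrands is the derivative in \<open>\<tau>\<close> of
  \<open>M / \<tau>\<close> times \<open>(1 - s / \<tau>)\<^sub>+\<close> to the power \<open>M - 1\<close>; the error \<open>M / T\<close> bounds its value at the
  outer cutoff.\<close>

lemma p_ker_le:
  assumes "0 < \<epsilon>" "\<epsilon> \<le> T" "M \<ge> 3" "s \<ge> 0"
  shows "s * p_ker M \<epsilon> T s \<le> q_ker M \<epsilon> T s + real M / T"
proof -
  obtain K where K: "M = Suc (Suc K)" "K \<ge> 1" using assms(3) by (metis Suc_le_D Suc_le_mono numeral_3_eq_3 One_nat_def)
  have "((\<lambda>\<tau>. s * (real M * real (M - 1) * max 0 (\<tau> - s) ^ (M - 2) / \<tau> ^ (M + 1))
        - real M * max 0 (\<tau> - s) ^ (M - 1) / \<tau> ^ (M + 1)) has_integral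
      real M * max 0 (T - s) ^ (M - 1) / T ^ M - real M * max 0 (\<epsilon> - s) ^ (M - 1) / \<epsilon> ^ M) {\<epsilon>..T}"
  proof (rule fundamental_theorem_of_calculus[OF assms(2)])
    fix \<tau> assume "\<tau> \<in> {\<epsilon>..T}"
    then have t: "\<tau> > 0" using assms(1) by simp
    define P where "P = max 0 (\<tau> - s)"
    have "((\<lambda>\<tau>. real M * max 0 (\<tau> - s) ^ Suc K / \<tau> ^ M) has_real_derivative
        (real M * (real (Suc K) * P ^ K) * \<tau> ^ M - real M * P ^ Suc K * (real M * \<tau> ^ Suc K)) / (\<tau> ^ M * \<tau> ^ M)) (at \<tau> within {\<epsilon>..T})"
      unfolding P_def K(1)
      apply (intro DERIV_divide DERIV_cmult)
      subgoal
        by (rule has_field_derivative_at_within, intro DERIV_chain2[OF DERIV_max_0_power[OF K(2)], THEN DERIV_cong])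
          (auto intro!: derivative_eq_intros)
      subgoal using DERIV_pow[of "Suc (Suc K)" \<tau>] by (simp del: power_Suc)
      subgoal using t by simp
      done
    also have "(real M * (real (Suc K) * P ^ K) * \<tau> ^ M - real M * P ^ Suc K * (real M * \<tau> ^ Suc K)) / (\<tau> ^ M * \<tau> ^ M)
        = s * (real M * real (M - 1) * P ^ (M - 2) / \<tau> ^ (M + 1)) - real M * P ^ (M - 1) / \<tau> ^ (M + 1)"
    proof -
      have sP: "s * P ^ K = \<tau> * P ^ K - P * P ^ K"
        using K(2) by (cases "\<tau> \<le> s") (auto simp: P_def algebra_simps)
      have "(r * (r1 * p) * (t * w) - r * (P' * p) * ((r1 + 1) * w)) / (t * w * (t * w))
          = r * r1 * (t * p - P' * p) / (t * (t * w)) - r * (P' * p) / (t * (t * w))"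
        if "t > 0" "w > 0" for r r1 p t w P' :: real using that by (simp add: field_simps)
      note alg = this[OF t, of "\<tau> ^ Suc K" "real M" "real (Suc K)" "P ^ K" P]
      have pw: "\<tau> ^ M = \<tau> * \<tau> ^ Suc K" "P ^ Suc K = P * P ^ K" "P ^ (M - 2) = P ^ K" "P ^ (M - 1) = P * P ^ K"
        "\<tau> ^ (M + 1) = \<tau> * (\<tau> * \<tau> ^ Suc K)" "real (M - 1) = real (Suc K)"
        by (simp_all add: K(1))
      have rM: "real (Suc K) + 1 = real M" by (simp add: K(1))
      have "\<tau> ^ Suc K > 0" using t by simp
      from alg[OF this] show ?thesis unfolding pw rM sP[symmetric] by (simp only: times_divide_eq_right mult_ac)
    qed
    finally show "((\<lambda>\<tau>. real M * max 0 (\<tau> - s) ^ (M - 1) / \<tau> ^ M) has_vector_derivative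
        s * (real M * real (M - 1) * max 0 (\<tau> - s) ^ (M - 2) / \<tau> ^ (M + 1))
        - real M * max 0 (\<tau> - s) ^ (M - 1) / \<tau> ^ (M + 1)) (at \<tau> within {\<epsilon>..T})"
      by (simp add: has_real_derivative_iff_has_vector_derivative P_def K(1))
  qed
  moreover have "((\<lambda>\<tau>. s * (real M * real (M - 1) * max 0 (\<tau> - s) ^ (M - 2) / \<tau> ^ (M + 1))
        - real M * max 0 (\<tau> - s) ^ (M - 1) / \<tau> ^ (M + 1)) has_integral (s * p_ker M \<epsilon> T s - q_ker M \<epsilon> T s)) {\<epsilon>..T}"
    unfolding p_ker_def q_ker_def
    by (intro has_integral_diff has_integral_mult_right integrable_integral p_integrable q_integrable assms)
  ultimately have "s * p_ker M \<epsilon> T s - q_ker M \<epsilon> T s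
      = real M * max 0 (T - s) ^ (M - 1) / T ^ M - real M * max 0 (\<epsilon> - s) ^ (M - 1) / \<epsilon> ^ M"
    by (rule has_integral_unique[symmetric])
  also have "\<dots> \<le> real M * max 0 (T - s) ^ (M - 1) / T ^ M" using assms by simp
  also have "\<dots> \<le> real M * T ^ (M - 1) / T ^ M"
    using assms by (intro divide_right_mono mult_left_mono power_mono) auto
  also have "\<dots> = real M / T" using assms by (simp add: K(1))
  finally show ?thesis by simp
qed

lemma swap_weighted_integral:
  fixes h :: "real ^ 'n::finite \<Rightarrow> real" and g :: "real \<Rightarrow> real ^ 'n \<Rightarrow> real"
  assumes "continuous_on UNIV h" "continuous_on ({\<epsilon>..T} \<times> cbox a b) (\<lambda>p. g (fst p) (snd p))"
  shows "integral {\<epsilon>..T} (\<lambda>\<tau>. integral (cbox a b) (\<lambda>z. h z * g \<tau> z))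
       = integral (cbox a b) (\<lambda>z. h z * integral {\<epsilon>..T} (\<lambda>\<tau>. g \<tau> z))"
proof -
  have "continuous_on (cbox (\<epsilon>, a) (T, b)) (\<lambda>(\<tau>, z). h z * g \<tau> z)"
    unfolding cbox_Pair_eq box_real split_beta
    by (intro continuous_intros assms continuous_on_compose2[OF assms(1)]) auto
  from integral_swap_continuous[OF this] show ?thesis
    by (simp add: box_real)
qed

context nonneg_curvatures begin

lemma taylor_at_0_difference:
  fixes v :: "real ^ 'n \<Rightarrow> real"
  assumes v: "C_inf v" and "0 < \<epsilon>" "\<epsilon> \<le> T" "N \<ge> 2"
  shows "taylor_at_0 m (lap_chain N v) \<epsilon> - taylor_at_0 m (lap_chain N v) T
    = integral {\<epsilon>..T} (\<lambda>\<tau>. \<tau> ^ (m - 1) / fact (m - 1) * ker_avg (N + m) \<tau> (nlap m v))"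
proof -
  obtain k where k: "m = Suc k" using m by (cases m) auto
  have "((\<lambda>\<tau>. - (\<tau> ^ k / fact k * lap_chain N v (Suc k) \<tau>)) has_integral
      taylor_at_0 (Suc k) (lap_chain N v) T - taylor_at_0 (Suc k) (lap_chain N v) \<epsilon>) {\<epsilon>..T}"
  proof (rule fundamental_theorem_of_calculus[OF assms(3)])
    fix \<tau> assume "\<tau> \<in> {\<epsilon>..T}"
    then have t: "\<tau> > 0" using assms(2) by simp
    have "(taylor_at_0 (Suc k) (lap_chain N v) has_real_derivative - (\<tau> ^ k / fact k * lap_chain N v (Suc k) \<tau>)) (at \<tau>)"
      by (rule DERIV_taylor_at_0) (rule DERIV_lap_chain[OF t assms(4) v even_dim])
    then show "(taylor_at_0 (Suc k) (lap_chain N v) has_vector_derivative - (\<tau> ^ k / fact k * lap_chain N v (Suc k) \<tau>)) (at \<tau> within {\<epsilon>..T})"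
      by (auto simp: has_real_derivative_iff_has_vector_derivative intro: has_vector_derivative_at_within)
  qed
  from has_integral_neg[OF this] have "((\<lambda>\<tau>. \<tau> ^ k / fact k * lap_chain N v (Suc k) \<tau>) has_integral
      taylor_at_0 (Suc k) (lap_chain N v) \<epsilon> - taylor_at_0 (Suc k) (lap_chain N v) T) {\<epsilon>..T}" by simp
  from integral_unique[OF this] show ?thesis by (simp add: k lap_chain_def)
qed

lemma integral_UNIV_eq_cube:
  fixes g :: "real ^ 'n \<Rightarrow> real"
  assumes "\<tau> \<le> T" "\<And>z. \<tau> \<le> z \<bullet> z \<Longrightarrow> g z = 0" "0 < \<tau>"
  shows "integral UNIV g = integral (cube (sqrt T)) g"
proof (rule integral_UNIV_superset, rule assms(2))
  fix z :: "real ^ 'n" assume "z \<notin> cube (sqrt T)"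
  then have "sqrt T < norm z" using norm_le_cube[of z "sqrt T"] by force
  then have "(sqrt T)\<^sup>2 \<le> (norm z)\<^sup>2" using assms by (intro power_mono) auto
  then show "\<tau> \<le> z \<bullet> z" using assms by (simp add: dot_square_norm)
qed

text \<open>Integrating by parts puts the derivative on the kernel, and the double integral over
  \<open>\<tau>\<close> and \<open>z\<close>, taken in the other order, collects the \<open>\<tau>\<close>-integral into \<open>q_ker\<close>.\<close>

lemma gradient_representation:
  assumes "0 < \<epsilon>" "\<epsilon> \<le> T" "N \<ge> 2"
  shows "taylor_at_0 m (lap_chain N (pd i u)) \<epsilon> - taylor_at_0 m (lap_chain N (pd i u)) T
    = rep_const N * integral (cube (sqrt T)) (\<lambda>z. nlap m u z * (z $ i * q_ker (N + m) \<epsilon> T (z \<bullet> z)))"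
proof -
  obtain k where k: "m = Suc k" using m by (cases m) auto
  define f where "f = nlap m u"
  have f: "C_inf f" unfolding f_def by (rule C_inf_neg_laplacian_power[OF u])
  define K where "K = N + k"
  have M: "N + m = Suc K" "K \<ge> 1" using assms by (auto simp: K_def k)
  have cd: "CARD('n) div 2 = Suc k" using dim k by simp
  define g where "g \<tau> z = real (Suc K) * max 0 (\<tau> - z \<bullet> z) ^ K / \<tau> ^ (K + 2)" for \<tau> and z :: "real ^ 'n"
  have "taylor_at_0 m (lap_chain N (pd i u)) \<epsilon> - taylor_at_0 m (lap_chain N (pd i u)) T
     = integral {\<epsilon>..T} (\<lambda>\<tau>. \<tau> ^ k / fact k * ker_avg (Suc K) \<tau> (pd i f))"
    using taylor_at_0_difference[OF C_inf_pd[OF u] assms, of i]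
    unfolding nlap_pd[OF u even_dim] f_def[symmetric] M(1) by (simp add: k)
  also have "\<dots> = integral {\<epsilon>..T} (\<lambda>\<tau>. integral (cube (sqrt T)) (\<lambda>z. (rep_const N * (f z * z $ i)) * g \<tau> z))"
  proof (rule integral_cong)
    fix \<tau> assume "\<tau> \<in> {\<epsilon>..T}"
    then have t: "\<tau> > 0" "\<tau> \<le> T" using assms by auto
    have "\<tau> ^ k / fact k * ker_avg (Suc K) \<tau> (pd i f)
       = integral UNIV (\<lambda>z. \<tau> ^ k / fact k * (z $ i / (2 * \<tau>) * ker K \<tau> z * f z))"
      unfolding ker_avg_pd[OF t(1) M(2) f] by (rule integral_mult_right[symmetric])
    also have "\<dots> = integral UNIV (\<lambda>z. (rep_const N * (f z * z $ i)) * g \<tau> z)"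
    proof (rule integral_cong)
      fix z :: "real ^ 'n"
      define P where "P = max 0 (\<tau> - z \<bullet> z) ^ K"
      have *: "ker K \<tau> z = P / (4 ^ K * fact K * (\<tau> ^ K * (\<tau> * \<tau> ^ k)))"
        by (simp add: ker_def cd P_def power_add)
      have r: "rep_const N = 2 / (4 * 4 ^ K * (real (Suc K) * fact K) * fact k)"
        unfolding rep_const_def M(1) by (simp add: k)
      have alg: "w / kf * (zi / (2 * t) * (P' / (fK * (v * (t * w)))) * fz)
          = 2 / (4 * F * (sK * Kf) * kf) * (fz * zi) * (sK * P' / (v * (t * t)))"
        if "w > 0" "kf > 0" "t > 0" "v > 0" "F > 0" "Kf > 0" "sK > 0" "fK = F * Kf" for w kf zi t P' fK v fz F sK Kf :: real
        using that by (simp add: field_simps)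
      show "\<tau> ^ k / fact k * (z $ i / (2 * \<tau>) * ker K \<tau> z * f z) = (rep_const N * (f z * z $ i)) * g \<tau> z"
        unfolding * r g_def P_def[symmetric] power_add power2_eq_square
        by (rule alg) (use t in auto)
    qed
    also have "\<dots> = integral (cube (sqrt T)) (\<lambda>z. (rep_const N * (f z * z $ i)) * g \<tau> z)"
      by (rule integral_UNIV_eq_cube[OF t(2) _ t(1)]) (use M(2) in \<open>simp add: g_def\<close>)
    finally show "\<tau> ^ k / fact k * ker_avg (Suc K) \<tau> (pd i f) = integral (cube (sqrt T)) (\<lambda>z. (rep_const N * (f z * z $ i)) * g \<tau> z)" .
  qed
  also have "\<dots> = integral (cube (sqrt T)) (\<lambda>z. (rep_const N * (f z * z $ i)) * integral {\<epsilon>..T} (\<lambda>\<tau>. g \<tau> z))"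
    by (rule swap_weighted_integral)
      (use assms in \<open>auto simp: g_def intro!: continuous_intros C_inf_continuous[OF f]\<close>)
  also have "\<dots> = integral (cube (sqrt T)) (\<lambda>z. rep_const N * (f z * (z $ i * q_ker (N + m) \<epsilon> T (z \<bullet> z))))"
    by (rule integral_cong) (simp add: q_ker_def g_def M(1) mult_ac)
  finally show ?thesis by (simp add: f_def)
qed

lemma hessian_representation:
  assumes "0 < \<epsilon>" "\<epsilon> \<le> T" "N \<ge> 2"
  shows "taylor_at_0 m (lap_chain N (pd i (pd j u))) \<epsilon> - taylor_at_0 m (lap_chain N (pd i (pd j u))) T
    = rep_const N * integral (cube (sqrt T)) (\<lambda>z. nlap m u z *
       (2 * (z $ i * z $ j) * p_ker (N + m) \<epsilon> T (z \<bullet> z) - (if i = j then q_ker (N + m) \<epsilon> T (z \<bullet> z) else 0)))"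
proof -
  obtain k where k: "m = Suc k" using m by (cases m) auto
  define f where "f = nlap m u"
  have f: "C_inf f" unfolding f_def by (rule C_inf_neg_laplacian_power[OF u])
  have cf: "continuous_on A f" for A by (rule C_inf_continuous[OF f])
  obtain N' where N': "N = Suc N'" "N' \<ge> 1" using assms(3) by (cases N) auto
  define K where "K = N' + k"
  have M: "N + m = K + 2" "K \<ge> 1" using N' by (auto simp: K_def k)
  have cd: "CARD('n) div 2 = Suc k" using dim k by simp
  define d where "d = (if i = j then 1 else 0 :: real)"
  define g1 where "g1 \<tau> z = real (K + 2) * max 0 (\<tau> - z \<bullet> z) ^ (K + 1) / \<tau> ^ (K + 3)" for \<tau> and z :: "real ^ 'n"
  define g2 where "g2 \<tau> z = real (K + 2) * real (K + 1) * max 0 (\<tau> - z \<bullet> z) ^ K / \<tau> ^ (K + 3)" for \<tau> and z :: "real ^ 'n"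
  define h where "h \<tau> z = 2 * (z $ i * z $ j) * g2 \<tau> z - d * g1 \<tau> z" for \<tau> z
  have "taylor_at_0 m (lap_chain N (pd i (pd j u))) \<epsilon> - taylor_at_0 m (lap_chain N (pd i (pd j u))) T
     = integral {\<epsilon>..T} (\<lambda>\<tau>. \<tau> ^ k / fact k * ker_avg (K + 2) \<tau> (pd i (pd j f)))"
    using taylor_at_0_difference[OF C_inf_pd[OF C_inf_pd[OF u]] assms, of i j]
    unfolding nlap_pd[OF C_inf_pd[OF u] even_dim] nlap_pd[OF u even_dim] f_def[symmetric] M(1) by (simp add: k)
  also have "\<dots> = integral {\<epsilon>..T} (\<lambda>\<tau>. integral (cube (sqrt T)) (\<lambda>z. (rep_const N * f z) * h \<tau> z))"
  proof (rule integral_cong)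
    fix \<tau> assume "\<tau> \<in> {\<epsilon>..T}"
    then have t: "\<tau> > 0" "\<tau> \<le> T" using assms by auto
    have "\<tau> ^ k / fact k * ker_avg (K + 2) \<tau> (pd i (pd j f))
       = integral UNIV (\<lambda>z. \<tau> ^ k / fact k * ((z $ i * z $ j / (4 * \<tau>\<^sup>2) * ker K \<tau> z
          - (if i = j then 1 / (2 * \<tau>) else 0) * ker (Suc K) \<tau> z) * f z))"
      unfolding ker_avg_pd_pd[OF t(1) M(2) f] by (rule integral_mult_right[symmetric])
    also have "\<dots> = integral UNIV (\<lambda>z. (rep_const N * f z) * h \<tau> z)"
    proof (rule integral_cong)
      fix z :: "real ^ 'n"
      define P where "P = max 0 (\<tau> - z \<bullet> z)"
      have 1: "ker K \<tau> z = P ^ K / (4 ^ K * fact K * (\<tau> ^ K * (\<tau> * \<tau> ^ k)))"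
        by (simp add: ker_def cd P_def power_add)
      have 2: "ker (Suc K) \<tau> z = P * P ^ K / (4 * 4 ^ K * (real (K + 1) * fact K) * (\<tau> * \<tau> ^ K * (\<tau> * \<tau> ^ k)))"
        by (simp add: ker_def cd P_def power_add algebra_simps)
      have r: "rep_const N = 2 / (16 * 4 ^ K * (real (K + 2) * (real (K + 1) * fact K)) * fact k)"
        unfolding rep_const_def M(1) by (simp add: k algebra_simps)
      have 3: "g1 \<tau> z = real (K + 2) * (P * P ^ K) / (\<tau> ^ K * (\<tau> * \<tau> * \<tau>))"
        "g2 \<tau> z = real (K + 2) * real (K + 1) * P ^ K / (\<tau> ^ K * (\<tau> * \<tau> * \<tau>))"
        by (simp_all add: g1_def g2_def P_def power_add power3_eq_cube)
      have alg: "w / kf * ((zz / (4 * (t * t)) * (p / (F * Kf * (v * (t * w))))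
            - d / (2 * t) * (P' * p / (4 * F * (k1 * Kf) * (t * v * (t * w))))) * fz)
          = (2 / (16 * F * (k2 * (k1 * Kf)) * kf) * fz) * (2 * zz * (k2 * k1 * p / (v * (t * t * t))) - d * (k2 * (P' * p) / (v * (t * t * t))))"
        if pos: "w > 0" "kf > 0" "t > 0" "v > 0" "F > 0" "Kf > 0" "k1 > 0" "k2 > 0" for w kf zz t p P' v fz F k1 k2 Kf d :: real
      proof -
        have a: "w / kf * (zz / (4 * (t * t)) * (p / (F * Kf * (v * (t * w)))) * fz) =
            (2 / (16 * F * (k2 * (k1 * Kf)) * kf) * fz) * (2 * zz * (k2 * k1 * p / (v * (t * t * t))))"
          using pos by (simp add: mult_ac)
        have b: "w / kf * (d / (2 * t) * (P' * p / (4 * F * (k1 * Kf) * (t * v * (t * w)))) * fz) =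
            (2 / (16 * F * (k2 * (k1 * Kf)) * kf) * fz) * (d * (k2 * (P' * p) / (v * (t * t * t))))"
          using pos by (simp add: mult_ac)
        show ?thesis unfolding left_diff_distrib right_diff_distrib a b ..
      qed
      have 4: "(if i = j then 1 / (2 * \<tau>) else 0) = d / (2 * \<tau>)" by (simp add: d_def)
      show "\<tau> ^ k / fact k * ((z $ i * z $ j / (4 * \<tau>\<^sup>2) * ker K \<tau> z
          - (if i = j then 1 / (2 * \<tau>) else 0) * ker (Suc K) \<tau> z) * f z) = (rep_const N * f z) * h \<tau> z"
        unfolding 1 2 3 4 h_def r power2_eq_square by (rule alg) (use t in auto)
    qed
    also have "\<dots> = integral (cube (sqrt T)) (\<lambda>z. (rep_const N * f z) * h \<tau> z)"
      by (rule integral_UNIV_eq_cube[OF t(2) _ t(1)]) (use M(2) in \<open>simp add: h_def g1_def g2_def\<close>)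
    finally show "\<tau> ^ k / fact k * ker_avg (K + 2) \<tau> (pd i (pd j f)) = integral (cube (sqrt T)) (\<lambda>z. (rep_const N * f z) * h \<tau> z)" .
  qed
  also have "\<dots> = integral (cube (sqrt T)) (\<lambda>z. (rep_const N * f z) * integral {\<epsilon>..T} (\<lambda>\<tau>. h \<tau> z))"
    by (rule swap_weighted_integral)
      (use assms in \<open>auto simp: h_def g1_def g2_def intro!: continuous_intros cf\<close>)
  also have "\<dots> = integral (cube (sqrt T)) (\<lambda>z. rep_const N * (f z *
      (2 * (z $ i * z $ j) * p_ker (N + m) \<epsilon> T (z \<bullet> z) - (if i = j then q_ker (N + m) \<epsilon> T (z \<bullet> z) else 0))))"
  proof (rule integral_cong)
    fix z :: "real ^ 'n"
    have "integral {\<epsilon>..T} (\<lambda>\<tau>. h \<tau> z) = 2 * (z $ i * z $ j) * p_ker (K + 2) \<epsilon> T (z \<bullet> z) - d * q_ker (K + 2) \<epsilon> T (z \<bullet> z)"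
    proof (rule integral_unique)
      have e: "K + 2 - 2 = K" "K + 2 - 1 = K + 1" "K + 2 + 1 = K + 3" by auto
      show "((\<lambda>\<tau>. h \<tau> z) has_integral 2 * (z $ i * z $ j) * p_ker (K + 2) \<epsilon> T (z \<bullet> z) - d * q_ker (K + 2) \<epsilon> T (z \<bullet> z)) {\<epsilon>..T}"
        unfolding h_def
        by (intro has_integral_diff has_integral_mult_right)
          (use integrable_integral[OF p_integrable[OF assms(1), of "K + 2" "z \<bullet> z" T]]
            integrable_integral[OF q_integrable[OF assms(1), of "K + 2" "z \<bullet> z" T]]
           in \<open>simp_all only: p_ker_def q_ker_def g1_def g2_def e\<close>)
    qed
    then show "rep_const N * f z * integral {\<epsilon>..T} (\<lambda>\<tau>. h \<tau> z) = rep_const N * (f z *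
      (2 * (z $ i * z $ j) * p_ker (N + m) \<epsilon> T (z \<bullet> z) - (if i = j then q_ker (N + m) \<epsilon> T (z \<bullet> z) else 0)))"
      by (simp add: M(1) d_def)
  qed
  finally show ?thesis by (simp add: f_def)
qed

end

section \<open>Ricci curvature\<close>

text \<open>The pointwise content of the identity for the Ricci tensor, with \<open>s = |z|\<^sup>2\<close> and
  \<open>a = (z \<bullet> v)\<^sup>2\<close>. For the untruncated kernels \<open>q = 1 / s\<close>, \<open>p = 1 / s\<^sup>2\<close> and \<open>\<delta> = 0\<close> the left-hand
  side vanishes.\<close>

lemma kernel_inequality:
  fixes q p s a \<delta> n :: real
  assumes "0 \<le> q" "s * q \<le> 1" "s * p \<le> q + \<delta>" "0 \<le> a" "a \<le> s" "0 \<le> \<delta>" "n \<ge> 2"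
  shows "(n - 2) * (q - 2 * a * p) + (n * q - 2 * s * p) - 2 * (n - 2) * ((s - a) * q\<^sup>2) \<ge> - (2 * (n - 1) * \<delta>)"
proof (cases "s = 0")
  case True
  then have "a = 0" using assms by simp
  have "0 \<le> (n - 2) * q + n * q" "0 \<le> 2 * (n - 1) * \<delta>"
    using assms by (auto intro!: add_nonneg_nonneg mult_nonneg_nonneg)
  then show ?thesis using True \<open>a = 0\<close> by simp
next
  case False
  define t where "t = a / s"
  have t: "0 \<le> t" "t \<le> 1" "a = t * s" using assms False by (auto simp: t_def)
  have 1: "a * p \<le> t * (q + \<delta>)"
    using mult_left_mono[OF assms(3) t(1)] by (simp add: t(3) mult.assoc)
  have 2: "(s - a) * q\<^sup>2 \<le> (1 - t) * q"
  proof -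
    have "(s - a) * q\<^sup>2 = (1 - t) * q * (s * q)" by (simp add: t(3) power2_eq_square algebra_simps)
    also have "\<dots> \<le> (1 - t) * q * 1" using t assms by (intro mult_left_mono) auto
    finally show ?thesis by simp
  qed
  have 3: "(n - 2) * (a * p) \<le> (n - 2) * (t * (q + \<delta>))" using 1 assms(7) by (intro mult_left_mono) auto
  have 4: "(n - 2) * ((s - a) * q\<^sup>2) \<le> (n - 2) * ((1 - t) * q)" using 2 assms(7) by (intro mult_left_mono) auto
  have 5: "(n - 2) * (t * \<delta>) \<le> (n - 2) * \<delta>" using t assms by (intro mult_left_mono mult_left_le_one_le) auto
  have "(n - 2) * (q - 2 * a * p) + (n * q - 2 * s * p) - 2 * (n - 2) * ((s - a) * q\<^sup>2)
      = (2 * n - 2) * q - 2 * ((n - 2) * (a * p)) - 2 * (s * p) - 2 * ((n - 2) * ((s - a) * q\<^sup>2))"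
    by (simp add: algebra_simps)
  also have "\<dots> \<ge> (2 * n - 2) * q - 2 * ((n - 2) * (t * (q + \<delta>))) - 2 * (q + \<delta>) - 2 * ((n - 2) * ((1 - t) * q))"
    by (intro diff_mono mult_left_mono 3 4 assms(3) order.refl) auto
  also have "(2 * n - 2) * q - 2 * ((n - 2) * (t * (q + \<delta>))) - 2 * (q + \<delta>) - 2 * ((n - 2) * ((1 - t) * q))
      = - (2 * ((n - 2) * (t * \<delta>)) + 2 * \<delta>)"
    by (simp add: algebra_simps)
  also have "\<dots> \<ge> - (2 * (n - 1) * \<delta>)" using 5 by (simp add: algebra_simps)
  finally show ?thesis by simp
qed

context nonneg_curvatures begin

text \<open>Here \<open>X / \<kappa>\<close> and \<open>Y / \<kappa>\<close> approximate the gradient and the Hessian of \<open>u\<close> at the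
  origin, and the left-hand side is \<open>\<kappa>\<^sup>2\<close> times the corresponding approximation of the Ricci
  form. The terms linear in the Hessian are integrals against \<open>f\<close>; the quadratic term in the
  part of the gradient orthogonal to \<open>v\<close> is brought to the same form by Cauchy-Schwarz and
  \<open>mass_bound\<close>, after which \<open>kernel_inequality\<close> applies under the integral.\<close>

lemma truncated_ricci_bound:
  fixes v :: "real ^ 'n"
  assumes \<epsilon>: "0 < \<epsilon>" "\<epsilon> \<le> T" and N: "N \<ge> 2" and v: "v \<bullet> v = 1"
  defines "X \<equiv> \<lambda>i. taylor_at_0 m (lap_chain N (pd i u)) \<epsilon> - taylor_at_0 m (lap_chain N (pd i u)) T"
    and "Y \<equiv> \<lambda>i j. taylor_at_0 m (lap_chain N (pd i (pd j u))) \<epsilon> - taylor_at_0 m (lap_chain N (pd i (pd j u))) T"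
    and "\<kappa> \<equiv> ker_mass TYPE('n) N" and "n \<equiv> real CARD('n)"
  shows "(n - 2) * ((\<Sum>i\<in>UNIV. v $ i * X i)\<^sup>2 - \<kappa> * (\<Sum>i\<in>UNIV. \<Sum>j\<in>UNIV. v $ i * v $ j * Y i j))
      - \<kappa> * (\<Sum>i\<in>UNIV. Y i i) - (n - 2) * (\<Sum>i\<in>UNIV. (X i)\<^sup>2) \<ge> - (4 * (n - 1) * \<kappa>\<^sup>2 * (real (N + m) / T))"
proof -
  define f where "f = nlap m u"
  define c where "c = rep_const N"
  define B :: "(real ^ 'n) set" where "B = cube (sqrt T)"
  define q where "q z = q_ker (N + m) \<epsilon> T (z \<bullet> z)" for z :: "real ^ 'n"
  define p where "p z = p_ker (N + m) \<epsilon> T (z \<bullet> z)" for z :: "real ^ 'n"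
  define I where "I g = c * integral B (\<lambda>z. f z * g z)" for g
  define \<delta> where "\<delta> = real (N + m) / T"
  have n: "n \<ge> 2" using dim m by (simp add: n_def)
  have T: "T > 0" using \<epsilon> by simp
  have \<delta>: "\<delta> \<ge> 0" using T by (simp add: \<delta>_def)
  have \<kappa>: "\<kappa> > 0" unfolding \<kappa>_def by (rule ker_mass_pos) (use N in simp)
  have c: "c > 0" by (simp add: c_def rep_const_def)
  have f: "f z \<ge> 0" for z unfolding f_def by (rule Q)
  have cf: "continuous_on A f" for A unfolding f_def by (rule cont_nlap)
  have cq [continuous_intros]: "continuous_on A q" for A unfolding q_def
    by (rule continuous_on_compose2[OF continuous_q_ker[OF \<epsilon>(1), of UNIV]]) (auto intro!: continuous_intros)
  have cp [continuous_intros]: "continuous_on A p" for A unfolding p_def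
    by (rule continuous_on_compose2[OF continuous_p_ker[OF \<epsilon>(1), of UNIV]]) (auto intro!: continuous_intros)
  have int: "(\<lambda>z. f z * g z) integrable_on B" if "continuous_on B g" for g
    unfolding B_def by (rule integrable_continuous) (use that in \<open>auto simp: B_def intro!: continuous_intros cf\<close>)
  have I_mono: "I g \<le> I h" if "continuous_on B g" "continuous_on B h" "\<And>z. g z \<le> h z" for g h
    unfolding I_def using c
    by (intro mult_left_mono integral_le int that f) auto
  have I_add: "I (\<lambda>z. g z + h z) = I g + I h" if "continuous_on B g" "continuous_on B h" for g h
    unfolding I_def distrib_left using integral_add[OF int[OF that(1)] int[OF that(2)]] by (simp add: distrib_left)
  have I_cmult: "I (\<lambda>z. r * g z) = r * I g" for r g
    unfolding I_def mult.left_commute[of _ r] by (simp add: mult.left_commute)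
  have I_sum: "I (\<lambda>z. \<Sum>i\<in>A. g i z) = (\<Sum>i\<in>A. I (g i))" if "\<And>i. i \<in> A \<Longrightarrow> continuous_on B (g i)" "finite A"
    for g and A :: "'n set"
    unfolding I_def sum_distrib_left by (subst integral_sum) (auto intro: int that simp: sum_distrib_left)
  have I_1: "I (\<lambda>z. 1) \<le> 2 * \<kappa>"
    using mass_bound[OF N, of "sqrt T"] by (simp add: I_def c_def B_def f_def \<kappa>_def)
  have X: "X i = I (\<lambda>z. z $ i * q z)" for i
    unfolding X_def gradient_representation[OF \<epsilon> N] by (simp add: I_def c_def B_def f_def q_def)
  have Y: "Y i j = I (\<lambda>z. 2 * (z $ i * z $ j) * p z - (if i = j then 1 else 0) * q z)" for i j
  proof -
    have "(if i = j then q z else 0) = (if i = j then 1 else 0) * q z" for z by simp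
    then show ?thesis
      unfolding Y_def hessian_representation[OF \<epsilon> N] by (simp only: I_def c_def B_def f_def q_def p_def)
  qed
  have vv: "(\<Sum>i\<in>UNIV. v $ i * v $ i) = 1" using v by (simp add: inner_vec_def)
  have YV: "(\<Sum>i\<in>UNIV. \<Sum>j\<in>UNIV. v $ i * v $ j * Y i j) = I (\<lambda>z. 2 * (z \<bullet> v)\<^sup>2 * p z - q z)"
  proof -
    have "(\<Sum>i\<in>UNIV. \<Sum>j\<in>UNIV. v $ i * v $ j * Y i j)
       = I (\<lambda>z. \<Sum>i\<in>UNIV. \<Sum>j\<in>UNIV. v $ i * v $ j * (2 * (z $ i * z $ j) * p z - (if i = j then 1 else 0) * q z))"
      unfolding Y I_cmult[symmetric] by (subst I_sum[symmetric] | auto intro!: continuous_intros)+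
    also have "(\<lambda>z. \<Sum>i\<in>UNIV. \<Sum>j\<in>UNIV. v $ i * v $ j * (2 * (z $ i * z $ j) * p z - (if i = j then 1 else 0) * q z))
       = (\<lambda>z. 2 * (z \<bullet> v)\<^sup>2 * p z - q z)"
    proof
      fix z
      have "(\<Sum>i\<in>UNIV. \<Sum>j\<in>UNIV. v $ i * v $ j * (2 * (z $ i * z $ j) * p z - (if i = j then 1 else 0) * q z))
         = (\<Sum>i\<in>UNIV. \<Sum>j\<in>UNIV. (z $ i * v $ i) * (z $ j * v $ j) * (2 * p z)) - (\<Sum>i\<in>UNIV. \<Sum>j\<in>UNIV. if i = j then v $ i * v $ j * q z else 0)"
        unfolding sum_subtractf[symmetric] by (intro sum.cong refl) (simp add: algebra_simps)
      also have "(\<Sum>i\<in>UNIV. \<Sum>j\<in>UNIV. (z $ i * v $ i) * (z $ j * v $ j) * (2 * p z)) = (z \<bullet> v)\<^sup>2 * (2 * p z)"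
      proof -
        have sq: "(z \<bullet> v)\<^sup>2 = (\<Sum>i\<in>UNIV. \<Sum>j\<in>UNIV. (z $ i * v $ i) * (z $ j * v $ j))"
          by (simp only: inner_vec_def inner_real_def power2_eq_square sum_product)
        show ?thesis unfolding sq sum_distrib_right ..
      qed
      also have "(\<Sum>i\<in>UNIV. \<Sum>j\<in>UNIV. if i = j then v $ i * v $ j * q z else 0) = q z"
        using vv by (simp flip: sum_distrib_right)
      finally show "(\<Sum>i\<in>UNIV. \<Sum>j\<in>UNIV. v $ i * v $ j * (2 * (z $ i * z $ j) * p z - (if i = j then 1 else 0) * q z))
        = 2 * (z \<bullet> v)\<^sup>2 * p z - q z" by simp
    qed
    finally show ?thesis .
  qed
  have YT: "(\<Sum>i\<in>UNIV. Y i i) = I (\<lambda>z. 2 * (z \<bullet> z) * p z - n * q z)"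
  proof -
    have "(\<Sum>i\<in>UNIV. Y i i) = I (\<lambda>z. \<Sum>i\<in>UNIV. 2 * (z $ i * z $ i) * p z - (if i = i then 1 else 0) * q z)"
      unfolding Y by (subst I_sum[symmetric]) (auto intro!: continuous_intros)
    also have "(\<lambda>z. \<Sum>i\<in>UNIV. 2 * (z $ i * z $ i) * p z - (if i = i then 1 else 0) * q z) = (\<lambda>z. 2 * (z \<bullet> z) * p z - n * q z)"
      by (rule ext) (simp add: sum_subtractf n_def inner_vec_def sum_distrib_left sum_distrib_right)
    finally show ?thesis .
  qed
  \<comment> \<open>The part of the gradient orthogonal to \<open>v\<close>.\<close>
  define w :: "real ^ 'n" where "w = (\<chi> i. X i) - (\<Sum>i\<in>UNIV. v $ i * X i) *\<^sub>R v"
  define y where "y z = z - (z \<bullet> v) *\<^sub>R v" for z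
  have wv: "w \<bullet> v = 0"
  proof -
    have "(\<Sum>i\<in>UNIV. v $ i * X i) = (\<chi> i. X i) \<bullet> v" by (simp add: inner_vec_def mult.commute)
    then show ?thesis by (simp add: w_def inner_diff_left v)
  qed
  have ww: "w \<bullet> w = (\<Sum>i\<in>UNIV. (X i)\<^sup>2) - (\<Sum>i\<in>UNIV. v $ i * X i)\<^sup>2"
  proof -
    define x :: "real ^ 'n" where "x = (\<chi> i. X i)"
    have xv: "(\<Sum>i\<in>UNIV. v $ i * X i) = x \<bullet> v" by (simp add: x_def inner_vec_def mult.commute)
    have "w \<bullet> w = x \<bullet> x - (x \<bullet> v)\<^sup>2"
      using v by (simp add: w_def xv inner_diff_left inner_diff_right inner_commute[of v x] power2_eq_square flip: x_def)
    moreover have "x \<bullet> x = (\<Sum>i\<in>UNIV. (X i)\<^sup>2)" by (simp add: x_def inner_vec_def power2_eq_square)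
    ultimately show ?thesis by (simp add: xv)
  qed
  have wX: "w \<bullet> w = I (\<lambda>z. (w \<bullet> z) * q z)"
  proof -
    have "w \<bullet> w = w \<bullet> (\<chi> i. X i)"
    proof -
      have "w \<bullet> w = w \<bullet> ((\<chi> i. X i) - (\<Sum>i\<in>UNIV. v $ i * X i) *\<^sub>R v)" by (simp add: w_def)
      also have "\<dots> = w \<bullet> (\<chi> i. X i)" by (simp only: inner_diff_right inner_scaleR_right wv mult_zero_right diff_zero)
      finally show ?thesis .
    qed
    also have "\<dots> = (\<Sum>i\<in>UNIV. I (\<lambda>z. w $ i * (z $ i * q z)))"
      unfolding I_cmult by (simp add: inner_vec_def X)
    also have "\<dots> = I (\<lambda>z. \<Sum>i\<in>UNIV. w $ i * (z $ i * q z))"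
      by (rule I_sum[symmetric]) (auto intro!: continuous_intros)
    also have "(\<lambda>z. \<Sum>i\<in>UNIV. w $ i * (z $ i * q z)) = (\<lambda>z. (w \<bullet> z) * q z)"
      by (simp add: fun_eq_iff inner_vec_def sum_distrib_right mult.assoc)
    finally show ?thesis .
  qed
  have ysq: "y z \<bullet> y z = z \<bullet> z - (z \<bullet> v)\<^sup>2" for z
    using v by (simp add: y_def inner_diff_left inner_diff_right inner_commute[of v z] power2_eq_square)
  have "w \<bullet> w \<le> I (\<lambda>z. (w \<bullet> w) / (4 * \<kappa>) + \<kappa> * ((z \<bullet> z - (z \<bullet> v)\<^sup>2) * (q z)\<^sup>2))"
    unfolding wX
  proof (rule I_mono)
    fix z
    \<comment> \<open>The weights are balanced for a total mass of at most \<open>2 * \<kappa>\<close>: they leave the factor \<open>1 / 2\<close> below.\<close>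
    have "0 \<le> (w - (2 * \<kappa> * q z) *\<^sub>R y z) \<bullet> (w - (2 * \<kappa> * q z) *\<^sub>R y z)" by (rule inner_ge_zero)
    also have "\<dots> = w \<bullet> w - 4 * \<kappa> * (q z * (w \<bullet> y z)) + (2 * \<kappa> * q z)\<^sup>2 * (y z \<bullet> y z)"
      by (simp add: inner_diff_left inner_diff_right inner_commute[of "y z" w] power2_eq_square algebra_simps)
    also have "w \<bullet> y z = w \<bullet> z" by (simp add: y_def inner_diff_right wv)
    finally have *: "4 * \<kappa> * (q z * (w \<bullet> z)) \<le> w \<bullet> w + (2 * \<kappa> * q z)\<^sup>2 * (y z \<bullet> y z)" by simp
    have "q z * (w \<bullet> z) = 4 * \<kappa> * (q z * (w \<bullet> z)) / (4 * \<kappa>)" using \<kappa> by simp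
    also have "\<dots> \<le> (w \<bullet> w + (2 * \<kappa> * q z)\<^sup>2 * (y z \<bullet> y z)) / (4 * \<kappa>)"
      using * \<kappa> by (intro divide_right_mono) auto
    also have "\<dots> = (w \<bullet> w) / (4 * \<kappa>) + \<kappa> * ((y z \<bullet> y z) * (q z)\<^sup>2)"
      using \<kappa> by (simp add: power2_eq_square field_simps)
    finally show "(w \<bullet> z) * q z \<le> I (\<lambda>z. (w \<bullet> z) * q z) / (4 * \<kappa>) + \<kappa> * ((z \<bullet> z - (z \<bullet> v)\<^sup>2) * (q z)\<^sup>2)"
      unfolding ysq wX[symmetric] by (simp add: mult.commute)
  qed (intro continuous_intros; use \<kappa> in simp)+
  also have "\<dots> = (w \<bullet> w) / (4 * \<kappa>) * I (\<lambda>z. 1) + \<kappa> * I (\<lambda>z. (z \<bullet> z - (z \<bullet> v)\<^sup>2) * (q z)\<^sup>2)"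
    using I_cmult[of "(w \<bullet> w) / (4 * \<kappa>)" "\<lambda>z. 1"]
    by (subst I_add) (auto intro!: continuous_intros simp: I_cmult)
  also have "(w \<bullet> w) / (4 * \<kappa>) * I (\<lambda>z. 1) \<le> (w \<bullet> w) / (4 * \<kappa>) * (2 * \<kappa>)"
    using I_1 \<kappa> by (intro mult_left_mono) auto
  also have "\<dots> = (w \<bullet> w) / 2" using \<kappa> by simp
  finally have cauchy: "w \<bullet> w \<le> 2 * \<kappa> * I (\<lambda>z. (z \<bullet> z - (z \<bullet> v)\<^sup>2) * (q z)\<^sup>2)" by simp
  define h where "h z = (n - 2) * (q z - 2 * (z \<bullet> v)\<^sup>2 * p z) + (n * q z - 2 * (z \<bullet> z) * p z)
     - 2 * (n - 2) * ((z \<bullet> z - (z \<bullet> v)\<^sup>2) * (q z)\<^sup>2)" for z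
  have "I (\<lambda>z. - (2 * (n - 1) * \<delta>)) \<le> I h"
  proof (rule I_mono)
    fix z :: "real ^ 'n"
    have s: "z \<bullet> z \<ge> 0" by simp
    show "- (2 * (n - 1) * \<delta>) \<le> h z"
      unfolding h_def
    proof (rule kernel_inequality)
      show "0 \<le> q z" unfolding q_def by (rule q_ker_nonneg[OF \<epsilon>(1)])
      show "(z \<bullet> z) * q z \<le> 1" unfolding q_def by (rule q_ker_le[OF \<epsilon> _ s]) (use N in simp)
      show "(z \<bullet> z) * p z \<le> q z + \<delta>" unfolding q_def p_def \<delta>_def by (rule p_ker_le[OF \<epsilon> _ s]) (use N m in simp)
      show "(z \<bullet> v)\<^sup>2 \<le> z \<bullet> z" using ysq[of z] inner_ge_zero[of "y z"] by simp
    qed (use \<delta> n in auto)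
  qed (auto simp: h_def intro!: continuous_intros)
  moreover have "I (\<lambda>z. - (2 * (n - 1) * \<delta>)) = - (2 * (n - 1) * \<delta>) * I (\<lambda>z. 1)"
    using I_cmult[of "- (2 * (n - 1) * \<delta>)" "\<lambda>z. 1"] by simp
  moreover have "2 * (n - 1) * \<delta> * I (\<lambda>z. 1) \<le> 2 * (n - 1) * \<delta> * (2 * \<kappa>)"
    using I_1 \<delta> n by (intro mult_left_mono) auto
  ultimately have Ih: "- (4 * (n - 1) * \<kappa> * \<delta>) \<le> I h" by (simp add: mult_ac)
  have Ih_eq: "I h = (n - 2) * (- I (\<lambda>z. 2 * (z \<bullet> v)\<^sup>2 * p z - q z)) + - I (\<lambda>z. 2 * (z \<bullet> z) * p z - n * q z)
      - 2 * (n - 2) * I (\<lambda>z. (z \<bullet> z - (z \<bullet> v)\<^sup>2) * (q z)\<^sup>2)"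
  proof -
    let ?g1 = "\<lambda>z. 2 * (z \<bullet> v)\<^sup>2 * p z - q z" and ?g2 = "\<lambda>z. 2 * (z \<bullet> z) * p z - n * q z"
      and ?g3 = "\<lambda>z. (z \<bullet> z - (z \<bullet> v)\<^sup>2) * (q z)\<^sup>2"
    have "h = (\<lambda>z. - (n - 2) * ?g1 z + (- 1 * ?g2 z + - (2 * (n - 2)) * ?g3 z))"
      by (simp add: h_def fun_eq_iff algebra_simps)
    then have "I h = - (n - 2) * I ?g1 + (- 1 * I ?g2 + - (2 * (n - 2)) * I ?g3)"
      by (simp only:) (subst I_add, (auto intro!: continuous_intros)[2], subst I_add, (auto intro!: continuous_intros)[2], simp only: I_cmult)
    then show ?thesis
      by (simp only: mult_minus_left mult_minus_right mult_1_left diff_conv_add_uminus add.assoc)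
  qed
  have "\<kappa> * I h = (n - 2) * (- \<kappa> * (\<Sum>i\<in>UNIV. \<Sum>j\<in>UNIV. v $ i * v $ j * Y i j)) - \<kappa> * (\<Sum>i\<in>UNIV. Y i i)
      - (n - 2) * (2 * \<kappa> * I (\<lambda>z. (z \<bullet> z - (z \<bullet> v)\<^sup>2) * (q z)\<^sup>2))"
    unfolding Ih_eq YV YT by (simp add: algebra_simps)
  also have "\<dots> \<le> (n - 2) * (- \<kappa> * (\<Sum>i\<in>UNIV. \<Sum>j\<in>UNIV. v $ i * v $ j * Y i j)) - \<kappa> * (\<Sum>i\<in>UNIV. Y i i)
      - (n - 2) * (w \<bullet> w)"
    using mult_left_mono[OF cauchy, of "n - 2"] n by simp
  also have "\<dots> = (n - 2) * ((\<Sum>i\<in>UNIV. v $ i * X i)\<^sup>2 - \<kappa> * (\<Sum>i\<in>UNIV. \<Sum>j\<in>UNIV. v $ i * v $ j * Y i j))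
      - \<kappa> * (\<Sum>i\<in>UNIV. Y i i) - (n - 2) * (\<Sum>i\<in>UNIV. (X i)\<^sup>2)"
    unfolding ww by (simp add: algebra_simps)
  finally have "\<kappa> * I h \<le> (n - 2) * ((\<Sum>i\<in>UNIV. v $ i * X i)\<^sup>2 - \<kappa> * (\<Sum>i\<in>UNIV. \<Sum>j\<in>UNIV. v $ i * v $ j * Y i j))
      - \<kappa> * (\<Sum>i\<in>UNIV. Y i i) - (n - 2) * (\<Sum>i\<in>UNIV. (X i)\<^sup>2)" .
  moreover have "- (4 * (n - 1) * \<kappa>\<^sup>2 * \<delta>) \<le> \<kappa> * I h"
    using mult_left_mono[OF Ih, of \<kappa>] \<kappa> by (simp add: power2_eq_square mult_ac)
  ultimately show ?thesis unfolding \<delta>_def by linarith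
qed

text \<open>As \<open>\<epsilon> \<rightarrow> 0\<close> the Taylor polynomials at \<open>\<epsilon>\<close> tend to \<open>\<kappa>\<close> times the derivatives of \<open>u\<close> at the
  origin, and as \<open>T \<rightarrow> \<infinity>\<close> those at \<open>T\<close> tend to \<open>0\<close>. Moving two
  derivatives onto the kernel lowers its index from \<open>4\<close> to \<open>2\<close>, the smallest one for which
  averages can be differentiated in \<open>\<tau>\<close>.\<close>

lemma ricci_form_nonneg_at_0:
  fixes v :: "real ^ 'n"
  assumes v: "v \<bullet> v = 1"
  shows "v \<bullet> (ricci (conformal_metric u) 0 *v v) \<ge> 0"
proof -
  define N :: nat where "N = 4"
  define \<kappa> where "\<kappa> = ker_mass TYPE('n) N"
  define n where "n = real CARD('n)"
  define E1 where "E1 i = taylor_at_0 m (lap_chain N (pd i u))" for i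
  define E2 where "E2 i j = taylor_at_0 m (lap_chain N (pd i (pd j u)))" for i j
  define F where "F X Y = (n - 2) * ((\<Sum>i\<in>UNIV. v $ i * X i)\<^sup>2 - \<kappa> * (\<Sum>i\<in>UNIV. \<Sum>j\<in>UNIV. v $ i * v $ j * Y i j))
      - \<kappa> * (\<Sum>i\<in>UNIV. Y i i) - (n - 2) * (\<Sum>i\<in>UNIV. (X i)\<^sup>2)" for X :: "'n \<Rightarrow> real" and Y :: "'n \<Rightarrow> 'n \<Rightarrow> real"
  have F_lim: "((\<lambda>t. F (X t) (Y t)) \<longlongrightarrow> F X0 Y0) A"
    if "\<And>i. ((\<lambda>t. X t i) \<longlongrightarrow> X0 i) A" "\<And>i j. ((\<lambda>t. Y t i j) \<longlongrightarrow> Y0 i j) A"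
    for X Y X0 Y0 and A :: "real filter"
    unfolding F_def by (intro tendsto_intros that)
  have \<kappa>: "\<kappa> > 0" unfolding \<kappa>_def by (rule ker_mass_pos) (simp add: N_def)
  have at0: "(taylor_at_0 m (lap_chain N w) \<longlongrightarrow> \<kappa> * w 0) (at_right 0)" if w: "C_inf w" for w :: "real ^ 'n \<Rightarrow> real"
  proof -
    have "(taylor_at_0 m (lap_chain N w) \<longlongrightarrow> ker_mass TYPE('n) (N + 0) * nlap 0 w 0) (at_right 0)"
    proof (rule taylor_at_0_tendsto_at_0[where L = "\<lambda>j. ker_mass TYPE('n) (N + j) * nlap j w 0"])
      show "(lap_chain N w j \<longlongrightarrow> ker_mass TYPE('n) (N + j) * nlap j w 0) (at_right 0)" for j
        unfolding lap_chain_def[abs_def]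
        by (rule ker_avg_tendsto[OF C_inf_continuous[OF C_inf_neg_laplacian_power[OF w]] _ even_dim]) (simp add: N_def)
    qed (use m in simp)
    then show ?thesis by (simp add: \<kappa>_def)
  qed
  have bound_T: "F (\<lambda>i. \<kappa> * pd i u 0 - E1 i T) (\<lambda>i j. \<kappa> * pd i (pd j u) 0 - E2 i j T)
      \<ge> - (4 * (n - 1) * \<kappa>\<^sup>2 * (real (N + m) / T))" if T: "T > 0" for T
  proof (rule tendsto_lowerbound[OF F_lim])
    show "((\<lambda>\<epsilon>. E1 i \<epsilon> - E1 i T) \<longlongrightarrow> \<kappa> * pd i u 0 - E1 i T) (at_right 0)" for i
      unfolding E1_def by (intro tendsto_diff tendsto_const at0 C_inf_pd u)
    show "((\<lambda>\<epsilon>. E2 i j \<epsilon> - E2 i j T) \<longlongrightarrow> \<kappa> * pd i (pd j u) 0 - E2 i j T) (at_right 0)" for i j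
      unfolding E2_def by (intro tendsto_diff tendsto_const at0 C_inf_pd u)
    have "- (4 * (n - 1) * \<kappa>\<^sup>2 * (real (N + m) / T)) \<le> F (\<lambda>i. E1 i \<epsilon> - E1 i T) (\<lambda>i j. E2 i j \<epsilon> - E2 i j T)"
      if "0 < \<epsilon>" "\<epsilon> < T" for \<epsilon>
      unfolding F_def E1_def E2_def n_def \<kappa>_def
      by (rule truncated_ricci_bound[OF that(1) less_imp_le[OF that(2)] _ v]) (simp add: N_def)
    then show "\<forall>\<^sub>F \<epsilon> in at_right 0. - (4 * (n - 1) * \<kappa>\<^sup>2 * (real (N + m) / T)) \<le> F (\<lambda>i. E1 i \<epsilon> - E1 i T) (\<lambda>i j. E2 i j \<epsilon> - E2 i j T)"
      using T by (auto simp: eventually_at_right_field)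
  qed simp
  have "0 \<le> F (\<lambda>i. \<kappa> * pd i u 0 - 0) (\<lambda>i j. \<kappa> * pd i (pd j u) 0 - 0)"
  proof (rule tendsto_le[OF trivial_limit_at_top_linorder F_lim])
    show "((\<lambda>T. \<kappa> * pd i u 0 - E1 i T) \<longlongrightarrow> \<kappa> * pd i u 0 - 0) at_top" for i
      unfolding E1_def using taylor_at_0_pd_tendsto_0[of 3] by (intro tendsto_diff tendsto_const) (simp add: N_def)
    show "((\<lambda>T. \<kappa> * pd i (pd j u) 0 - E2 i j T) \<longlongrightarrow> \<kappa> * pd i (pd j u) 0 - 0) at_top" for i j
      unfolding E2_def using taylor_at_0_pd_pd_tendsto_0[of 2] by (intro tendsto_diff tendsto_const) (simp add: N_def)
    have "((\<lambda>T. - (4 * (n - 1) * \<kappa>\<^sup>2 * (real (N + m) / T))) \<longlongrightarrow> - (4 * (n - 1) * \<kappa>\<^sup>2 * 0)) at_top"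
      by (intro tendsto_minus tendsto_mult tendsto_const tendsto_divide_0[OF tendsto_const]
          filterlim_at_top_imp_at_infinity filterlim_ident)
    then show "((\<lambda>T. - (4 * (n - 1) * \<kappa>\<^sup>2 * (real (N + m) / T))) \<longlongrightarrow> 0) at_top" by simp
    show "\<forall>\<^sub>F T in at_top. - (4 * (n - 1) * \<kappa>\<^sup>2 * (real (N + m) / T))
        \<le> F (\<lambda>i. \<kappa> * pd i u 0 - E1 i T) (\<lambda>i j. \<kappa> * pd i (pd j u) 0 - E2 i j T)"
      using eventually_gt_at_top[of 0] by eventually_elim (rule bound_T)
  qed
  also have "F (\<lambda>i. \<kappa> * pd i u 0 - 0) (\<lambda>i j. \<kappa> * pd i (pd j u) 0 - 0) = \<kappa>\<^sup>2 * (v \<bullet> (ricci (conformal_metric u) 0 *v v))"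
  proof -
    have 1: "(\<Sum>i\<in>UNIV. v $ i * (\<kappa> * pd i u 0)) = \<kappa> * (\<Sum>i\<in>UNIV. v $ i * pd i u 0)"
      by (simp add: sum_distrib_left mult_ac)
    have 2: "(\<Sum>i\<in>UNIV. \<Sum>j\<in>UNIV. v $ i * v $ j * (\<kappa> * pd i (pd j u) 0)) = \<kappa> * (\<Sum>i\<in>UNIV. \<Sum>j\<in>UNIV. v $ i * v $ j * pd i (pd j u) 0)"
      by (simp add: sum_distrib_left mult_ac)
    have 3: "(\<Sum>i\<in>UNIV. \<kappa> * pd i (pd i u) 0) = - (\<kappa> * neg_laplacian u 0)"
      by (simp add: neg_laplacian_def sum_distrib_left)
    have 4: "(\<Sum>i\<in>UNIV. (\<kappa> * pd i u 0)\<^sup>2) = \<kappa>\<^sup>2 * (\<Sum>i\<in>UNIV. (pd i u 0)\<^sup>2)"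
      by (simp add: sum_distrib_left power_mult_distrib)
    show ?thesis
      unfolding F_def diff_zero 1 2 3 4 ricci_form_conformal[OF u] v n_def[symmetric]
      by (simp add: power2_eq_square algebra_simps)
  qed
  finally show ?thesis using \<kappa> by (simp add: zero_le_mult_iff)
qed

end

theorem theorem1p2:
  fixes u :: "real ^ 'n::finite \<Rightarrow> real"
  assumes "CARD('n) \<ge> 4" and "even CARD('n)"
    and "C_inf u"
    and "riem_complete (conformal_metric u)"
    and "\<forall>x. Q_curvature u x \<ge> 0"
    and "\<forall>x. scalar_curvature (conformal_metric u) x \<ge> 0"
  shows "ricci_nonneg (conformal_metric u)"
  unfolding ricci_nonneg_def
proof (intro allI)
  fix x v :: "real ^ 'n"
  define m where "m = CARD('n) div 2"
  have m: "CARD('n) = 2 * m" "m \<ge> 2" using assms(1,2) by (auto simp: m_def)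
  interpret nonneg_curvatures u m
  proof
    fix x
    show "nlap m u x \<ge> 0"
      using assms(5) unfolding m_def Q_curvature_eq by simp
    have "0 \<le> exp (- (2 * u x)) * (real CARD('n) - 1) *
        (2 * neg_laplacian u x - (real CARD('n) - 2) * (\<Sum>i\<in>UNIV. (pd i u x)\<^sup>2))"
      using assms(6) unfolding scalar_curvature_conformal[OF assms(3)] by blast
    moreover have "exp (- (2 * u x)) * (real CARD('n) - 1) > 0" using assms(1) by simp
    ultimately have "0 \<le> 2 * neg_laplacian u x - (real CARD('n) - 2) * (\<Sum>i\<in>UNIV. (pd i u x)\<^sup>2)"
      by (metis zero_le_mult_iff less_le_not_le)
    then show "- neg_laplacian u x + (real m - 1) * (\<Sum>i\<in>UNIV. (pd i u x)\<^sup>2) \<le> 0"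
      by (simp add: m(1) algebra_simps)
  qed (use m assms(3) in auto)
  define w where "w = (\<lambda>z. u (x + z))"
  interpret w: nonneg_curvatures w m unfolding w_def by (rule nonneg_curvatures_translate)
  show "v \<bullet> (ricci (conformal_metric u) x *v v) \<ge> 0"
  proof (cases "v = 0")
    case False
    define e where "e = v /\<^sub>R norm v"
    have v: "v = norm v *\<^sub>R e" and e: "e \<bullet> e = 1"
      using False by (simp_all add: e_def dot_square_norm power2_eq_square)
    have "ricci (conformal_metric w) 0 = ricci (conformal_metric u) x"
      unfolding vec_eq_iff ricci_conformal[OF assms(3)] ricci_conformal[OF w.u]
      by (simp add: w_def pd_translate_C_inf neg_laplacian_translate assms(3) C_inf_pd)
    with w.ricci_form_nonneg_at_0[OF e] have "0 \<le> e \<bullet> (ricci (conformal_metric u) x *v e)" by simp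
    then have "0 \<le> (norm v)\<^sup>2 * (e \<bullet> (ricci (conformal_metric u) x *v e))" by simp
    also have "\<dots> = v \<bullet> (ricci (conformal_metric u) x *v v)"
      by (subst (2 3) v) (simp add: matrix_vector_mult_scaleR power2_eq_square)
    finally show ?thesis .
  qed simp
qed

end
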